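(* Let $m\ge2$, $N>2m$ and let $\Omega\subset\mathbb{R}^N$ be a bounded smooth domain with $0\in\Omega$. Let $\mathcal{K}\subset\mathbb{R}^N$ be a fixed compact set and, for all $\varepsilon>0$, let $K_\varepsilon=\varepsilon\mathcal{K}$. Let $\lambda_J$ be an eigenvalue of $(-\Delta)^m$ in $\Omega$ with Dirichlet boundary conditions and let $u_J\in H^m_0(\Omega)$ be a corresponding eigenfunction normalized in $L^2(\Omega)$. Let $\gamma$ and $U_0$ be the vanishing order and the limiting homogeneous polynomial of $u_J$ at $0$ (as defined in the context). Then $$\mathrm{cap}_{m,\Omega}(K_\varepsilon,u_J)=\varepsilon^{N-2m+2\gamma}\big(\mathrm{cap}_{m,\mathbb{R}^N}(\mathcal{K},U_0)+o(1)\big)\qquad\text{as }\varepsilon\to0.$$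
   Context: Functions are real valued. $\nabla^m f:=\Delta^{m/2}f$ if $m$ is even and $\nabla^m f:=\nabla\Delta^{(m-1)/2}f$ if $m$ is odd. $H^m_0(\Omega)$ is the closure of $C_0^\infty(\Omega)$ in $H^m(\Omega)$; for $K\subset\Omega$ compact, $H^m_0(\Omega\setminus K)$ is the closure of $C_0^\infty(\Omega\setminus K)$ in $H^m(\Omega)$. Eigenpair (Dirichlet): $u_J\in H^m_0(\Omega)\setminus\{0\}$ and $\int_\Omega\nabla^m u_J\,\nabla^m\varphi=\lambda_J\int_\Omega u_J\varphi$ for all $\varphi\in H^m_0(\Omega)$. Capacity in $\Omega$: for $K\subset\Omega$ compact and $u\in H^m_0(\Omega)$, $\mathrm{cap}_{m,\Omega}(K,u):=\inf\{\int_\Omega|\nabla^m f|^2: f\in H^m_0(\Omega),\ f-u\in H^m_0(\Omega\setminus K)\}$. (Note $K_\varepsilon\subset\Omega$ for $\varepsilon$ small.) Capacity in $\mathbb{R}^N$ ($N>2m$): $D^{m,2}_0(\mathbb{R}^N)$ is the completion of $C_0^\infty(\mathbb{R}^N)$ for the norm $\|\nabla^m\cdot\|_{L^2(\mathbb{R}^N)}$ (a space of functions, embedded in $L^{2N/(N-2m)}(\mathbb{R}^N)$), and $D^{m,2}_0(\mathbb{R}^N\setminus\mathcal{K})$ is the closure in it of $C_0^\infty(\mathbb{R}^N\setminus\mathcal{K})$. For $u\in H^m_{loc}(\mathbb{R}^N)$, $\mathrm{cap}_{m,\mathbb{R}^N}(\mathcal{K},u):=\inf\{\int_{\mathbb{R}^N}|\nabla^m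 f|^2: f\in D^{m,2}_0(\mathbb{R}^N),\ f-\eta u\in D^{m,2}_0(\mathbb{R}^N\setminus\mathcal{K})\}$, where $\eta\in C_0^\infty(\mathbb{R}^N)$ is any function equal to $1$ in a neighbourhood of $\mathcal{K}$ (the value does not depend on $\eta$). $\gamma$ and $U_0$: since $u_J$ is analytic and nontrivial near $0$, there exist $\gamma\in\mathbb{N}$ (possibly $0$) and a $\gamma$-homogeneous polyharmonic polynomial $U_0\not\equiv0$ (i.e. $(-\Delta)^mU_0=0$) such that $u_J(\varepsilon\,\cdot)/\varepsilon^\gamma\to U_0$ in $H^m(B_R(0))$ as $\varepsilon\to0$, for all $R>0$. *)

theory Defs
  imports "HOL-Analysis.Analysis" "HOL-Library.Landau_Symbols"
begin

subsection \<open>Smooth functions and classical derivatives\<close>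

definition partial :: "'a::euclidean_space \<Rightarrow> ('a \<Rightarrow> real) \<Rightarrow> 'a \<Rightarrow> real" where
  "partial b f x = frechet_derivative f (at x) b"

text \<open>
  Higher partial derivatives are indexed by lists of basis vectors instead of multi-indices;
  a multi-index \<open>\<alpha>\<close> with \<open>|\<alpha>| = k\<close> corresponds to \<open>k!/\<alpha>!\<close> lists of length \<open>k\<close>.
\<close>

definition partials :: "'a::euclidean_space list \<Rightarrow> ('a \<Rightarrow> real) \<Rightarrow> 'a \<Rightarrow> real" where
  "partials bs f = foldr partial bs f"

definition smooth :: "('a::euclidean_space \<Rightarrow> real) \<Rightarrow> bool" where
  "smooth f \<longleftrightarrow> (\<forall>bs\<in>lists Basis. \<forall>x. partials bs f differentiable (at x))"

definition laplacian :: "('a::euclidean_space \<Rightarrow> real) \<Rightarrow> 'a \<Rightarrow> real" where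
  "laplacian f x = (\<Sum>b\<in>Basis. partials [b, b] f x)"

definition test_functions :: "'a::euclidean_space set \<Rightarrow> ('a \<Rightarrow> real) set" where
  "test_functions U = {\<phi>. smooth \<phi> \<and> compact (closure {x. \<phi> x \<noteq> 0}) \<and> closure {x. \<phi> x \<noteq> 0} \<subseteq> U}"

text \<open>
  The boundary is locally, after a rotation, the graph of a smooth function over the hyperplane
  orthogonal to a unit vector \<open>e\<close>, and \<open>\<Omega>\<close> is locally the set above that graph.
\<close>

definition smooth_boundary :: "'a::euclidean_space set \<Rightarrow> bool" where
  "smooth_boundary \<Omega> \<longleftrightarrow>
     (\<forall>p\<in>frontier \<Omega>. \<exists>r>0. \<exists>e g. norm e = 1 \<and> smooth g \<and>
        \<Omega> \<inter> ball p r = {x \<in> ball p r. g (x - (x \<bullet> e) *\<^sub>R e) < x \<bullet> e})"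

definition bounded_smooth_domain :: "'a::euclidean_space set \<Rightarrow> bool" where
  "bounded_smooth_domain \<Omega> \<longleftrightarrow>
     \<Omega> \<noteq> {} \<and> open \<Omega> \<and> connected \<Omega> \<and> bounded \<Omega> \<and> smooth_boundary \<Omega>"


subsection \<open>Lebesgue and Sobolev spaces\<close>

text \<open>
  Elements of function spaces on an open set \<open>\<Omega>\<close> are represented by functions on the whole
  space; only their values almost everywhere in \<open>\<Omega>\<close> matter.
\<close>

definition Lp :: "real \<Rightarrow> 'a::euclidean_space set \<Rightarrow> ('a \<Rightarrow> real) set" where
  "Lp p \<Omega> = {f. f \<in> borel_measurable (lebesgue_on \<Omega>) \<and>
                integrable (lebesgue_on \<Omega>) (\<lambda>x. \<bar>f x\<bar> powr p)}"

definition Lp_norm :: "real \<Rightarrow> 'a::euclidean_space set \<Rightarrow> ('a \<Rightarrow> real) \<Rightarrow> real" where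
  "Lp_norm p \<Omega> f = (\<integral>x. \<bar>f x\<bar> powr p \<partial>lebesgue_on \<Omega>) powr (1 / p)"

definition locally_integrable :: "'a::euclidean_space set \<Rightarrow> ('a \<Rightarrow> real) \<Rightarrow> bool" where
  "locally_integrable \<Omega> f \<longleftrightarrow> (\<forall>C. compact C \<and> C \<subseteq> \<Omega> \<longrightarrow> integrable (lebesgue_on C) f)"

definition has_weak_partials ::
  "'a::euclidean_space set \<Rightarrow> 'a list \<Rightarrow> ('a \<Rightarrow> real) \<Rightarrow> ('a \<Rightarrow> real) \<Rightarrow> bool" where
  "has_weak_partials \<Omega> bs f g \<longleftrightarrow>
     locally_integrable \<Omega> f \<and> locally_integrable \<Omega> g \<and>
     (\<forall>\<phi>\<in>test_functions \<Omega>.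
        (\<integral>x. f x * partials bs \<phi> x \<partial>lebesgue_on \<Omega>)
          = (-1) ^ length bs * (\<integral>x. g x * \<phi> x \<partial>lebesgue_on \<Omega>))"

text \<open>
  If it exists, the weak derivative is determined up to a null set in \<open>\<Omega>\<close>; an arbitrary
  representative is chosen.
\<close>

definition weak_partials ::
  "'a::euclidean_space set \<Rightarrow> 'a list \<Rightarrow> ('a \<Rightarrow> real) \<Rightarrow> 'a \<Rightarrow> real" where
  "weak_partials \<Omega> bs f = (SOME g. has_weak_partials \<Omega> bs f g)"

definition sobolev_space :: "nat \<Rightarrow> 'a::euclidean_space set \<Rightarrow> ('a \<Rightarrow> real) set" where
  "sobolev_space m \<Omega> =
     {f. \<forall>bs\<in>lists Basis. length bs \<le> m \<longrightarrow> (\<exists>g\<in>Lp 2 \<Omega>. has_weak_partials \<Omega> bs f g)}"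

text \<open>
  Summing over lists gives the norm \<open>(\<Sum>k\<le>m. \<parallel>D\<^sup>k f\<parallel>\<^sup>2)\<^sup>1\<^sup>/\<^sup>2\<close> with the Euclidean (Hilbert--Schmidt)
  norm of the tensor of derivatives of order \<open>k\<close>.
\<close>

definition sobolev_norm :: "nat \<Rightarrow> 'a::euclidean_space set \<Rightarrow> ('a \<Rightarrow> real) \<Rightarrow> real" where
  "sobolev_norm m \<Omega> f =
     sqrt (\<Sum>bs | bs \<in> lists Basis \<and> length bs \<le> m. (Lp_norm 2 \<Omega> (weak_partials \<Omega> bs f))\<^sup>2)"

text \<open>
  Closure of the test functions on \<open>U \<subseteq> \<Omega>\<close> in the Sobolev space on \<open>\<Omega>\<close>: the space
  \<open>H\<^sup>m\<^sub>0(\<Omega>)\<close> is the case \<open>U = \<Omega>\<close>, and \<open>H\<^sup>m\<^sub>0(\<Omega> \<setminus> K)\<close> the case \<open>U = \<Omega> - K\<close>.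
\<close>

definition sobolev0 :: "nat \<Rightarrow> 'a::euclidean_space set \<Rightarrow> 'a set \<Rightarrow> ('a \<Rightarrow> real) set" where
  "sobolev0 m \<Omega> U =
     {f \<in> sobolev_space m \<Omega>.
        \<exists>\<phi>. (\<forall>n::nat. \<phi> n \<in> test_functions U) \<and>
            (\<lambda>n. sobolev_norm m \<Omega> (\<lambda>x. \<phi> n x - f x)) \<longlonglongrightarrow> 0}"


subsection \<open>The operator \<open>\<nabla>\<^sup>m\<close> and the Dirichlet eigenvalue problem\<close>

definition weak_laplacian :: "'a::euclidean_space set \<Rightarrow> ('a \<Rightarrow> real) \<Rightarrow> 'a \<Rightarrow> real" where
  "weak_laplacian \<Omega> f x = (\<Sum>b\<in>Basis. weak_partials \<Omega> [b, b] f x)"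

definition weak_gradient :: "'a::euclidean_space set \<Rightarrow> ('a \<Rightarrow> real) \<Rightarrow> 'a \<Rightarrow> 'a" where
  "weak_gradient \<Omega> f x = (\<Sum>b\<in>Basis. weak_partials \<Omega> [b] f x *\<^sub>R b)"

text \<open>
  \<open>\<nabla>\<^sup>m f\<close> is scalar for even \<open>m\<close> and a vector for odd \<open>m\<close>. Both cases are embedded isometrically
  in the Euclidean space \<open>\<real> \<times> \<real>\<^sup>N\<close>. For odd \<open>m\<close>, \<open>m div 2 = (m - 1) / 2\<close>.
\<close>

definition nabla_pow ::
  "nat \<Rightarrow> 'a::euclidean_space set \<Rightarrow> ('a \<Rightarrow> real) \<Rightarrow> 'a \<Rightarrow> real \<times> 'a" where
  "nabla_pow m \<Omega> f x =
     (if even m then ((weak_laplacian \<Omega> ^^ (m div 2)) f x, 0)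
      else (0, weak_gradient \<Omega> ((weak_laplacian \<Omega> ^^ (m div 2)) f) x))"

definition energy :: "nat \<Rightarrow> 'a::euclidean_space set \<Rightarrow> ('a \<Rightarrow> real) \<Rightarrow> real" where
  "energy m \<Omega> f = (\<integral>x. (norm (nabla_pow m \<Omega> f x))\<^sup>2 \<partial>lebesgue_on \<Omega>)"

definition dirichlet_eigenpair ::
  "nat \<Rightarrow> 'a::euclidean_space set \<Rightarrow> real \<Rightarrow> ('a \<Rightarrow> real) \<Rightarrow> bool" where
  "dirichlet_eigenpair m \<Omega> lam u \<longleftrightarrow>
     u \<in> sobolev0 m \<Omega> \<Omega> \<and> \<not> (AE x in lebesgue_on \<Omega>. u x = 0) \<and>
     (\<forall>\<phi>\<in>sobolev0 m \<Omega> \<Omega>.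
        (\<integral>x. nabla_pow m \<Omega> u x \<bullet> nabla_pow m \<Omega> \<phi> x \<partial>lebesgue_on \<Omega>)
          = lam * (\<integral>x. u x * \<phi> x \<partial>lebesgue_on \<Omega>))"


subsection \<open>Capacities\<close>

definition cap_domain ::
  "nat \<Rightarrow> 'a::euclidean_space set \<Rightarrow> 'a set \<Rightarrow> ('a \<Rightarrow> real) \<Rightarrow> real" where
  "cap_domain m \<Omega> K u =
     Inf {energy m \<Omega> f | f. f \<in> sobolev0 m \<Omega> \<Omega> \<and> (\<lambda>x. f x - u x) \<in> sobolev0 m \<Omega> (\<Omega> - K)}"

definition energy_norm :: "nat \<Rightarrow> ('a::euclidean_space \<Rightarrow> real) \<Rightarrow> real" where
  "energy_norm m f = sqrt (energy m UNIV f)"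

text \<open>
  The completion of the test functions for \<open>energy_norm m\<close>, for \<open>N > 2 m\<close>. The class of a Cauchy
  sequence is identified with the limit of the sequence in \<open>L\<^sup>p\<close>, where \<open>p = 2 N / (N - 2 m)\<close>.
\<close>

definition homogeneous_sobolev :: "nat \<Rightarrow> ('a::euclidean_space \<Rightarrow> real) set" where
  "homogeneous_sobolev m =
     (let p = 2 * real DIM('a) / (real DIM('a) - 2 * real m) in
      {f \<in> Lp p UNIV.
         \<exists>\<phi>. (\<forall>n::nat. \<phi> n \<in> test_functions UNIV) \<and>
             (\<forall>e>0. \<exists>M. \<forall>j\<ge>M. \<forall>k\<ge>M. energy_norm m (\<lambda>x. \<phi> j x - \<phi> k x) < e) \<and>
             (\<lambda>n. Lp_norm p UNIV (\<lambda>x. \<phi> n x - f x)) \<longlonglongrightarrow> 0})"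

definition homogeneous_sobolev0 ::
  "nat \<Rightarrow> 'a::euclidean_space set \<Rightarrow> ('a \<Rightarrow> real) set" where
  "homogeneous_sobolev0 m U =
     {f \<in> homogeneous_sobolev m.
        \<exists>\<phi>. (\<forall>n::nat. \<phi> n \<in> test_functions U) \<and>
            (\<lambda>n. energy_norm m (\<lambda>x. \<phi> n x - f x)) \<longlonglongrightarrow> 0}"

definition cutoff :: "'a::euclidean_space set \<Rightarrow> ('a \<Rightarrow> real) \<Rightarrow> bool" where
  "cutoff K \<eta> \<longleftrightarrow> \<eta> \<in> test_functions UNIV \<and> (\<exists>V. open V \<and> K \<subseteq> V \<and> (\<forall>x\<in>V. \<eta> x = 1))"

text \<open>
  The capacity in the whole space does not depend on the cutoff function \<open>\<eta>\<close> of \<open>K\<close>; it is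
  kept as an explicit argument, to be quantified universally.
\<close>

definition cap_space ::
  "nat \<Rightarrow> ('a::euclidean_space \<Rightarrow> real) \<Rightarrow> 'a set \<Rightarrow> ('a \<Rightarrow> real) \<Rightarrow> real" where
  "cap_space m \<eta> K u =
     Inf {energy m UNIV f | f. f \<in> homogeneous_sobolev m \<and>
            (\<lambda>x. f x - \<eta> x * u x) \<in> homogeneous_sobolev0 m (- K)}"


subsection \<open>Vanishing order and limiting polynomial\<close>

definition blowup_limit ::
  "nat \<Rightarrow> ('a::euclidean_space \<Rightarrow> real) \<Rightarrow> nat \<Rightarrow> ('a \<Rightarrow> real) \<Rightarrow> bool" where
  "blowup_limit m u \<gamma> U \<longleftrightarrow>
     real_polynomial_function U \<and>
     (\<forall>t x. U (t *\<^sub>R x) = t ^ \<gamma> * U x) \<and>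
     (\<forall>x. (-1) ^ m * (laplacian ^^ m) U x = 0) \<and>
     (\<exists>x. U x \<noteq> 0) \<and>
     (\<forall>R>0. ((\<lambda>\<epsilon>. sobolev_norm m (ball 0 R) (\<lambda>x. u (\<epsilon> *\<^sub>R x) / \<epsilon> ^ \<gamma> - U x)) \<longlongrightarrow> 0) (at_right 0))"

end

theory Submission
  imports Defs
begin

text \<open>
  Both capacities are determined by test functions: every competitor is \<open>\<eta> U + \<phi>\<close> (in the whole space), respectively
  \<open>v + \<psi>\<close> with \<open>v\<close> close to \<open>u\<^sub>J\<close> (in \<open>\<Omega>\<close>), up to small errors in energy, where \<open>\<phi>\<close> and \<open>\<psi>\<close> vanish near the compact set.
  After rescaling by \<open>\<epsilon>\<close>, which multiplies the energy of \<open>x \<mapsto> v (\<epsilon> x) / \<epsilon>\<^sup>\<gamma>\<close> by a power of \<open>\<epsilon>\<close>, a competitor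
  of one kind becomes one of the other kind once \<open>\<eta> (U\<^sub>0 - u\<^sub>J (\<epsilon> x) / \<epsilon>\<^sup>\<gamma>)\<close> is added, and the energy of this
  function tends to zero by the blow-up limit. Hence no compactness argument is needed.
  The condition \<open>N > 2 m\<close> enters through a weighted Hardy inequality, which shows that elements of the completion
  have weak derivatives up to order \<open>m\<close>, so that \<open>\<nabla>\<^sup>m\<close> is linear there.
\<close>

subsection \<open>Calculus of iterated partial derivatives\<close>

text \<open>\<open>nabla_pow\<close> iterates arbitrarily chosen representatives, so it is linear
  only almost everywhere, and only on functions whose weak derivatives exist at every level. Making
  the triangle inequality for \<open>enorm\<close> available for each competitor is the main
  obstacle. In \<Omega> it comes from membership in the Sobolev space. In the completion a function
  is given only as an \<open>Lp\<close> limit, and its derivatives of order below m need not be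
  square integrable; hence a power of \<open>hardy_weight\<close>, with an exponent that vanishes at
  order m. Exact scaling is proved on test functions, where integration by parts turns the energy
  into the sum of the squares of all partial derivatives of order m. All estimates concern square
  roots of capacities, because errors then add up. Two errors occur. One comes from replacing u by
  test functions; its constant degenerates as \<epsilon> tends to 0, but it is removed at fixed
  \<epsilon>. The other is the blow-up error, whose constant depends on the cutoff and a fixed ball,
  not on \<epsilon>.\<close>

lemma partials_Nil [simp]: "partials [] f = f"
  by (simp add: partials_def)

lemma partials_Cons: "partials (b # bs) f = partial b (partials bs f)"
  by (simp add: partials_def)

lemma partials_append: "partials (bs @ cs) f = partials bs (partials cs f)"
  by (simp add: partials_def)

lemma partial_eqI:
  assumes "\<And>x. (f has_derivative f' x) (at x)"
  shows "partial b f = (\<lambda>x. f' x b)"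
  unfolding partial_def using frechet_derivative_at[OF assms] by auto

lemma has_derivative_frechet:
  "f differentiable (at x) \<Longrightarrow> (f has_derivative (\<lambda>h. partial h f x)) (at x)"
  unfolding partial_def frechet_derivative_works by simp

text \<open>The recursion removes the innermost derivative, so closure under sums, products and
  composition follows by induction on \<open>n\<close> with the function generalised. The lists in
  \<open>smooth\<close> carry the outermost derivative at the head and do not fit such an
  induction.\<close>

primrec diff_times :: "nat \<Rightarrow> ('a::euclidean_space \<Rightarrow> real) \<Rightarrow> bool" where
  "diff_times 0 f \<longleftrightarrow> (\<forall>x. f differentiable (at x))"
| "diff_times (Suc n) f \<longleftrightarrow> (\<forall>x. f differentiable (at x)) \<and> (\<forall>b\<in>Basis. diff_times n (partial b f))"

lemma diff_times_differentiable: "diff_times n f \<Longrightarrow> f differentiable (at x)"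
  by (cases n) auto

lemma diff_times_iff:
  "diff_times n f \<longleftrightarrow> (\<forall>bs\<in>lists Basis. length bs \<le> n \<longrightarrow> (\<forall>x. partials bs f differentiable (at x)))"
proof (induction n arbitrary: f)
  case 0
  then show ?case by auto
next
  case (Suc n)
  show ?case
  proof
    assume L: "diff_times (Suc n) f"
    show "\<forall>bs\<in>lists Basis. length bs \<le> Suc n \<longrightarrow> (\<forall>x. partials bs f differentiable at x)"
    proof (intro ballI impI allI)
      fix bs :: "'a list" and x assume bs: "bs \<in> lists Basis" "length bs \<le> Suc n"
      show "partials bs f differentiable at x"
      \<comment> \<open>The last entry of the list is the derivative taken first, the one that
        \<open>diff_times\<close> removes.\<close>
      proof (cases bs rule: rev_cases)
        case Nil
        then show ?thesis using L by simp
      next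
        case (snoc cs b)
        then have "diff_times n (partial b f)" using L bs by auto
        then have "partials cs (partial b f) differentiable at x" using Suc bs snoc by auto
        then show ?thesis by (simp add: snoc partials_append partials_Cons)
      qed
    qed
  next
    assume R: "\<forall>bs\<in>lists Basis. length bs \<le> Suc n \<longrightarrow> (\<forall>x. partials bs f differentiable at x)"
    have "diff_times n (partial b f)" if b: "b \<in> Basis" for b
      unfolding Suc.IH
    proof (intro ballI impI allI)
      fix bs :: "'a list" and x assume "bs \<in> lists Basis" "length bs \<le> n"
      then show "partials bs (partial b f) differentiable at x"
        using R[rule_format, of "bs @ [b]" x] b by (simp add: partials_append partials_Cons)
    qed
    moreover have "f differentiable at x" for x
      using R[rule_format, of "[]"] by simp
    ultimately show "diff_times (Suc n) f" by simp
  qed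
qed

lemma diff_times_mono: "diff_times n f \<Longrightarrow> k \<le> n \<Longrightarrow> diff_times k f"
  by (auto simp: diff_times_iff)

lemma smooth_iff_diff_times: "smooth f \<longleftrightarrow> (\<forall>n. diff_times n f)"
  unfolding smooth_def diff_times_iff by blast

lemma smooth_differentiable: "smooth f \<Longrightarrow> f differentiable (at x)"
  using diff_times_differentiable smooth_iff_diff_times by blast

lemma smooth_has_derivative:
  "smooth f \<Longrightarrow> (f has_derivative (\<lambda>h. partial h f x)) (at x)"
  by (simp add: has_derivative_frechet smooth_differentiable)

lemma smooth_continuous_on: "smooth f \<Longrightarrow> continuous_on S f"
  by (meson continuous_at_imp_continuous_on differentiable_imp_continuous_within smooth_differentiable)

lemma smooth_partial: "smooth f \<Longrightarrow> b \<in> Basis \<Longrightarrow> smooth (partial b f)"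
  unfolding smooth_iff_diff_times by (meson diff_times.simps(2))

lemma smooth_partials: "smooth f \<Longrightarrow> bs \<in> lists Basis \<Longrightarrow> smooth (partials bs f)"
  by (induction bs) (auto simp: partials_Cons smooth_partial)

lemma partial_const: "partial b (\<lambda>_. c) = (\<lambda>_. 0)"
  by (rule partial_eqI) auto

lemma diff_times_const: "diff_times n (\<lambda>_. c)"
  by (induction n arbitrary: c) (auto simp: partial_const)

lemma smooth_const: "smooth (\<lambda>_. c)"
  by (simp add: smooth_iff_diff_times diff_times_const)

lemma smooth_bounded_linear:
  assumes "bounded_linear f" shows "smooth f"
  unfolding smooth_iff_diff_times
proof
  fix n
  have 1: "(f has_derivative f) (at x)" for x
    using assms by (simp add: bounded_linear_imp_has_derivative)
  then have "partial b f = (\<lambda>_. f b)" for b by (rule partial_eqI)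
  then show "diff_times n f" using 1
    by (cases n) (auto simp: diff_times_const differentiable_def)
qed

lemma partial_add:
  assumes "\<And>x. f differentiable (at x)" "\<And>x. g differentiable (at x)"
  shows "partial b (\<lambda>x. f x + g x) = (\<lambda>x. partial b f x + partial b g x)"
  by (rule partial_eqI) (intro has_derivative_add has_derivative_frechet assms)

lemma partial_mult:
  assumes "\<And>x. f differentiable (at x)" "\<And>x. g differentiable (at x)"
  shows "partial b (\<lambda>x. f x * g x) = (\<lambda>x. partial b f x * g x + f x * partial b g x)"
proof -
  have "((\<lambda>x. f x * g x) has_derivative (\<lambda>h. f x * partial h g x + partial h f x * g x)) (at x)" for x
    by (intro has_derivative_mult has_derivative_frechet assms)
  from partial_eqI[OF this, of b] show ?thesis by (auto simp: fun_eq_iff)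
qed

lemma partial_cmult:
  assumes "\<And>x. f differentiable (at x)"
  shows "partial b (\<lambda>x. c * f x) = (\<lambda>x. c * partial b f x)"
  using partial_mult[of "\<lambda>_. c" f b] assms by (simp add: partial_const)

lemma diff_times_add: "diff_times n f \<Longrightarrow> diff_times n g \<Longrightarrow> diff_times n (\<lambda>x. f x + g x)"
proof (induction n arbitrary: f g)
  case (Suc n)
  have f: "\<And>x. f differentiable (at x)" and g: "\<And>x. g differentiable (at x)"
    using Suc.prems by auto
  show ?case using Suc by (auto simp: partial_add[OF f g])
qed auto

lemma diff_times_mult: "diff_times n f \<Longrightarrow> diff_times n g \<Longrightarrow> diff_times n (\<lambda>x. f x * g x)"
proof (induction n arbitrary: f g)
  case (Suc n)
  have f: "\<And>x. f differentiable (at x)" and g: "\<And>x. g differentiable (at x)"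
    using Suc.prems by auto
  have "diff_times n f" "diff_times n g"
    using Suc.prems diff_times_mono[of "Suc n" _ n] by (auto simp del: diff_times.simps)
  then show ?case using Suc by (auto simp: partial_mult[OF f g] intro!: diff_times_add)
qed (auto intro: differentiable_mult)

lemma smooth_add: "smooth f \<Longrightarrow> smooth g \<Longrightarrow> smooth (\<lambda>x. f x + g x)"
  by (simp add: smooth_iff_diff_times diff_times_add)

lemma smooth_mult: "smooth f \<Longrightarrow> smooth g \<Longrightarrow> smooth (\<lambda>x. f x * g x)"
  by (simp add: smooth_iff_diff_times diff_times_mult)

lemma smooth_cmult: "smooth f \<Longrightarrow> smooth (\<lambda>x. c * f x)"
  by (intro smooth_mult smooth_const)

lemma smooth_uminus: "smooth f \<Longrightarrow> smooth (\<lambda>x. - f x)"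
  using smooth_cmult[of f "-1"] by simp

lemma smooth_diff: "smooth f \<Longrightarrow> smooth g \<Longrightarrow> smooth (\<lambda>x. f x - g x)"
  using smooth_add[OF _ smooth_uminus, of f g] by simp

lemma smooth_power: "smooth f \<Longrightarrow> smooth (\<lambda>x. f x ^ k)"
  by (induction k) (auto intro: smooth_const smooth_mult)

lemma smooth_sum: "(\<And>i. i \<in> I \<Longrightarrow> smooth (f i)) \<Longrightarrow> smooth (\<lambda>x. \<Sum>i\<in>I. f i x)"
  by (induction I rule: infinite_finite_induct) (auto intro: smooth_const smooth_add)

lemma smooth_prod: "(\<And>i. i \<in> I \<Longrightarrow> smooth (f i)) \<Longrightarrow> smooth (\<lambda>x. \<Prod>i\<in>I. f i x)"
  by (induction I rule: infinite_finite_induct) (auto intro: smooth_const smooth_mult)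

text \<open>The partial derivatives of 1/f are products of 1/f with partial derivatives of f, so the
  order of differentiability of 1/f improves by one at each step of the induction.\<close>

lemma smooth_inverse:
  assumes "smooth f" "\<And>x. f x \<noteq> 0"
  shows "smooth (\<lambda>x. inverse (f x))"
proof -
  have d: "((\<lambda>x. inverse (f x)) has_derivative (\<lambda>h. - (inverse (f x) * partial h f x * inverse (f x)))) (at x)" for x
    using assms by (intro Deriv.has_derivative_inverse smooth_has_derivative) auto
  have e: "partial b (\<lambda>x. inverse (f x)) = (\<lambda>x. (-1) * (inverse (f x) * partial b f x * inverse (f x)))" for b
    using partial_eqI[OF d] by simp
  have "diff_times n (\<lambda>x. inverse (f x))" for n
  proof (induction n)
    case 0
    then show ?case using d differentiable_def by auto
  next
    case (Suc n)
    have "diff_times n (partial b f)" if "b \<in> Basis" for b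
      using assms smooth_partial smooth_iff_diff_times that by blast
    then show ?case unfolding diff_times.simps e using Suc d
      by (intro conjI allI ballI diff_times_mult diff_times_const) (auto simp: differentiable_def)
  qed
  then show ?thesis by (simp add: smooth_iff_diff_times)
qed

lemma smooth_real_polynomial_function: "real_polynomial_function p \<Longrightarrow> smooth p"
  by (induction rule: real_polynomial_function.induct)
     (auto intro: smooth_bounded_linear smooth_const smooth_add smooth_mult)

lemma partial_scaleR:
  "f differentiable (at x) \<Longrightarrow> partial (u *\<^sub>R b) f x = u * partial b f x"
  unfolding partial_def using linear_cmul[OF linear_frechet_derivative, of f "at x" u b] by simp

lemma partial_scale:
  assumes "\<And>x. f differentiable (at x)"
  shows "partial b (\<lambda>x. f (c *\<^sub>R x)) = (\<lambda>x. c * partial b f (c *\<^sub>R x))"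
proof -
  have "((\<lambda>x. f (c *\<^sub>R x)) has_derivative (\<lambda>h. partial (c *\<^sub>R h) f (c *\<^sub>R x))) (at x)" for x
    by (rule has_derivative_compose[OF _ has_derivative_frechet[OF assms], where f="\<lambda>x. c *\<^sub>R x"])
       (auto intro!: derivative_eq_intros)
  from partial_eqI[OF this, of b]
  show ?thesis by (simp add: partial_scaleR assms)
qed

lemma smooth_scale: 
  assumes "smooth f" shows "smooth (\<lambda>x. f (c *\<^sub>R x))"
proof -
  have "diff_times n (\<lambda>x. f (c *\<^sub>R x))" if "diff_times n f" for n f
    using that
  proof (induction n arbitrary: f)
    case 0
    then have f: "f differentiable (at x)" for x by auto
    have "(\<lambda>x. f (c *\<^sub>R x)) differentiable at x" for x
      by (rule differentiable_compose[where g="\<lambda>x. c *\<^sub>R x"]) (auto intro: f)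
    then show ?case by simp
  next
    case (Suc n)
    then have f: "f differentiable (at x)" for x by auto
    have "(\<lambda>x. f (c *\<^sub>R x)) differentiable at x" for x 
      by (rule differentiable_compose[where g="\<lambda>x. c *\<^sub>R x"]) (auto intro: f)
    then show ?case using Suc by (auto simp: partial_scale[OF f] intro!: diff_times_mult diff_times_const)
  qed
  then show ?thesis using assms unfolding smooth_iff_diff_times by blast
qed

lemma partials_add:
  assumes "smooth f" "smooth g" "bs \<in> lists Basis"
  shows "partials bs (\<lambda>x. f x + g x) = (\<lambda>x. partials bs f x + partials bs g x)"
  using assms(3)
  by (induction bs) (auto simp: partials_Cons partial_add smooth_differentiable smooth_partials assms)

lemma partials_cmult:
  assumes "smooth f" "bs \<in> lists Basis"
  shows "partials bs (\<lambda>x. c * f x) = (\<lambda>x. c * partials bs f x)"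
  using assms(2)
  by (induction bs) (auto simp: partials_Cons partial_cmult smooth_differentiable smooth_partials assms)

lemma partials_diff:
  assumes "smooth f" "smooth g" "bs \<in> lists Basis"
  shows "partials bs (\<lambda>x. f x - g x) = (\<lambda>x. partials bs f x - partials bs g x)"
  using partials_add[OF assms(1) smooth_cmult[OF assms(2)] assms(3), of "-1"]
  unfolding partials_cmult[OF assms(2,3)] by simp

lemma partials_zero: "bs \<in> lists Basis \<Longrightarrow> partials bs (\<lambda>_. 0) = (\<lambda>_. 0)"
  by (induction bs) (auto simp: partials_Cons partial_const)

lemma partials_sum:
  assumes "\<And>i. i \<in> I \<Longrightarrow> smooth (f i)" "bs \<in> lists Basis"
  shows "partials bs (\<lambda>x. \<Sum>i\<in>I. f i x) = (\<lambda>x. \<Sum>i\<in>I. partials bs (f i) x)"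
  using assms(1)
  by (induction I rule: infinite_finite_induct) (auto simp: partials_zero partials_add assms(2) smooth_sum)

lemma partials_scale:
  assumes "smooth f" "bs \<in> lists Basis"
  shows "partials bs (\<lambda>x. f (c *\<^sub>R x)) = (\<lambda>x. c ^ length bs * partials bs f (c *\<^sub>R x))"
  using assms(2)
proof (induction bs)
  case (Cons b bs)
  then have s: "smooth (partials bs f)" by (auto intro: smooth_partials assms)
  have "partials (b # bs) (\<lambda>x. f (c *\<^sub>R x)) = partial b (\<lambda>x. c ^ length bs * partials bs f (c *\<^sub>R x))"
    using Cons by (auto simp: partials_Cons)
  also have "\<dots> = (\<lambda>x. c ^ length bs * (c * partial b (partials bs f) (c *\<^sub>R x)))"
    by (subst partial_cmult) (auto simp: partial_scale smooth_differentiable s smooth_scale)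
  finally show ?case by (auto simp: partials_Cons)
qed auto

section \<open>Symmetry of mixed partial derivatives\<close>

lemma smooth_mean_value:
  assumes "smooth f" "0 < h"
  obtains s where "0 < s" "s < h" "f (x + h *\<^sub>R b) - f x = h * partial b f (x + s *\<^sub>R b)"
proof -
  have d: "((\<lambda>t. f (x + t *\<^sub>R b)) has_derivative (\<lambda>u. partial (u *\<^sub>R b) f (x + t *\<^sub>R b))) (at t)" for t
    by (rule has_derivative_compose[OF _ smooth_has_derivative[OF assms(1)], where f="\<lambda>t. x + t *\<^sub>R b"])
       (auto intro!: derivative_eq_intros)
  have lin: "partial (u *\<^sub>R b) f y = u * partial b f y" for u y
    by (simp add: partial_scaleR smooth_differentiable assms)
  have "DERIV (\<lambda>t. f (x + t *\<^sub>R b)) t :> partial b f (x + t *\<^sub>R b)" for t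
    using d[of t] unfolding lin by (rule has_derivative_imp_has_field_derivative) simp
  from MVT2[OF assms(2) this] that show ?thesis by force
qed

text \<open>The second difference is the increment along \<open>b\<close> of \<open>?g\<close>, the
  first difference along \<open>c\<close>. The mean value theorem applies to \<open>?g\<close> along
  \<open>b\<close>, and then to \<open>partial b f\<close> along \<open>c\<close>.\<close>

lemma smooth_second_difference:
  assumes "smooth f" "0 < h" "b \<in> Basis"
  obtains s t where "0 < s" "s < h" "0 < t" "t < h"
    "f (x + h *\<^sub>R b + h *\<^sub>R c) - f (x + h *\<^sub>R b) - f (x + h *\<^sub>R c) + f x
      = h * h * partial c (partial b f) (x + s *\<^sub>R b + t *\<^sub>R c)"
proof -
  let ?g = "\<lambda>y. f (y + h *\<^sub>R c) - f y"
  have d: "(?g has_derivative (\<lambda>u. partial u f (y + h *\<^sub>R c) - partial u f y)) (at y)" for y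
    by (intro has_derivative_diff smooth_has_derivative[OF assms(1)]
        has_derivative_compose[OF _ smooth_has_derivative[OF assms(1)], where f="\<lambda>y. y + h *\<^sub>R c"])
       (auto intro!: derivative_eq_intros)
  have lin: "partial (u *\<^sub>R b) f y = u * partial b f y" for u y
    by (simp add: partial_scaleR smooth_differentiable assms)
  have D: "DERIV (\<lambda>t. ?g (x + t *\<^sub>R b)) t :> partial b f (x + t *\<^sub>R b + h *\<^sub>R c) - partial b f (x + t *\<^sub>R b)" for t
  proof -
    have "((\<lambda>t. ?g (x + t *\<^sub>R b)) has_derivative
        (\<lambda>u. partial (u *\<^sub>R b) f (x + t *\<^sub>R b + h *\<^sub>R c) - partial (u *\<^sub>R b) f (x + t *\<^sub>R b))) (at t)"
      by (rule has_derivative_compose[OF _ d, where f="\<lambda>t. x + t *\<^sub>R b"])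
         (auto intro!: derivative_eq_intros)
    then show ?thesis unfolding lin
      by (rule has_derivative_imp_has_field_derivative) (simp add: algebra_simps)
  qed
  obtain s where s: "0 < s" "s < h" "?g (x + h *\<^sub>R b) - ?g (x + 0 *\<^sub>R b)
      = h * (partial b f (x + s *\<^sub>R b + h *\<^sub>R c) - partial b f (x + s *\<^sub>R b))"
    using MVT2[OF assms(2) D] by force
  obtain t where t: "0 < t" "t < h" "partial b f (x + s *\<^sub>R b + h *\<^sub>R c) - partial b f (x + s *\<^sub>R b)
      = h * partial c (partial b f) (x + s *\<^sub>R b + t *\<^sub>R c)"
    using smooth_mean_value[OF smooth_partial[OF assms(1,3)] assms(2)] by blast
  have "f (x + h *\<^sub>R b + h *\<^sub>R c) - f (x + h *\<^sub>R b) - f (x + h *\<^sub>R c) + f x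
      = h * h * partial c (partial b f) (x + s *\<^sub>R b + t *\<^sub>R c)"
    using s(3) unfolding t(3) by simp
  with s t that show ?thesis by blast
qed

text \<open>The second difference is symmetric in \<open>b\<close> and \<open>c\<close>, so each
  step size gives a value of one mixed derivative equal to a value of the other; both points tend to
  x and the derivatives are continuous.\<close>

lemma partial_commute:
  assumes f: "smooth f" and b: "b \<in> Basis" and c: "c \<in> Basis"
  shows "partial b (partial c f) = partial c (partial b f)"
proof
  fix x
  let ?h = "\<lambda>n. inverse (real (Suc n))"
  have "\<exists>s t s' t'. 0 < s \<and> s < ?h n \<and> 0 < t \<and> t < ?h n \<and> 0 < s' \<and> s' < ?h n \<and> 0 < t' \<and> t' < ?h n \<and>
      partial c (partial b f) (x + s *\<^sub>R b + t *\<^sub>R c) = partial b (partial c f) (x + s' *\<^sub>R c + t' *\<^sub>R b)" for n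
  proof -
    obtain s t where 1: "0 < s" "s < ?h n" "0 < t" "t < ?h n"
      "f (x + ?h n *\<^sub>R b + ?h n *\<^sub>R c) - f (x + ?h n *\<^sub>R b) - f (x + ?h n *\<^sub>R c) + f x
        = ?h n * ?h n * partial c (partial b f) (x + s *\<^sub>R b + t *\<^sub>R c)"
      using smooth_second_difference[OF f _ b, of "?h n" x c thesis] by auto
    obtain s' t' where 2: "0 < s'" "s' < ?h n" "0 < t'" "t' < ?h n"
      "f (x + ?h n *\<^sub>R c + ?h n *\<^sub>R b) - f (x + ?h n *\<^sub>R c) - f (x + ?h n *\<^sub>R b) + f x
        = ?h n * ?h n * partial b (partial c f) (x + s' *\<^sub>R c + t' *\<^sub>R b)"
      using smooth_second_difference[OF f _ c, of "?h n" x b thesis] by auto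
    have "?h n * ?h n * partial c (partial b f) (x + s *\<^sub>R b + t *\<^sub>R c)
      = ?h n * ?h n * partial b (partial c f) (x + s' *\<^sub>R c + t' *\<^sub>R b)"
      using 1(5) 2(5) by (simp add: algebra_simps)
    then have "partial c (partial b f) (x + s *\<^sub>R b + t *\<^sub>R c) = partial b (partial c f) (x + s' *\<^sub>R c + t' *\<^sub>R b)"
      by simp
    then show ?thesis using 1 2 by blast
  qed
  then obtain s t s' t' where st: "\<And>n. 0 < s n \<and> s n < ?h n \<and> 0 < t n \<and> t n < ?h n \<and> 0 < s' n \<and> s' n < ?h n \<and> 0 < t' n \<and> t' n < ?h n \<and>
      partial c (partial b f) (x + s n *\<^sub>R b + t n *\<^sub>R c) = partial b (partial c f) (x + s' n *\<^sub>R c + t' n *\<^sub>R b)"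
    by metis
  have lim: "r \<longlonglongrightarrow> 0" if "\<And>n. 0 < r n \<and> r n < ?h n" for r :: "nat \<Rightarrow> real"
    by (rule tendsto_sandwich[OF _ _ tendsto_const LIMSEQ_inverse_real_of_nat])
       (use that less_imp_le in \<open>auto intro!: always_eventually\<close>)
  have s: "s \<longlonglongrightarrow> 0" "t \<longlonglongrightarrow> 0" "s' \<longlonglongrightarrow> 0" "t' \<longlonglongrightarrow> 0"
    by (rule lim, use st in blast)+
  have l1: "(\<lambda>n. x + s n *\<^sub>R b + t n *\<^sub>R c) \<longlonglongrightarrow> x + 0 *\<^sub>R b + 0 *\<^sub>R c"
    and l2: "(\<lambda>n. x + s' n *\<^sub>R c + t' n *\<^sub>R b) \<longlonglongrightarrow> x + 0 *\<^sub>R c + 0 *\<^sub>R b"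
    by (intro tendsto_intros s)+
  have cont: "isCont (partial c (partial b f)) x" "isCont (partial b (partial c f)) x"
    using smooth_continuous_on[of _ UNIV] assms smooth_partial continuous_on_eq_continuous_at by blast+
  have "(\<lambda>n. partial c (partial b f) (x + s n *\<^sub>R b + t n *\<^sub>R c)) \<longlonglongrightarrow> partial c (partial b f) x"
    by (rule isCont_tendsto_compose[OF cont(1)]) (use l1 in simp)
  moreover have "(\<lambda>n. partial b (partial c f) (x + s' n *\<^sub>R c + t' n *\<^sub>R b)) \<longlonglongrightarrow> partial b (partial c f) x"
    by (rule isCont_tendsto_compose[OF cont(2)]) (use l2 in simp)
  ultimately show "partial b (partial c f) x = partial c (partial b f) x"
    using LIMSEQ_unique st by auto
qed

lemma partials_partial_commute:
  "smooth f \<Longrightarrow> bs \<in> lists Basis \<Longrightarrow> b \<in> Basis \<Longrightarrow> partials bs (partial b f) = partial b (partials bs f)"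
proof (induction bs)
  case (Cons c bs)
  then show ?case using partial_commute[OF smooth_partials[of f bs], of b c]
    by (auto simp: partials_Cons)
qed auto

lemma partials_commute:
  "smooth f \<Longrightarrow> bs \<in> lists Basis \<Longrightarrow> cs \<in> lists Basis \<Longrightarrow> partials bs (partials cs f) = partials cs (partials bs f)"
  by (induction cs) (auto simp: partials_Cons partials_partial_commute smooth_partials)

subsection \<open>Test functions\<close>

text \<open>Any compact set outside which \<phi> vanishes may stand for the closure of the support,
  so supports of sums, products and dilations never have to be computed exactly.\<close>

lemma test_functions_iff:
  "\<phi> \<in> test_functions U \<longleftrightarrow> smooth \<phi> \<and> (\<exists>C. compact C \<and> C \<subseteq> U \<and> (\<forall>x. x \<notin> C \<longrightarrow> \<phi> x = 0))"
proof
  assume "\<phi> \<in> test_functions U"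
  then show "smooth \<phi> \<and> (\<exists>C. compact C \<and> C \<subseteq> U \<and> (\<forall>x. x \<notin> C \<longrightarrow> \<phi> x = 0))"
    unfolding test_functions_def
    by (intro conjI exI[of _ "closure {x. \<phi> x \<noteq> 0}"]) (auto simp: closure_def)
next
  assume R: "smooth \<phi> \<and> (\<exists>C. compact C \<and> C \<subseteq> U \<and> (\<forall>x. x \<notin> C \<longrightarrow> \<phi> x = 0))"
  then obtain C where C: "compact C" "C \<subseteq> U" "\<forall>x. x \<notin> C \<longrightarrow> \<phi> x = 0" by blast
  then have "{x. \<phi> x \<noteq> 0} \<subseteq> C" by auto
  then have "closure {x. \<phi> x \<noteq> 0} \<subseteq> C" using C(1) by (simp add: closure_minimal compact_imp_closed)
  moreover from this have "compact (closure {x. \<phi> x \<noteq> 0})"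
    using C(1) bounded_subset[of C "closure {x. \<phi> x \<noteq> 0}"] by (simp add: compact_eq_bounded_closed)
  ultimately show "\<phi> \<in> test_functions U"
    unfolding test_functions_def using C(2) R by (simp add: subset_trans)
qed

lemma test_functions_smooth: "\<phi> \<in> test_functions U \<Longrightarrow> smooth \<phi>"
  by (simp add: test_functions_iff)

lemma test_functionsE:
  assumes "\<phi> \<in> test_functions U"
  obtains C where "compact C" "C \<subseteq> U" "\<And>x. x \<notin> C \<Longrightarrow> \<phi> x = 0"
  using assms by (auto simp: test_functions_iff)

lemma test_functions_mono: "U \<subseteq> V \<Longrightarrow> test_functions U \<subseteq> test_functions V"
  by (auto simp: test_functions_def)

lemma test_functions_UNIV: "\<phi> \<in> test_functions U \<Longrightarrow> \<phi> \<in> test_functions UNIV"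
  using test_functions_mono by blast

lemma test_functions_zero_outside: "\<phi> \<in> test_functions U \<Longrightarrow> x \<notin> U \<Longrightarrow> \<phi> x = 0"
  by (auto elim!: test_functionsE)

text \<open>Closedness of \<open>C\<close> is the point: around x the function vanishes on an open
  set.\<close>

lemma partial_zero_outside:
  assumes "closed C" "\<And>x. x \<notin> C \<Longrightarrow> f x = 0" "x \<notin> C"
  shows "partial b f x = 0"
proof -
  have "(f has_derivative (\<lambda>_. 0)) (at x)"
    by (rule has_derivative_transform_within_open[of "\<lambda>_. 0" _ _ _ "- C"]) (use assms in auto)
  then show ?thesis unfolding partial_def using frechet_derivative_at by metis
qed

lemma partials_zero_outside:
  assumes "closed C" "\<And>x. x \<notin> C \<Longrightarrow> f x = 0" "x \<notin> C"
  shows "partials bs f x = 0"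
  using assms(3)
proof (induction bs arbitrary: x)
  case (Cons b bs)
  then show ?case using partial_zero_outside[OF assms(1), of "partials bs f"] by (auto simp: partials_Cons)
qed (use assms in auto)

lemma test_functions_partials:
  assumes "\<phi> \<in> test_functions U" "bs \<in> lists Basis"
  shows "partials bs \<phi> \<in> test_functions U"
proof -
  obtain C where "compact C" "C \<subseteq> U" "\<And>x. x \<notin> C \<Longrightarrow> \<phi> x = 0"
    using assms test_functionsE by blast
  then have "compact C \<and> C \<subseteq> U \<and> (\<forall>x. x \<notin> C \<longrightarrow> partials bs \<phi> x = 0)"
    using partials_zero_outside[of C \<phi>] compact_imp_closed by metis
  then show ?thesis
    using assms test_functions_iff smooth_partials by blast
qed

lemma test_functions_partial:
  "\<phi> \<in> test_functions U \<Longrightarrow> b \<in> Basis \<Longrightarrow> partial b \<phi> \<in> test_functions U"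
  using test_functions_partials[of \<phi> U "[b]"] by (simp add: partials_Cons)

lemma test_functions_add:
  assumes "\<phi> \<in> test_functions U" "\<psi> \<in> test_functions U"
  shows "(\<lambda>x. \<phi> x + \<psi> x) \<in> test_functions U"
proof -
  obtain C D where "compact C" "C \<subseteq> U" "\<And>x. x \<notin> C \<Longrightarrow> \<phi> x = 0"
    "compact D" "D \<subseteq> U" "\<And>x. x \<notin> D \<Longrightarrow> \<psi> x = 0"
    using assms test_functionsE by metis
  then show ?thesis unfolding test_functions_iff
    using assms
    by (intro conjI smooth_add exI[of _ "C \<union> D"]) (auto intro: test_functions_smooth compact_Un)
qed

lemma test_functions_mult:
  assumes "\<phi> \<in> test_functions U" "smooth f"
  shows "(\<lambda>x. f x * \<phi> x) \<in> test_functions U"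
  using assms unfolding test_functions_iff by (auto intro!: smooth_mult)

lemma test_functions_cmult: "\<phi> \<in> test_functions U \<Longrightarrow> (\<lambda>x. c * \<phi> x) \<in> test_functions U"
  by (rule test_functions_mult[OF _ smooth_const])

lemma test_functions_diff:
  assumes "\<phi> \<in> test_functions U" "\<psi> \<in> test_functions U"
  shows "(\<lambda>x. \<phi> x - \<psi> x) \<in> test_functions U"
  using test_functions_add[OF assms(1) test_functions_cmult[OF assms(2), of "-1"]] by simp

lemma test_functions_sum:
  "(\<And>i. i \<in> I \<Longrightarrow> f i \<in> test_functions U) \<Longrightarrow> (\<lambda>x. \<Sum>i\<in>I. f i x) \<in> test_functions U"
proof (induction I rule: infinite_finite_induct)
  case empty
  then show ?case by (auto simp: test_functions_iff smooth_const)
next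
  case (infinite A)
  then show ?case by (auto simp: test_functions_iff smooth_const)
qed (auto intro: test_functions_add)

lemma test_functions_scale:
  assumes "\<phi> \<in> test_functions U" "c \<noteq> 0" "(*\<^sub>R) (1 / c) ` U \<subseteq> V"
  shows "(\<lambda>x. \<phi> (c *\<^sub>R x)) \<in> test_functions V"
proof -
  obtain C where C: "compact C" "C \<subseteq> U" "\<And>x. x \<notin> C \<Longrightarrow> \<phi> x = 0"
    using assms test_functionsE by blast
  have "\<phi> (c *\<^sub>R x) = 0" if "x \<notin> (*\<^sub>R) (1 / c) ` C" for x
  proof (rule C)
    have "x = (1 / c) *\<^sub>R (c *\<^sub>R x)" using assms by simp
    then show "c *\<^sub>R x \<notin> C" using that by blast
  qed
  then show ?thesis unfolding test_functions_iff
    using assms C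
    by (intro conjI smooth_scale test_functions_smooth[OF assms(1)] exI[of _ "(*\<^sub>R) (1 / c) ` C"] compact_scaling) auto
qed

subsection \<open>Square integrable functions\<close>

text \<open>Values in a Euclidean space are allowed because \<open>nabla_pow\<close> maps into
  \<real> \<times> 'a; measurability is part of the notion because the integral alone does not
  provide it.\<close>

definition square_integrable :: "'x measure \<Rightarrow> ('x \<Rightarrow> 'b::euclidean_space) \<Rightarrow> bool" where
  "square_integrable M f \<longleftrightarrow> f \<in> borel_measurable M \<and> integrable M (\<lambda>x. (norm (f x))\<^sup>2)"

definition l2norm :: "'x measure \<Rightarrow> ('x \<Rightarrow> 'b::euclidean_space) \<Rightarrow> real" where
  "l2norm M f = sqrt (\<integral>x. (norm (f x))\<^sup>2 \<partial>M)"

lemma l2norm_nonneg [simp]: "0 \<le> l2norm M f"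
  by (simp add: l2norm_def)

lemma l2norm_power2: "(l2norm M f)\<^sup>2 = (\<integral>x. (norm (f x))\<^sup>2 \<partial>M)"
  by (simp add: l2norm_def)

lemma l2norm_minus: "l2norm M (\<lambda>x. f x - g x) = l2norm M (\<lambda>x. g x - f x)"
  by (simp add: l2norm_def norm_minus_commute)

lemma square_integrable_measurable: "square_integrable M f \<Longrightarrow> f \<in> borel_measurable M"
  by (simp add: square_integrable_def)

lemma square_integrable_zero [simp]: "square_integrable M (\<lambda>_. 0)"
  by (simp add: square_integrable_def)

lemma square_integrable_cong_AE:
  assumes "f \<in> borel_measurable M" "g \<in> borel_measurable M" "AE x in M. f x = g x"
  shows "square_integrable M f \<longleftrightarrow> square_integrable M g"
proof -
  have "AE x in M. (norm (f x))\<^sup>2 = (norm (g x))\<^sup>2" using assms(3) by eventually_elim simp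
  then have "integrable M (\<lambda>x. (norm (f x))\<^sup>2) \<longleftrightarrow> integrable M (\<lambda>x. (norm (g x))\<^sup>2)"
    using assms by (intro integrable_cong_AE) auto
  then show ?thesis using assms by (simp add: square_integrable_def)
qed

lemma l2norm_cong_AE:
  assumes "f \<in> borel_measurable M" "g \<in> borel_measurable M" "AE x in M. f x = g x"
  shows "l2norm M f = l2norm M g"
proof -
  have "AE x in M. (norm (f x))\<^sup>2 = (norm (g x))\<^sup>2" using assms(3) by eventually_elim simp
  then show ?thesis unfolding l2norm_def using assms by (subst integral_cong_AE) auto
qed

lemma square_integrable_bound:
  assumes "square_integrable M f" "g \<in> borel_measurable M" "AE x in M. norm (g x) \<le> norm (f x)"
  shows "square_integrable M g" "l2norm M g \<le> l2norm M f"
proof -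
  have le: "AE x in M. (norm (g x))\<^sup>2 \<le> (norm (f x))\<^sup>2" using assms(3)
    by eventually_elim (simp add: power_mono)
  have i: "integrable M (\<lambda>x. (norm (g x))\<^sup>2)"
    by (rule Bochner_Integration.integrable_bound[of M "\<lambda>x. (norm (f x))\<^sup>2"])
       (use assms le in \<open>auto simp: square_integrable_def\<close>)
  then show "square_integrable M g" using assms by (simp add: square_integrable_def)
  show "l2norm M g \<le> l2norm M f"
    unfolding l2norm_def real_sqrt_le_iff
    by (rule integral_mono_AE[OF i _ le]) (use assms in \<open>auto simp: square_integrable_def\<close>)
qed

lemma square_integrable_norm:
  "square_integrable M f \<Longrightarrow> square_integrable M (\<lambda>x. norm (f x))"
  by (auto simp: square_integrable_def)

lemma square_integrable_scaleR:
  assumes "square_integrable M f"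
  shows "square_integrable M (\<lambda>x. c *\<^sub>R f x)"
  using assms by (auto simp: square_integrable_def power_mult_distrib)

lemma square_integrable_cmult:
  "square_integrable M f \<Longrightarrow> square_integrable M (\<lambda>x. c * f x :: real)"
  using square_integrable_scaleR[of M f c] by simp

lemma l2norm_scaleR: "l2norm M (\<lambda>x. c *\<^sub>R f x) = \<bar>c\<bar> * l2norm M f"
  by (simp add: l2norm_def power_mult_distrib real_sqrt_mult)

lemma l2norm_cmult: "l2norm M (\<lambda>x. c * f x :: real) = \<bar>c\<bar> * l2norm M f"
  using l2norm_scaleR[of M c f] by simp

text \<open>Young's inequality with a free parameter. It survives integration for each
  \<open>t\<close>, and choosing \<open>t\<close> as a ratio of norms afterwards gives the triangle
  inequality in L^2.\<close>

lemma norm_add_power2_le: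
  fixes a b :: "'b::real_normed_vector" and t :: real
  assumes "t > 0"
  shows "(norm (a + b))\<^sup>2 \<le> (1 + t) * (norm a)\<^sup>2 + (1 + 1 / t) * (norm b)\<^sup>2"
proof -
  have "(norm (a + b))\<^sup>2 \<le> (norm a + norm b)\<^sup>2" by (simp add: norm_triangle_ineq power_mono)
  also have "\<dots> = (norm a)\<^sup>2 + (norm b)\<^sup>2 + 2 * (sqrt t * norm a) * (norm b / sqrt t)"
    using assms by (simp add: power2_sum)
  also have "2 * (sqrt t * norm a) * (norm b / sqrt t) \<le> (sqrt t * norm a)\<^sup>2 + (norm b / sqrt t)\<^sup>2"
    using sum_squares_bound by blast
  also have "\<dots> = t * (norm a)\<^sup>2 + (norm b)\<^sup>2 / t" using assms by (simp add: power_mult_distrib power_divide)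
  finally show ?thesis by (simp add: algebra_simps)
qed

lemma square_integrable_add:
  assumes "square_integrable M f" "square_integrable M g"
  shows "square_integrable M (\<lambda>x. f x + g x)"
proof -
  have [measurable]: "f \<in> borel_measurable M" "g \<in> borel_measurable M" using assms by (auto simp: square_integrable_def)
  have "integrable M (\<lambda>x. (norm (f x + g x))\<^sup>2)"
  proof (rule Bochner_Integration.integrable_bound)
    show "integrable M (\<lambda>x. 2 * (norm (f x))\<^sup>2 + 2 * (norm (g x))\<^sup>2)"
      using assms by (auto simp: square_integrable_def)
    show "AE x in M. norm ((norm (f x + g x))\<^sup>2) \<le> norm (2 * (norm (f x))\<^sup>2 + 2 * (norm (g x))\<^sup>2)"
      using norm_add_power2_le[of 1] by auto
  qed auto
  then show ?thesis by (simp add: square_integrable_def)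
qed

lemma square_integrable_uminus: "square_integrable M f \<Longrightarrow> square_integrable M (\<lambda>x. - f x)"
  by (simp add: square_integrable_def)

lemma square_integrable_diff:
  assumes "square_integrable M f" "square_integrable M g"
  shows "square_integrable M (\<lambda>x. f x - g x)"
  using square_integrable_add[OF assms(1) square_integrable_uminus[OF assms(2)]] by simp

lemma square_integrable_sum:
  "(\<And>i. i \<in> I \<Longrightarrow> square_integrable M (f i)) \<Longrightarrow> square_integrable M (\<lambda>x. \<Sum>i\<in>I. f i x)"
  by (induction I rule: infinite_finite_induct) (auto intro: square_integrable_add)

lemma l2norm_triangle:
  assumes f: "square_integrable M f" and g: "square_integrable M g"
  shows "l2norm M (\<lambda>x. f x + g x) \<le> l2norm M f + l2norm M g"
proof -
  let ?a = "l2norm M f" and ?b = "l2norm M g"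
  have i: "integrable M (\<lambda>x. (norm (f x))\<^sup>2)" "integrable M (\<lambda>x. (norm (g x))\<^sup>2)"
    "integrable M (\<lambda>x. (norm (f x + g x))\<^sup>2)"
    using f g square_integrable_add[OF f g] by (auto simp: square_integrable_def)
  have key: "(l2norm M (\<lambda>x. f x + g x))\<^sup>2 \<le> (1 + t) * ?a\<^sup>2 + (1 + 1 / t) * ?b\<^sup>2" if "t > 0" for t
  proof -
    have "(\<integral>x. (norm (f x + g x))\<^sup>2 \<partial>M) \<le> (\<integral>x. (1 + t) * (norm (f x))\<^sup>2 + (1 + 1 / t) * (norm (g x))\<^sup>2 \<partial>M)"
      by (rule integral_mono) (use i norm_add_power2_le[OF that] in auto)
    then show ?thesis unfolding l2norm_power2 using i by simp
  qed
  \<comment> \<open>\<open>t\<close> is the ratio of the two norms; adding \<open>d\<close> to both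
    keeps it defined and positive when a norm vanishes.\<close>
  have half: "l2norm M (\<lambda>x. f x + g x) \<le> (?a + d) + (?b + d)" if d: "d > 0" for d
  proof -
    have pos: "?a + d > 0" "?b + d > 0" using d by (simp_all add: add_nonneg_pos)
    have "(l2norm M (\<lambda>x. f x + g x))\<^sup>2
      \<le> (1 + (?b + d) / (?a + d)) * ?a\<^sup>2 + (1 + 1 / ((?b + d) / (?a + d))) * ?b\<^sup>2"
      using pos by (intro key) simp
    also have "\<dots> \<le> (1 + (?b + d) / (?a + d)) * (?a + d)\<^sup>2 + (1 + 1 / ((?b + d) / (?a + d))) * (?b + d)\<^sup>2"
      using pos d by (intro add_mono mult_left_mono power_mono) auto
    also have "\<dots> = ((?a + d) + (?b + d))\<^sup>2"
    proof -
      have "(1 + q / p) * p\<^sup>2 + (1 + 1 / (q / p)) * q\<^sup>2 = (p + q)\<^sup>2" if "p > 0" "q > 0" for p q :: real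
        using that by (simp add: field_simps power2_eq_square)
      from this[OF pos] show ?thesis .
    qed
    finally show ?thesis using pos by (simp add: power2_le_iff_abs_le)
  qed
  have "l2norm M (\<lambda>x. f x + g x) \<le> ?a + ?b + e" if "e > 0" for e
    using half[of "e / 2"] that by (simp add: algebra_simps)
  then show ?thesis by (rule field_le_epsilon)
qed

text \<open>Cauchy-Schwarz by the same device: the inequality between the weighted means is
  integrated for every \<open>t\<close>, then \<open>t\<close> is taken as the perturbed ratio of
  the norms and the perturbation \<open>d\<close> tends to 0.\<close>

lemma square_integrable_mult:
  fixes f g :: "'x \<Rightarrow> real"
  assumes f: "square_integrable M f" and g: "square_integrable M g"
  shows "integrable M (\<lambda>x. f x * g x)" "\<bar>\<integral>x. f x * g x \<partial>M\<bar> \<le> l2norm M f * l2norm M g"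
proof -
  let ?a = "l2norm M f" and ?b = "l2norm M g"
  have [measurable]: "f \<in> borel_measurable M" "g \<in> borel_measurable M" using assms by (auto simp: square_integrable_def)
  have i: "integrable M (\<lambda>x. (f x)\<^sup>2)" "integrable M (\<lambda>x. (g x)\<^sup>2)"
    using f g by (auto simp: square_integrable_def)
  have le: "2 * \<bar>u * v\<bar> \<le> t * u\<^sup>2 + v\<^sup>2 / t" if "t > 0" for t u v :: real
  proof -
    have "2 * \<bar>u * v\<bar> = 2 * (sqrt t * \<bar>u\<bar>) * (\<bar>v\<bar> / sqrt t)" using that by (simp add: abs_mult)
    also have "\<dots> \<le> (sqrt t * \<bar>u\<bar>)\<^sup>2 + (\<bar>v\<bar> / sqrt t)\<^sup>2" using sum_squares_bound by blast
    finally show ?thesis using that by (simp add: power_mult_distrib power_divide)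
  qed
  have i3: "integrable M (\<lambda>x. \<bar>f x * g x\<bar>)"
  proof (rule Bochner_Integration.integrable_bound)
    show "integrable M (\<lambda>x. (f x)\<^sup>2 + (g x)\<^sup>2)" using i by auto
    have "\<bar>f x * g x\<bar> \<le> (f x)\<^sup>2 + (g x)\<^sup>2" for x 
      using le[of 1 "f x" "g x"] by simp
    then show "AE x in M. norm \<bar>f x * g x\<bar> \<le> norm ((f x)\<^sup>2 + (g x)\<^sup>2)" by simp
  qed auto
  then show "integrable M (\<lambda>x. f x * g x)" by (subst (asm) integrable_abs_iff) auto
  have key: "2 * (\<integral>x. \<bar>f x * g x\<bar> \<partial>M) \<le> t * ?a\<^sup>2 + ?b\<^sup>2 / t" if "t > 0" for t
  proof -
    have "(\<integral>x. 2 * \<bar>f x * g x\<bar> \<partial>M) \<le> (\<integral>x. t * (f x)\<^sup>2 + (g x)\<^sup>2 / t \<partial>M)"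
      by (rule integral_mono) (use i i3 le[OF that] in auto)
    then show ?thesis unfolding l2norm_power2 using i by simp
  qed
  have "(\<integral>x. \<bar>f x * g x\<bar> \<partial>M) \<le> (?a + d) * (?b + d)" if d: "d > 0" for d
  proof -
    have pos: "?a + d > 0" "?b + d > 0" using d by (simp_all add: add_nonneg_pos)
    have "2 * (\<integral>x. \<bar>f x * g x\<bar> \<partial>M) \<le> ((?b + d) / (?a + d)) * ?a\<^sup>2 + ?b\<^sup>2 / ((?b + d) / (?a + d))"
      using pos by (intro key) simp
    also have "\<dots> \<le> ((?b + d) / (?a + d)) * (?a + d)\<^sup>2 + (?b + d)\<^sup>2 / ((?b + d) / (?a + d))"
      using pos d by (intro add_mono mult_left_mono divide_right_mono power_mono) auto
    also have "\<dots> = 2 * ((?a + d) * (?b + d))"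
    proof -
      have "q / p * p\<^sup>2 + q\<^sup>2 / (q / p) = 2 * (p * q)" if "p > 0" "q > 0" for p q :: real
        using that by (simp add: field_simps power2_eq_square)
      from this[OF pos] show ?thesis .
    qed
    finally show ?thesis by simp
  qed
  then have ev: "\<forall>\<^sub>F d in at_right 0. (\<integral>x. \<bar>f x * g x\<bar> \<partial>M) \<le> (?a + d) * (?b + d)"
    by (auto simp: eventually_at_right_less eventually_at_filter)
  have "((\<lambda>d. (?a + d) * (?b + d)) \<longlongrightarrow> (?a + 0) * (?b + 0)) (at_right 0)"
    by (intro tendsto_intros)
  from tendsto_lowerbound[OF this ev] have "(\<integral>x. \<bar>f x * g x\<bar> \<partial>M) \<le> ?a * ?b" by simp
  then show "\<bar>\<integral>x. f x * g x \<partial>M\<bar> \<le> ?a * ?b"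
    using integral_abs_bound[of M "\<lambda>x. f x * g x"] by linarith
qed

lemma l2_tendsto_integral_mult:
  fixes s :: "nat \<Rightarrow> 'x \<Rightarrow> real"
  assumes s: "\<And>n. square_integrable M (s n)" and f: "square_integrable M f" and g: "square_integrable M g"
    and lim: "(\<lambda>n. l2norm M (\<lambda>x. s n x - f x)) \<longlonglongrightarrow> 0"
  shows "(\<lambda>n. \<integral>x. s n x * g x \<partial>M) \<longlonglongrightarrow> (\<integral>x. f x * g x \<partial>M)"
proof -
  have "(\<lambda>n. (\<integral>x. s n x * g x \<partial>M) - (\<integral>x. f x * g x \<partial>M)) \<longlonglongrightarrow> 0"
  proof (rule Lim_null_comparison)
    have "norm ((\<integral>x. s n x * g x \<partial>M) - (\<integral>x. f x * g x \<partial>M)) \<le> l2norm M (\<lambda>x. s n x - f x) * l2norm M g" for n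
    proof -
      have "(\<integral>x. s n x * g x \<partial>M) - (\<integral>x. f x * g x \<partial>M) = (\<integral>x. (s n x - f x) * g x \<partial>M)"
        by (subst Bochner_Integration.integral_diff[symmetric])
           (auto simp: square_integrable_mult s f g algebra_simps)
      then show ?thesis using square_integrable_mult(2)[OF square_integrable_diff[OF s f] g] by simp
    qed
    then show "\<forall>\<^sub>F n in sequentially. norm ((\<integral>x. s n x * g x \<partial>M) - (\<integral>x. f x * g x \<partial>M))
        \<le> l2norm M (\<lambda>x. s n x - f x) * l2norm M g" by simp
    show "(\<lambda>n. l2norm M (\<lambda>x. s n x - f x) * l2norm M g) \<longlonglongrightarrow> 0"
      using tendsto_mult_right[OF lim, of "l2norm M g"] by simp
  qed
  then show ?thesis using Lim_null by blast
qed

text \<open>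
  Multiplication by a positive weight in \<open>L\<^sup>2\<close> reduces the a.e. convergence of a subsequence to
  the corresponding fact for \<open>L\<^sup>1\<close>; the limit is then controlled by Fatou's lemma.
\<close>

lemma l2_complete:
  fixes s :: "nat \<Rightarrow> 'x \<Rightarrow> real"
  assumes M: "sigma_finite_measure M"
    and s: "\<And>n. square_integrable M (s n)"
    and cauchy: "\<And>e. e > 0 \<Longrightarrow> \<exists>N. \<forall>i\<ge>N. \<forall>j\<ge>N. l2norm M (\<lambda>x. s i x - s j x) < e"
  obtains f where "square_integrable M f" "(\<lambda>n. l2norm M (\<lambda>x. s n x - f x)) \<longlonglongrightarrow> 0"
proof -
  have sm[measurable]: "s n \<in> borel_measurable M" for n using s by (simp add: square_integrable_def)
  obtain h where h[measurable]: "h \<in> borel_measurable M" "integral\<^sup>N M h \<noteq> \<infinity>"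
    and hpos: "\<And>x. x \<in> space M \<Longrightarrow> 0 < h x \<and> h x < \<infinity>"
    using sigma_finite_measure.Ex_finite_integrable_function[OF M] by blast
  \<comment> \<open>The square root of a positive integrable function lies in L^2, so each
    \<open>s n * w\<close> is integrable; positivity allows dividing by \<open>w\<close> after the
    pointwise limit.\<close>
  define w where "w x = sqrt (enn2real (h x))" for x
  have [measurable]: "w \<in> borel_measurable M" by (simp add: w_def[abs_def])
  have wpos: "w x > 0" if "x \<in> space M" for x
    using hpos[OF that] by (simp add: w_def enn2real_positive_iff)
  have wsq: "square_integrable M w"
  proof -
    have "integrable M (\<lambda>x. enn2real (h x))"
    proof (rule integrableI_nonneg)
      have "(\<integral>\<^sup>+x. ennreal (enn2real (h x)) \<partial>M) = integral\<^sup>N M h"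
        by (rule nn_integral_cong) (use hpos in auto)
      then show "(\<integral>\<^sup>+x. ennreal (enn2real (h x)) \<partial>M) < \<infinity>" using h by (simp add: top.not_eq_extremum)
    qed auto
    then show ?thesis by (simp add: square_integrable_def w_def)
  qed
  have L1: "integrable M (\<lambda>x. s n x * w x)" for n by (rule square_integrable_mult[OF s wsq])
  have "\<exists>N. \<forall>i\<ge>N. \<forall>j\<ge>N. (LINT x|M. norm (s i x * w x - s j x * w x)) < e" if "e > 0" for e
  proof -
    have "e / (l2norm M w + 1) > 0" using that by (simp add: add_nonneg_pos)
    from cauchy[OF this] obtain N where N: "\<forall>i\<ge>N. \<forall>j\<ge>N. l2norm M (\<lambda>x. s i x - s j x) < e / (l2norm M w + 1)"
      by blast
    have "(LINT x|M. norm (s i x * w x - s j x * w x)) < e" if "i \<ge> N" "j \<ge> N" for i j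
    proof -
      have d: "square_integrable M (\<lambda>x. norm (s i x - s j x))"
        by (intro square_integrable_norm square_integrable_diff s)
      have "(LINT x|M. norm (s i x * w x - s j x * w x)) = (LINT x|M. norm (s i x - s j x) * w x)"
        by (rule Bochner_Integration.integral_cong)
           (use wpos less_imp_le in \<open>force simp: abs_mult left_diff_distrib[symmetric]\<close>)+
      also have "\<dots> \<le> l2norm M (\<lambda>x. norm (s i x - s j x)) * l2norm M w"
        using square_integrable_mult(2)[OF d wsq] by linarith
      also have "\<dots> = l2norm M (\<lambda>x. s i x - s j x) * l2norm M w" by (simp add: l2norm_def)
      also have "\<dots> \<le> l2norm M (\<lambda>x. s i x - s j x) * (l2norm M w + 1)" by (simp add: mult_left_mono)
      also have "\<dots> < e" using N that by (simp add: pos_less_divide_eq add_nonneg_pos)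
      finally show ?thesis .
    qed
    then show ?thesis by blast
  qed
  from cauchy_L1_AE_cauchy_subseq[OF L1 this] obtain r :: "nat \<Rightarrow> nat"
    where r: "strict_mono r" "AE x in M. Cauchy (\<lambda>i. s (r i) x * w x)" by blast
  define f where "f x = lim (\<lambda>i. s (r i) x)" for x
  have [measurable]: "f \<in> borel_measurable M" unfolding f_def[abs_def] by (rule borel_measurable_lim_metric) auto
  have conv: "AE x in M. (\<lambda>i. s (r i) x) \<longlonglongrightarrow> f x"
    using r(2) AE_space
  proof eventually_elim
    case (elim x)
    then have "(\<lambda>i. (s (r i) x * w x) / w x) \<longlonglongrightarrow> lim (\<lambda>i. s (r i) x * w x) / w x"
      using wpos[of x] by (intro tendsto_divide tendsto_const) (auto simp: Cauchy_convergent_iff convergent_LIMSEQ_iff)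
    then have "convergent (\<lambda>i. s (r i) x)" using wpos[of x] elim by (auto simp: convergent_def)
    then show ?case by (simp add: f_def convergent_LIMSEQ_iff)
  qed
  have fatou: "(\<integral>\<^sup>+x. ennreal ((s n x - f x)\<^sup>2) \<partial>M) \<le> ennreal (e\<^sup>2)"
    if e: "e > 0" and N: "\<forall>i\<ge>N. \<forall>j\<ge>N. l2norm M (\<lambda>x. s i x - s j x) < e" and n: "n \<ge> N" for e N n
  proof -
    have "(\<integral>\<^sup>+x. ennreal ((s n x - f x)\<^sup>2) \<partial>M) = (\<integral>\<^sup>+x. liminf (\<lambda>i. ennreal ((s n x - s (r i) x)\<^sup>2)) \<partial>M)"
    proof (rule nn_integral_cong_AE)
      show "AE x in M. ennreal ((s n x - f x)\<^sup>2) = liminf (\<lambda>i. ennreal ((s n x - s (r i) x)\<^sup>2))"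
        using conv
      proof eventually_elim
        case (elim x)
        have "(\<lambda>i. ennreal ((s n x - s (r i) x)\<^sup>2)) \<longlonglongrightarrow> ennreal ((s n x - f x)\<^sup>2)"
          by (intro tendsto_ennrealI tendsto_intros elim)
        then show ?case using lim_imp_Liminf[OF sequentially_bot] by metis
      qed
    qed
    also have "\<dots> \<le> liminf (\<lambda>i. \<integral>\<^sup>+x. ennreal ((s n x - s (r i) x)\<^sup>2) \<partial>M)"
      by (rule nn_integral_liminf) auto
    also have "\<dots> \<le> ennreal (e\<^sup>2)"
    proof (rule Liminf_le)
      show "\<forall>\<^sub>F i in sequentially. (\<integral>\<^sup>+x. ennreal ((s n x - s (r i) x)\<^sup>2) \<partial>M) \<le> ennreal (e\<^sup>2)"
      proof (rule eventually_sequentiallyI[of N])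
        fix i assume "N \<le> i"
        then have "r i \<ge> N" using seq_suble[OF r(1), of i] by linarith
        have "square_integrable M (\<lambda>x. s n x - s (r i) x)" by (intro square_integrable_diff s)
        then have "(\<integral>\<^sup>+x. ennreal ((s n x - s (r i) x)\<^sup>2) \<partial>M) = ennreal ((l2norm M (\<lambda>x. s n x - s (r i) x))\<^sup>2)"
          unfolding l2norm_power2 by (subst nn_integral_eq_integral) (auto simp: square_integrable_def)
        also have "\<dots> \<le> ennreal (e\<^sup>2)"
          using N n \<open>r i \<ge> N\<close> by (intro ennreal_leI power_mono) (auto simp: less_imp_le)
        finally show "(\<integral>\<^sup>+x. ennreal ((s n x - s (r i) x)\<^sup>2) \<partial>M) \<le> ennreal (e\<^sup>2)" .
      qed
    qed auto
    finally show ?thesis .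
  qed
  have sqd: "square_integrable M (\<lambda>x. s n x - f x)"
    if "e > 0" "\<forall>i\<ge>N. \<forall>j\<ge>N. l2norm M (\<lambda>x. s i x - s j x) < e" "n \<ge> N" for e N n
  proof -
    have "(\<integral>\<^sup>+x. ennreal ((s n x - f x)\<^sup>2) \<partial>M) < \<infinity>"
      using fatou[OF that] by (simp add: order_le_less_trans ennreal_less_top)
    then have "integrable M (\<lambda>x. (s n x - f x)\<^sup>2)" by (intro integrableI_nonneg) auto
    then show ?thesis by (simp add: square_integrable_def)
  qed
  obtain N1 where N1: "\<forall>i\<ge>N1. \<forall>j\<ge>N1. l2norm M (\<lambda>x. s i x - s j x) < 1" using cauchy[of 1] by auto
  have "square_integrable M (\<lambda>x. s N1 x - (s N1 x - f x))"
    by (rule square_integrable_diff[OF s sqd[OF _ N1]]) auto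
  then have fsq: "square_integrable M f" by simp
  have "(\<lambda>n. l2norm M (\<lambda>x. s n x - f x)) \<longlonglongrightarrow> 0"
  proof (rule LIMSEQ_I)
    fix e :: real assume "e > 0"
    then have e: "e / 2 > 0" by simp
    obtain N where N: "\<forall>i\<ge>N. \<forall>j\<ge>N. l2norm M (\<lambda>x. s i x - s j x) < e / 2" using cauchy[OF e] by blast
    have "norm (l2norm M (\<lambda>x. s n x - f x) - 0) < e" if n: "n \<ge> N" for n
    proof -
      have "ennreal ((l2norm M (\<lambda>x. s n x - f x))\<^sup>2) = (\<integral>\<^sup>+x. ennreal ((s n x - f x)\<^sup>2) \<partial>M)"
        unfolding l2norm_power2 using sqd[OF e N n]
        by (subst nn_integral_eq_integral) (auto simp: square_integrable_def)
      also have "\<dots> \<le> ennreal ((e / 2)\<^sup>2)" by (rule fatou[OF e N n])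
      finally have "(l2norm M (\<lambda>x. s n x - f x))\<^sup>2 \<le> (e / 2)\<^sup>2" by (simp add: ennreal_le_iff)
      then have "l2norm M (\<lambda>x. s n x - f x) \<le> e / 2" using e power2_le_imp_le by fastforce
      then show ?thesis using \<open>e > 0\<close> by simp
    qed
    then show "\<exists>no. \<forall>n\<ge>no. norm (l2norm M (\<lambda>x. s n x - f x) - 0) < e" by blast
  qed
  with fsq that show ?thesis by blast
qed

subsection \<open>Integration against test functions\<close>

lemma sigma_finite_lebesgue_on:
  "S \<in> sets lebesgue \<Longrightarrow> sigma_finite_measure (lebesgue_on S)"
proof (rule sigma_finite_measure_restrict_space)
  obtain A :: "'a set set" where A: "countable A" "A \<subseteq> sets lborel" "\<Union>A = space lborel"
    "\<forall>a\<in>A. emeasure lborel a \<noteq> \<infinity>"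
    using sigma_finite_measure.sigma_finite_countable[OF sigma_finite_lborel] by auto
  show "sigma_finite_measure (lebesgue :: 'a measure)"
    by standard (use A in \<open>auto intro!: exI[of _ A] simp: emeasure_completion\<close>)
qed

lemma integrable_lebesgue_compact_support:
  fixes f :: "'a::euclidean_space \<Rightarrow> real"
  assumes "continuous_on UNIV f" "compact C" "\<And>x. x \<notin> C \<Longrightarrow> f x = 0"
  shows "integrable lebesgue f"
proof -
  have "integrable lborel (\<lambda>x. indicator C x *\<^sub>R f x)"
    by (rule borel_integrable_compact) (use assms continuous_on_subset[of UNIV f C] in auto)
  moreover have "(\<lambda>x. indicator C x *\<^sub>R f x) = f" using assms(3) by (auto simp: indicator_def fun_eq_iff)
  ultimately show ?thesis 
    by (simp add: integrable_completion borel_measurable_continuous_onI assms(1))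
qed

lemma smooth_measurable_lebesgue_on:
  "smooth f \<Longrightarrow> S \<in> sets lebesgue \<Longrightarrow> f \<in> borel_measurable (lebesgue_on S)"
  by (rule continuous_imp_measurable_on_sets_lebesgue[OF smooth_continuous_on])

lemma smooth_measurable_lebesgue: "smooth f \<Longrightarrow> f \<in> borel_measurable lebesgue"
  using smooth_measurable_lebesgue_on[of f UNIV] by (simp add: lebesgue_on_UNIV_eq)

lemma test_functions_integrable: "\<phi> \<in> test_functions U \<Longrightarrow> integrable lebesgue \<phi>"
  by (meson integrable_lebesgue_compact_support smooth_continuous_on test_functionsE test_functions_smooth)

section \<open>Affine changes of variables and integration by parts\<close>

lemma lebesgue_affine_eq:
  fixes t :: "'a::euclidean_space"
  assumes "c \<noteq> 0"
  shows "lebesgue = density (distr lebesgue lebesgue (\<lambda>x. t + c *\<^sub>R x)) (\<lambda>_. ennreal (\<bar>c\<bar> ^ DIM('a)))"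
    and "(\<lambda>x. t + c *\<^sub>R x) \<in> lebesgue \<rightarrow>\<^sub>M lebesgue"
proof -
  have "(\<Sum>j\<in>Basis. (c * (x \<bullet> j)) *\<^sub>R j) = c *\<^sub>R x" for x :: 'a
    by (simp flip: scaleR_scaleR scaleR_sum_right add: euclidean_representation)
  then have T: "(\<lambda>x. t + (\<Sum>j\<in>Basis. (c * (x \<bullet> j)) *\<^sub>R j)) = (\<lambda>x. t + c *\<^sub>R x)" by simp
  show "lebesgue = density (distr lebesgue lebesgue (\<lambda>x. t + c *\<^sub>R x)) (\<lambda>_. ennreal (\<bar>c\<bar> ^ DIM('a)))"
    using lebesgue_affine_euclidean[of "\<lambda>_. c" t] assms unfolding T by (simp add: prod_constant)
  show "(\<lambda>x. t + c *\<^sub>R x) \<in> lebesgue \<rightarrow>\<^sub>M lebesgue"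
    using lebesgue_affine_measurable[of "\<lambda>_. c" t] assms unfolding T by simp
qed

lemma integral_lebesgue_affine:
  fixes f :: "'a::euclidean_space \<Rightarrow> real"
  assumes c: "c \<noteq> 0" and f: "f \<in> borel_measurable lebesgue"
  shows "integral\<^sup>L lebesgue f = \<bar>c\<bar> ^ DIM('a) * (\<integral>x. f (t + c *\<^sub>R x) \<partial>lebesgue)"
    and "integrable lebesgue (\<lambda>x. f (t + c *\<^sub>R x)) \<longleftrightarrow> integrable lebesgue f"
proof -
  note m = lebesgue_affine_eq(2)[OF c, of t]
  have fm: "f \<in> borel_measurable (distr lebesgue lebesgue (\<lambda>x. t + c *\<^sub>R x))"
    using f by simp
  have "integral\<^sup>L lebesgue f = (\<integral>x. f x \<partial>density (distr lebesgue lebesgue (\<lambda>x. t + c *\<^sub>R x)) (\<lambda>_. ennreal (\<bar>c\<bar> ^ DIM('a))))"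
    using lebesgue_affine_eq(1)[OF c, of t] by simp
  also have "\<dots> = (\<integral>x. \<bar>c\<bar> ^ DIM('a) *\<^sub>R f x \<partial>distr lebesgue lebesgue (\<lambda>x. t + c *\<^sub>R x))"
    using fm by (subst integral_density) auto
  also have "\<dots> = (\<integral>x. \<bar>c\<bar> ^ DIM('a) *\<^sub>R f (t + c *\<^sub>R x) \<partial>lebesgue)"
    by (rule integral_distr[OF m]) (use f in auto)
  finally show "integral\<^sup>L lebesgue f = \<bar>c\<bar> ^ DIM('a) * (\<integral>x. f (t + c *\<^sub>R x) \<partial>lebesgue)" by simp
  have "integrable lebesgue f \<longleftrightarrow> integrable (density (distr lebesgue lebesgue (\<lambda>x. t + c *\<^sub>R x)) (\<lambda>_. ennreal (\<bar>c\<bar> ^ DIM('a)))) f"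
    using lebesgue_affine_eq(1)[OF c, of t] by simp
  also have "\<dots> \<longleftrightarrow> integrable (distr lebesgue lebesgue (\<lambda>x. t + c *\<^sub>R x)) (\<lambda>x. \<bar>c\<bar> ^ DIM('a) *\<^sub>R f x)"
    using fm by (subst integrable_density) auto
  also have "\<dots> \<longleftrightarrow> integrable lebesgue (\<lambda>x. \<bar>c\<bar> ^ DIM('a) *\<^sub>R f (t + c *\<^sub>R x))"
    by (rule integrable_distr_eq[OF m]) (use f in auto)
  finally show "integrable lebesgue (\<lambda>x. f (t + c *\<^sub>R x)) \<longleftrightarrow> integrable lebesgue f"
    using c by simp
qed

text \<open>The difference quotients have integral zero by translation invariance; they converge to
  the derivative and are dominated by means of the mean value theorem.\<close>

lemma integral_partial_test_function:
  assumes \<phi>: "\<phi> \<in> test_functions U" and b: "b \<in> Basis"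
  shows "(\<integral>x. partial b \<phi> x \<partial>lebesgue) = 0"
proof -
  let ?t = "\<lambda>n. inverse (real (Suc n))"
  let ?q = "\<lambda>n x. (\<phi> (x + ?t n *\<^sub>R b) - \<phi> x) / ?t n"
  have sm: "smooth \<phi>" and sp: "smooth (partial b \<phi>)"
    using \<phi> b by (auto intro: test_functions_smooth smooth_partial)
  obtain C where C: "compact C" "\<And>x. x \<notin> C \<Longrightarrow> \<phi> x = 0" by (rule test_functionsE[OF \<phi>]) blast
  obtain R where R: "R > 0" "\<And>x. x \<in> C \<Longrightarrow> norm x \<le> R"
    using compact_imp_bounded[OF C(1)] unfolding bounded_pos by blast
  \<comment> \<open>Shifts have length at most 1: the quotients vanish outside radius R + 1, and for
    x inside it the mean value point stays within radius R + 2.\<close>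
  have "bounded (partial b \<phi> ` cball 0 (R + 2))"
    by (intro compact_imp_bounded compact_continuous_image smooth_continuous_on sp) auto
  then obtain B where B: "B > 0" "\<And>x. x \<in> cball 0 (R + 2) \<Longrightarrow> norm (partial b \<phi> x) \<le> B"
    unfolding bounded_pos by blast
  have pos: "0 < ?t n" "?t n \<le> 1" for n by (auto simp: field_simps)
  have trans: "(\<integral>x. ?q n x \<partial>lebesgue) = 0" for n
  proof -
    have i: "integrable lebesgue \<phi>" by (rule test_functions_integrable[OF \<phi>])
    then have m: "\<phi> \<in> borel_measurable lebesgue" by auto
    have "integrable lebesgue (\<lambda>x. \<phi> (x + ?t n *\<^sub>R b))"
      "(\<integral>x. \<phi> (x + ?t n *\<^sub>R b) \<partial>lebesgue) = integral\<^sup>L lebesgue \<phi>"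
      using integral_lebesgue_affine[of 1 \<phi> "?t n *\<^sub>R b"] i m by (simp_all add: add.commute)
    with i show ?thesis by simp
  qed
  have "(\<lambda>n. \<integral>x. ?q n x \<partial>lebesgue) \<longlonglongrightarrow> (\<integral>x. partial b \<phi> x \<partial>lebesgue)"
  proof (rule integral_dominated_convergence)
    show "integrable lebesgue (\<lambda>x. indicat_real (cball 0 (R + 1)) x * B)"
      by (intro integrable_mult_left integrable_real_indicator) (use emeasure_bounded_finite[OF bounded_cball] in auto)
    show "partial b \<phi> \<in> borel_measurable lebesgue" by (rule smooth_measurable_lebesgue[OF sp])
    have "(\<lambda>x. \<phi> (x + ?t n *\<^sub>R b)) \<in> borel_measurable lebesgue" for n
      using measurable_compose[OF lebesgue_affine_eq(2)[of 1 "?t n *\<^sub>R b"] smooth_measurable_lebesgue[OF sm]]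
      by (simp add: add.commute)
    then show "?q n \<in> borel_measurable lebesgue" for n
      using smooth_measurable_lebesgue[OF sm] by (intro borel_measurable_divide borel_measurable_diff) auto
    show "AE x in lebesgue. (\<lambda>n. ?q n x) \<longlonglongrightarrow> partial b \<phi> x"
    proof (rule AE_I2)
      fix x
      have "\<exists>s. 0 < s \<and> s < ?t n \<and> ?q n x = partial b \<phi> (x + s *\<^sub>R b)" for n
      proof -
        obtain s where s: "0 < s" "s < ?t n" "\<phi> (x + ?t n *\<^sub>R b) - \<phi> x = ?t n * partial b \<phi> (x + s *\<^sub>R b)"
          using smooth_mean_value[OF sm pos(1)[of n], where x=x and b=b] by blast
        have "?q n x = partial b \<phi> (x + s *\<^sub>R b)" unfolding s(3) using pos(1)[of n] by simp
        with s show ?thesis by blast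
      qed
      then obtain s where s: "\<And>n. 0 < s n \<and> s n < ?t n \<and> ?q n x = partial b \<phi> (x + s n *\<^sub>R b)" by metis
      have "s \<longlonglongrightarrow> 0"
        by (rule tendsto_sandwich[OF _ _ tendsto_const LIMSEQ_inverse_real_of_nat])
           (use s less_imp_le in \<open>auto intro!: always_eventually\<close>)
      then have "(\<lambda>n. x + s n *\<^sub>R b) \<longlonglongrightarrow> x + 0 *\<^sub>R b" by (intro tendsto_intros)
      then have "(\<lambda>n. partial b \<phi> (x + s n *\<^sub>R b)) \<longlonglongrightarrow> partial b \<phi> x"
        using smooth_continuous_on[OF sp, of UNIV]
        by (intro isCont_tendsto_compose[of _ "partial b \<phi>"]) (auto simp: continuous_on_eq_continuous_at)
      then show "(\<lambda>n. ?q n x) \<longlonglongrightarrow> partial b \<phi> x" using s by simp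
    qed
    show "AE x in lebesgue. norm (?q n x) \<le> indicat_real (cball 0 (R + 1)) x * B" for n
    proof (rule AE_I2)
      fix x
      show "norm (?q n x) \<le> indicat_real (cball 0 (R + 1)) x * B"
      proof (cases "x \<in> cball 0 (R + 1)")
        case True
        obtain s where s: "0 < s" "s < ?t n" "\<phi> (x + ?t n *\<^sub>R b) - \<phi> x = ?t n * partial b \<phi> (x + s *\<^sub>R b)"
          using smooth_mean_value[OF sm pos(1)[of n], where x=x and b=b] by blast
        have "?q n x = partial b \<phi> (x + s *\<^sub>R b)" unfolding s(3) using pos(1)[of n] by simp
        moreover have "x + s *\<^sub>R b \<in> cball 0 (R + 2)"
          using True s pos(2)[of n] b norm_triangle_ineq[of x "s *\<^sub>R b"] by simp
        ultimately show ?thesis using B True by simp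
      next
        case False
        then have "R + 1 < norm x" by simp
        moreover have "norm x - norm (?t n *\<^sub>R b) \<le> norm (x + ?t n *\<^sub>R b)"
          using norm_diff_ineq by blast
        moreover have "norm (?t n *\<^sub>R b) \<le> 1" using b pos(2)[of n] by simp
        ultimately have "norm (x + ?t n *\<^sub>R b) > R" "norm x > R" by linarith+
        then have "\<phi> (x + ?t n *\<^sub>R b) = 0" "\<phi> x = 0" using R C(2) by (meson not_le)+
        then show ?thesis using B by simp
      qed
    qed
  qed
  then show ?thesis unfolding trans using LIMSEQ_unique tendsto_const by blast
qed

lemma integral_partial_by_parts:
  assumes "smooth f" "\<phi> \<in> test_functions U" "b \<in> Basis"
  shows "(\<integral>x. partial b f x * \<phi> x \<partial>lebesgue) = - (\<integral>x. f x * partial b \<phi> x \<partial>lebesgue)"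
proof -
  have s: "smooth \<phi>" by (rule test_functions_smooth[OF assms(2)])
  have t: "(\<lambda>x. f x * \<phi> x) \<in> test_functions U" by (rule test_functions_mult) (use assms in auto)
  have i: "integrable lebesgue (\<lambda>x. partial b f x * \<phi> x)" "integrable lebesgue (\<lambda>x. f x * partial b \<phi> x)"
    by (rule test_functions_integrable[of _ U], rule test_functions_mult,
        use assms in \<open>auto intro: test_functions_partial smooth_partial\<close>)+
  have "0 = (\<integral>x. partial b (\<lambda>x. f x * \<phi> x) x \<partial>lebesgue)"
    using integral_partial_test_function[OF t assms(3)] by simp
  also have "\<dots> = (\<integral>x. partial b f x * \<phi> x + f x * partial b \<phi> x \<partial>lebesgue)"
    using assms s by (subst partial_mult) (auto intro: smooth_differentiable)
  also have "\<dots> = (\<integral>x. partial b f x * \<phi> x \<partial>lebesgue) + (\<integral>x. f x * partial b \<phi> x \<partial>lebesgue)"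
    by (rule Bochner_Integration.integral_add[OF i])
  finally show ?thesis by simp
qed

lemma integral_partials_by_parts:
  assumes "smooth f" "\<phi> \<in> test_functions U" "bs \<in> lists Basis"
  shows "(\<integral>x. partials bs f x * \<phi> x \<partial>lebesgue) = (-1) ^ length bs * (\<integral>x. f x * partials bs \<phi> x \<partial>lebesgue)"
  using assms(3,2)
proof (induction bs arbitrary: \<phi>)
  case (Cons b bs)
  then have b: "b \<in> Basis" "bs \<in> lists Basis" by auto
  have "(\<integral>x. partials (b # bs) f x * \<phi> x \<partial>lebesgue) = - (\<integral>x. partials bs f x * partial b \<phi> x \<partial>lebesgue)"
    unfolding partials_Cons using b assms Cons.prems
    by (intro integral_partial_by_parts) (auto intro: smooth_partials)
  also have "\<dots> = - ((-1) ^ length bs * (\<integral>x. f x * partials bs (partial b \<phi>) x \<partial>lebesgue))"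
    using b Cons by (subst Cons.IH) (auto intro: test_functions_partial)
  \<comment> \<open>The derivatives reach \<phi> in reversed order, so their commutation is used
    here.\<close>
  also have "partials bs (partial b \<phi>) = partials (b # bs) \<phi>"
    using b Cons.prems partials_partial_commute[of \<phi> bs b] by (simp add: partials_Cons test_functions_smooth)
  finally show ?case by simp
qed simp

subsection \<open>Approximation of boxes and the fundamental lemma\<close>

text \<open>The case \<open>k = 0\<close> is the classical flat function. The factor
  \<open>(1 / t) ^ k\<close> makes the family closed under differentiation up to linear
  combinations.\<close>

definition flat_exp :: "nat \<Rightarrow> real \<Rightarrow> real" where
  "flat_exp k t = (if t > 0 then (1 / t) ^ k * exp (- (1 / t)) else 0)"

lemma flat_exp_tendsto_0: "(flat_exp k \<longlongrightarrow> 0) (at 0)"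
proof -
  have "(flat_exp k \<longlongrightarrow> 0) (at_right 0)"
  proof (rule Lim_transform_eventually)
    have "((\<lambda>t::real. t ^ k / exp t) \<longlongrightarrow> 0) at_top" by (rule tendsto_power_div_exp_0)
    then have "((\<lambda>t::real. (1 / t) ^ k / exp (1 / t)) \<longlongrightarrow> 0) (at_right 0)"
      by (rule filterlim_compose) (simp add: filterlim_inverse_at_top_right inverse_eq_divide[symmetric])
    then show "((\<lambda>t::real. (1 / t) ^ k * exp (- (1 / t))) \<longlongrightarrow> 0) (at_right 0)"
      by (simp add: exp_minus divide_inverse)
    show "\<forall>\<^sub>F t in at_right 0. (1 / t) ^ k * exp (- (1 / t)) = flat_exp k t"
      by (auto simp: eventually_at_filter flat_exp_def)
  qed
  moreover have "(flat_exp k \<longlongrightarrow> 0) (at_left 0)"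
    by (rule Lim_transform_eventually[OF tendsto_const])
       (auto simp: eventually_at_filter flat_exp_def)
  ultimately show ?thesis by (simp add: filterlim_split_at)
qed

lemma flat_exp_has_derivative:
  "(flat_exp k has_field_derivative (flat_exp (k + 2) t - real k * flat_exp (k + 1) t)) (at t)"
proof -
  consider "t > 0" | "t < 0" | "t = 0" by linarith
  then show ?thesis
  proof cases
    case 1
    have "((\<lambda>t. (1 / t) ^ k * exp (- (1 / t))) has_field_derivative
      (flat_exp (k + 2) t - real k * flat_exp (k + 1) t)) (at t)"
    proof -
      have i: "((\<lambda>t. 1 / t) has_field_derivative - (1 / t)\<^sup>2) (at t)"
        using 1 by (auto intro!: derivative_eq_intros simp: power2_eq_square)
      have e: "((\<lambda>t. exp (- (1 / t))) has_field_derivative exp (- (1 / t)) * (1 / t)\<^sup>2) (at t)"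
        using 1 by (auto intro!: derivative_eq_intros simp: power2_eq_square)
      show ?thesis
        by (rule DERIV_cong[OF DERIV_mult[OF DERIV_power[OF i, of k] e]])
           (use 1 in \<open>cases k; simp add: flat_exp_def power2_eq_square algebra_simps\<close>)
    qed
    then show ?thesis
      by (rule has_field_derivative_transform_within_open[where S="{0<..}"]) (use 1 in \<open>auto simp: flat_exp_def\<close>)
  next
    case 2
    have "((\<lambda>t. 0) has_field_derivative (flat_exp (k + 2) t - real k * flat_exp (k + 1) t)) (at t)"
      using 2 by (simp add: flat_exp_def)
    then show ?thesis
      by (rule has_field_derivative_transform_within_open[where S="{..<0}"]) (use 2 in \<open>auto simp: flat_exp_def\<close>)
  next
    case 3
    have "((\<lambda>h. (flat_exp k (0 + h) - flat_exp k 0) / h) \<longlongrightarrow> 0) (at 0)"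
    \<comment> \<open>At 0 the difference quotient of one member of the family is the next
      member.\<close>
    proof (rule Lim_transform_eventually[OF flat_exp_tendsto_0[of "Suc k"]])
      show "\<forall>\<^sub>F h in at 0. flat_exp (Suc k) h = (flat_exp k (0 + h) - flat_exp k 0) / h"
        by (auto simp: eventually_at_filter flat_exp_def)
    qed
    then show ?thesis using 3 by (simp add: DERIV_def flat_exp_def)
  qed
qed

text \<open>The inner derivative is the constant \<open>b \<bullet> v\<close>, so partial
  derivatives are linear combinations of the same family and the induction, with \<open>k\<close>
  generalised, closes.\<close>

lemma smooth_flat_exp_affine:
  fixes v :: "'a::euclidean_space"
  shows "smooth (\<lambda>x. flat_exp k (\<alpha> + x \<bullet> v))"
proof -
  have d: "((\<lambda>x. flat_exp k (\<alpha> + x \<bullet> v)) has_derivative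
      (\<lambda>h. (flat_exp (k + 2) (\<alpha> + x \<bullet> v) - real k * flat_exp (k + 1) (\<alpha> + x \<bullet> v)) * (h \<bullet> v))) (at x)" for k x
    by (rule has_derivative_compose[OF _ flat_exp_has_derivative[unfolded has_field_derivative_def], where f="\<lambda>x. \<alpha> + x \<bullet> v"])
       (auto intro!: derivative_eq_intros)
  have p: "partial b (\<lambda>x. flat_exp k (\<alpha> + x \<bullet> v)) =
      (\<lambda>x. (b \<bullet> v) * (flat_exp (k + 2) (\<alpha> + x \<bullet> v) + (- real k) * flat_exp (k + 1) (\<alpha> + x \<bullet> v)))" for b k
    using partial_eqI[OF d] by (simp add: mult.commute)
  have "diff_times n (\<lambda>x. flat_exp k (\<alpha> + x \<bullet> v))" for n k
  proof (induction n arbitrary: k)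
    case 0
    show ?case using d by (auto intro: differentiableI)
  next
    case (Suc n)
    show ?case unfolding diff_times.simps p using d
      by (intro conjI allI ballI diff_times_mult diff_times_add diff_times_const Suc) (blast intro: differentiableI)
  qed
  then show ?thesis by (simp add: smooth_iff_diff_times)
qed

lemma flat_exp_0_bounds: "0 \<le> flat_exp 0 t" "flat_exp 0 t \<le> 1"
  by (auto simp: flat_exp_def)

lemma flat_exp_0_tendsto:
  "(\<lambda>n. flat_exp 0 (real n * t)) \<longlonglongrightarrow> (if t > 0 then 1 else 0)"
proof (cases "t > 0")
  case True
  have "(\<lambda>n. exp (- (1 / t * (1 / real n)))) \<longlonglongrightarrow> exp (- (1 / t * 0))"
    by (intro tendsto_intros lim_1_over_n)
  moreover have "\<forall>\<^sub>F n in sequentially. exp (- (1 / t * (1 / real n))) = flat_exp 0 (real n * t)"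
    using eventually_gt_at_top[of 0] by eventually_elim (use True in \<open>auto simp: flat_exp_def\<close>)
  ultimately show ?thesis using True by (simp add: Lim_transform_eventually)
next
  case False
  then show ?thesis by (auto simp: flat_exp_def zero_less_mult_iff)
qed

text \<open>The functions are products over all coordinates of \<open>flat_exp 0\<close> evaluated
  at n times the signed distance to each of the two faces. Every factor lies in [0, 1] and tends to
  1 strictly inside the face and to 0 elsewhere.\<close>

lemma test_functions_box_approx:
  fixes a b :: "'a::euclidean_space"
  assumes "cbox a b \<subseteq> U"
  obtains \<phi> where "\<And>n::nat. \<phi> n \<in> test_functions U" "\<And>n x. 0 \<le> \<phi> n x \<and> \<phi> n x \<le> 1"
    "\<And>n x. x \<notin> cbox a b \<Longrightarrow> \<phi> n x = 0" "\<And>x. (\<lambda>n. \<phi> n x) \<longlonglongrightarrow> indicator (box a b) x"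
proof
  define \<phi> where "\<phi> n x = (\<Prod>i\<in>Basis. flat_exp 0 (real n * (x \<bullet> i - a \<bullet> i)) * flat_exp 0 (real n * (b \<bullet> i - x \<bullet> i)))"
    for n :: nat and x :: 'a
  have sm: "smooth (\<phi> n)" for n
  proof -
    have "smooth (\<lambda>x. \<Prod>i\<in>Basis. flat_exp 0 (- (real n * (a \<bullet> i)) + x \<bullet> (real n *\<^sub>R i))
        * flat_exp 0 (real n * (b \<bullet> i) + x \<bullet> (- real n *\<^sub>R i)))"
      by (intro smooth_prod smooth_mult smooth_flat_exp_affine)
    then show ?thesis by (simp add: \<phi>_def[abs_def] algebra_simps)
  qed
  show zero: "\<phi> n x = 0" if x: "x \<notin> cbox a b" for n x
  proof -
    obtain i where i: "i \<in> Basis" "x \<bullet> i < a \<bullet> i \<or> b \<bullet> i < x \<bullet> i"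
      using x unfolding mem_box by fastforce
    then have "flat_exp 0 (real n * (x \<bullet> i - a \<bullet> i)) * flat_exp 0 (real n * (b \<bullet> i - x \<bullet> i)) = 0"
      by (auto simp: flat_exp_def zero_less_mult_iff)
    then show ?thesis unfolding \<phi>_def using i(1) by (intro prod_zero) auto
  qed
  show "\<phi> n \<in> test_functions U" for n
    unfolding test_functions_iff using sm zero assms by (auto intro!: exI[of _ "cbox a b"])
  show "0 \<le> \<phi> n x \<and> \<phi> n x \<le> 1" for n x
    unfolding \<phi>_def by (auto intro!: prod_nonneg prod_le_1 mult_le_one simp: flat_exp_0_bounds)
  show "(\<lambda>n. \<phi> n x) \<longlonglongrightarrow> indicator (box a b) x" for x
  proof -
    have "(\<lambda>n. \<phi> n x) \<longlonglongrightarrow> (\<Prod>i\<in>Basis. (if x \<bullet> i - a \<bullet> i > 0 then 1 else 0) * (if b \<bullet> i - x \<bullet> i > 0 then 1 else 0))"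
      unfolding \<phi>_def by (intro tendsto_intros flat_exp_0_tendsto)
    also have "(\<Prod>i\<in>Basis. (if x \<bullet> i - a \<bullet> i > 0 then 1 else 0) * (if b \<bullet> i - x \<bullet> i > 0 then 1 else 0)) = indicat_real (box a b) x"
    proof (cases "x \<in> box a b")
      case True
      then show ?thesis by (auto simp: mem_box intro!: prod.neutral)
    next
      case False
      then obtain i where "i \<in> Basis" "\<not> (x \<bullet> i - a \<bullet> i > 0 \<and> b \<bullet> i - x \<bullet> i > 0)" by (auto simp: mem_box)
      then show ?thesis using False by (auto intro!: prod_zero bexI[of _ i])
    qed
    finally show ?thesis .
  qed
qed

text \<open>Open boxes form an intersection-stable generator of the Borel sets, so the vanishing of
  the integral spreads to all of them; the assumption on the whole space serves the step to
  complements. A Lebesgue set differs from a Borel set by a null set only.\<close>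

lemma AE_zero_if_integrals_over_boxes_zero:
  fixes f :: "'a::euclidean_space \<Rightarrow> real"
  assumes f: "integrable lebesgue f" and UNIV: "(\<integral>x. f x \<partial>lebesgue) = 0"
    and box: "\<And>a b. (\<integral>x. indicator (box a b) x * f x \<partial>lebesgue) = 0"
  shows "AE x in lebesgue. f x = 0"
proof (rule density_unique_real[OF f])
  have borel: "(\<integral>x. indicator A x * f x \<partial>lebesgue) = 0" if "A \<in> sets borel" for A
  proof -
    let ?G = "range (\<lambda>(a, b). box a b :: 'a set)"
    have lebesgue_box_sigma: "B \<in> sets lebesgue" if "B \<in> sigma_sets UNIV ?G" for B :: "'a set"
    proof -
      have "B \<in> sets borel" using that by (subst borel_eq_box) simp
      then show ?thesis by simp
    qed
    have "Int_stable ?G"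
      by (auto simp: Int_stable_def box_Int_box)
    moreover have "?G \<subseteq> Pow UNIV" by auto
    moreover have "A \<in> sigma_sets UNIV ?G" using that by (subst (asm) borel_eq_box) simp
    ultimately show ?thesis
    proof (induction rule: sigma_sets_induct_disjoint)
      case (basic A)
      then show ?case using box by auto
    next
      case empty
      then show ?case by simp
    next
      case (compl A)
      then have [measurable]: "A \<in> sets lebesgue" using lebesgue_box_sigma by blast
      have "(\<integral>x. indicator (UNIV - A) x * f x \<partial>lebesgue) = (\<integral>x. f x - indicator A x * f x \<partial>lebesgue)"
        by (rule Bochner_Integration.integral_cong) (auto simp: indicator_def)
      also have "\<dots> = 0" using compl UNIV f by (subst Bochner_Integration.integral_diff) (auto intro!: integrable_real_mult_indicator simp: mult.commute)
      finally show ?case .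
    next
      case (union A)
      then have A: "A i \<in> sets lebesgue" for i
        using lebesgue_box_sigma by blast
      have "set_integrable lebesgue (\<Union>i. A i) f"
        unfolding set_integrable_def by (rule integrable_mult_indicator[OF _ f]) (use A in auto)
      then have "(LINT x:(\<Union>i. A i)|lebesgue. f x) = (\<Sum>i. (LINT x:(A i)|lebesgue. f x))"
        by (intro lebesgue_integral_countable_add) (use A union(1) in \<open>auto simp: disjoint_family_on_def\<close>)
      also have "\<dots> = 0" using union by (simp add: set_lebesgue_integral_def)
      finally show ?case by (simp add: set_lebesgue_integral_def)
    qed
  qed
  show "integrable lebesgue (\<lambda>_::'a. 0::real)" by simp
  fix A :: "'a set" assume A: "A \<in> sets lebesgue"
  then obtain S N N' where S: "A = S \<union> N" "N \<subseteq> N'" "N' \<in> null_sets lborel" "S \<in> sets lborel"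
    by (rule sets_completionE)
  have "AE x in lebesgue. x \<notin> N'" using S(3) by (intro AE_not_in null_sets_completionI)
  then have "AE x in lebesgue. indicator A x * f x = indicator S x * f x"
    by eventually_elim (use S in \<open>auto simp: indicator_def\<close>)
  moreover have "f \<in> borel_measurable lebesgue" "S \<in> sets lebesgue" using f S by auto
  ultimately have "(\<integral>x. indicator A x * f x \<partial>lebesgue) = (\<integral>x. indicator S x * f x \<partial>lebesgue)"
    using A by (intro integral_cong_AE) auto
  then show "(\<integral>x\<in>A. f x \<partial>lebesgue) = (\<integral>x\<in>A. 0 \<partial>lebesgue)"
    using borel[of S] S by (simp add: set_lebesgue_integral_def)
qed

lemma locally_integrable_indicator:
  assumes "locally_integrable \<Omega> f" "compact C" "C \<subseteq> \<Omega>"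
  shows "integrable lebesgue (\<lambda>x. indicator C x * f x)"
  using assms integrable_restrict_space[of C lebesgue f]
  by (auto simp: locally_integrable_def compact_imp_closed borel_closed)

text \<open>Testing with approximations of box indicators gives zero integral over each open box
  whose closed box lies in \<Omega>. Hence f vanishes almost everywhere on each closed box in
  \<Omega>, and countably many of these cover \<Omega>.\<close>

theorem fundamental_lemma:
  fixes f :: "'a::euclidean_space \<Rightarrow> real"
  assumes \<Omega>: "open \<Omega>" and f: "locally_integrable \<Omega> f"
    and zero: "\<And>\<phi>. \<phi> \<in> test_functions \<Omega> \<Longrightarrow> (\<integral>x. f x * \<phi> x \<partial>lebesgue_on \<Omega>) = 0"
  shows "AE x in lebesgue_on \<Omega>. f x = 0"
proof -
  have \<Omega>s[measurable]: "\<Omega> \<in> sets lebesgue" using \<Omega> by (auto intro: borel_open)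
  have box: "(\<integral>x. indicator (box a b) x * f x \<partial>lebesgue) = 0" if ab: "cbox a b \<subseteq> \<Omega>" for a b
  proof -
    obtain \<phi> where \<phi>: "\<And>n::nat. \<phi> n \<in> test_functions \<Omega>" "\<And>n x. 0 \<le> \<phi> n x \<and> \<phi> n x \<le> 1"
      "\<And>n x. x \<notin> cbox a b \<Longrightarrow> \<phi> n x = 0" "\<And>x. (\<lambda>n. \<phi> n x) \<longlonglongrightarrow> indicator (box a b) x"
      using test_functions_box_approx[OF ab] by metis
    let ?F = "\<lambda>x. indicator (cbox a b) x * f x"
    have F: "integrable lebesgue ?F" by (rule locally_integrable_indicator[OF f]) (use ab in auto)
    have Fm[measurable]: "?F \<in> borel_measurable lebesgue" using F by auto
    have "(\<lambda>n. \<integral>x. \<phi> n x * ?F x \<partial>lebesgue) \<longlonglongrightarrow> (\<integral>x. indicator (box a b) x * ?F x \<partial>lebesgue)"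
    proof (rule integral_dominated_convergence)
      show "integrable lebesgue (\<lambda>x. norm (?F x))" using F by auto
      show "(\<lambda>x. indicator (box a b) x * ?F x) \<in> borel_measurable lebesgue" 
        by (intro borel_measurable_times Fm borel_measurable_indicator) auto
      show "(\<lambda>x. \<phi> n x * ?F x) \<in> borel_measurable lebesgue" for n
        using \<phi>(1) by (intro borel_measurable_times Fm smooth_measurable_lebesgue test_functions_smooth)
      show "AE x in lebesgue. (\<lambda>n. \<phi> n x * ?F x) \<longlonglongrightarrow> indicator (box a b) x * ?F x"
        by (intro AE_I2 tendsto_intros \<phi>)
      show "AE x in lebesgue. norm (\<phi> n x * ?F x) \<le> norm (?F x)" for n
        using \<phi>(2) by (intro AE_I2) (auto simp: abs_mult intro!: mult_left_le_one_le)
    qed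
    moreover have "(\<integral>x. \<phi> n x * ?F x \<partial>lebesgue) = 0" for n
    proof -
      have "(\<integral>x. \<phi> n x * ?F x \<partial>lebesgue) = (\<integral>x. indicator \<Omega> x *\<^sub>R (f x * \<phi> n x) \<partial>lebesgue)"
        by (rule Bochner_Integration.integral_cong) (use ab \<phi>(3) in \<open>auto simp: indicator_def\<close>)
      also have "\<dots> = (\<integral>x. f x * \<phi> n x \<partial>lebesgue_on \<Omega>)"
        by (subst integral_restrict_space) auto
      finally show ?thesis using zero[OF \<phi>(1)] by simp
    qed
    moreover have "(\<lambda>x. indicator (box a b) x * ?F x) = (\<lambda>x. indicator (box a b) x * f x)"
      using box_subset_cbox[of a b] by (intro ext) (auto simp: indicator_def)
    ultimately show ?thesis by (simp add: LIMSEQ_const_iff)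
  qed
  have cbox: "AE x in lebesgue. x \<in> cbox c d \<longrightarrow> f x = 0" if cd: "cbox c d \<subseteq> \<Omega>" for c d
  proof -
    let ?F = "\<lambda>x. indicator (box c d) x * f x"
    have "?F = (\<lambda>x. indicator (box c d) x * (indicator (cbox c d) x * f x))"
      using box_subset_cbox[of c d] by (intro ext) (auto simp: indicator_def)
    moreover have "integrable lebesgue (\<lambda>x. indicator (box c d) x *\<^sub>R (indicator (cbox c d) x * f x))"
      by (rule integrable_mult_indicator) (use locally_integrable_indicator[OF f] cd in auto)
    ultimately have F: "integrable lebesgue ?F" by simp
    have "AE x in lebesgue. ?F x = 0"
    proof (rule AE_zero_if_integrals_over_boxes_zero[OF F box[OF cd]])
      fix a b
      obtain a' b' where ab: "box a b \<inter> box c d = box a' b'" by (rule that[OF box_Int_box])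
      have "(\<integral>x. indicator (box a b) x * ?F x \<partial>lebesgue) = (\<integral>x. indicator (box a' b') x * f x \<partial>lebesgue)"
        unfolding ab[symmetric] by (rule Bochner_Integration.integral_cong) (auto simp: indicator_def)
      also have "\<dots> = 0"
      \<comment> \<open>If the open box is empty, the closed box with the same corners may be a
        nonempty degenerate box anywhere, so only the other case can appeal to
        \<open>box\<close>.\<close>
      proof (cases "box a' b' = {}")
        case False
        then have "closure (box a' b') = cbox a' b'" by (rule closure_box)
        moreover have "closure (box a' b') \<subseteq> cbox c d"
          using ab box_subset_cbox[of c d] by (intro closure_minimal) auto
        ultimately show ?thesis using cd by (intro box) auto
      qed simp
      finally show "(\<integral>x. indicator (box a b) x * ?F x \<partial>lebesgue) = 0" .
    qed
    moreover have "AE x in lebesgue. x \<notin> cbox c d - box c d"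
      using negligible_frontier_interval[of c d] by (intro AE_not_in) (simp add: negligible_iff_null_sets)
    ultimately show ?thesis by eventually_elim (auto simp: indicator_def)
  qed
  obtain \<D> where D: "countable \<D>" "\<D> \<subseteq> Pow \<Omega>" "\<And>X. X \<in> \<D> \<Longrightarrow> \<exists>a b. X = cbox a b" "\<Union>\<D> = \<Omega>"
    using open_countable_Union_open_cbox[OF \<Omega>] by metis
  have "AE x in lebesgue. \<forall>X\<in>\<D>. x \<in> X \<longrightarrow> f x = 0"
    unfolding AE_ball_countable[OF D(1)]
  proof
    fix X assume "X \<in> \<D>"
    then obtain a b where "X = cbox a b" "cbox a b \<subseteq> \<Omega>" using D by blast
    then show "AE x in lebesgue. x \<in> X \<longrightarrow> f x = 0" using cbox by simp
  qed
  then have "AE x in lebesgue. x \<in> \<Omega> \<longrightarrow> f x = 0" by eventually_elim (use D(4) in blast)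
  then show ?thesis by (subst AE_restrict_space_iff) auto
qed

subsection \<open>Weak derivatives\<close>

lemma sets_lebesgue_compact: "compact C \<Longrightarrow> C \<in> sets lebesgue"
  by (simp add: compact_imp_closed borel_closed)

lemma sets_lebesgue_open: "open S \<Longrightarrow> S \<in> sets lebesgue"
  by (simp add: borel_open)

lemma locally_integrableD:
  "locally_integrable \<Omega> f \<Longrightarrow> compact C \<Longrightarrow> C \<subseteq> \<Omega> \<Longrightarrow> integrable (lebesgue_on C) f"
  by (simp add: locally_integrable_def)

lemma locally_integrable_add:
  "locally_integrable \<Omega> f \<Longrightarrow> locally_integrable \<Omega> g \<Longrightarrow> locally_integrable \<Omega> (\<lambda>x. f x + g x)"
  by (simp add: locally_integrable_def)

lemma locally_integrable_cmult:
  "locally_integrable \<Omega> f \<Longrightarrow> locally_integrable \<Omega> (\<lambda>x. c * f x)"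
  by (simp add: locally_integrable_def)

lemma locally_integrable_zero: "locally_integrable \<Omega> (\<lambda>_. 0)"
  by (simp add: locally_integrable_def)

lemma locally_integrable_smooth: "smooth f \<Longrightarrow> locally_integrable \<Omega> f"
  unfolding locally_integrable_def
proof (intro allI impI)
  fix C :: "'a set" assume f: "smooth f" and C: "compact C \<and> C \<subseteq> \<Omega>"
  have "integrable lborel (\<lambda>x. indicator C x *\<^sub>R f x)"
    by (rule borel_integrable_compact) (use f C smooth_continuous_on in auto)
  then have "integrable lebesgue (\<lambda>x. indicator C x *\<^sub>R f x)"
    by (subst integrable_completion) (auto simp: borel_measurable_integrable)
  then show "integrable (lebesgue_on C) f"
    using C by (subst integrable_restrict_space) (auto simp: sets_lebesgue_compact)
qed

lemma square_integrable_restrict: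
  assumes "square_integrable (lebesgue_on \<Omega>) f" "C \<subseteq> \<Omega>" "C \<in> sets lebesgue" "\<Omega> \<in> sets lebesgue"
  shows "square_integrable (lebesgue_on C) f" "l2norm (lebesgue_on C) f \<le> l2norm (lebesgue_on \<Omega>) f"
proof -
  have i: "integrable lebesgue (\<lambda>x. indicator \<Omega> x *\<^sub>R (norm (f x))\<^sup>2)"
    using assms by (subst integrable_restrict_space[symmetric]) (auto simp: square_integrable_def)
  have "integrable lebesgue (\<lambda>x. indicator C x *\<^sub>R (indicator \<Omega> x *\<^sub>R (norm (f x))\<^sup>2))"
    by (rule integrable_mult_indicator[OF assms(3) i])
  moreover have "(\<lambda>x. indicator C x *\<^sub>R (indicator \<Omega> x *\<^sub>R (norm (f x))\<^sup>2)) = (\<lambda>x. indicator C x *\<^sub>R (norm (f x))\<^sup>2)"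
    using assms(2) by (auto simp: indicator_def fun_eq_iff)
  ultimately have j: "integrable lebesgue (\<lambda>x. indicator C x *\<^sub>R (norm (f x))\<^sup>2)" by simp
  then show "square_integrable (lebesgue_on C) f"
    using measurable_restrict_mono[of f lebesgue \<Omega> borel C] assms(1,2)
    unfolding square_integrable_def by (subst integrable_restrict_space) (simp_all add: assms(3))
  have "(\<integral>x. indicator C x *\<^sub>R (norm (f x))\<^sup>2 \<partial>lebesgue) \<le> (\<integral>x. indicator \<Omega> x *\<^sub>R (norm (f x))\<^sup>2 \<partial>lebesgue)"
    by (rule integral_mono[OF j i]) (use assms(2) in \<open>auto simp: indicator_def\<close>)
  then show "l2norm (lebesgue_on C) f \<le> l2norm (lebesgue_on \<Omega>) f"
    using assms unfolding l2norm_def by (simp add: integral_restrict_space)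
qed

lemma square_integrable_compact_imp_integrable:
  fixes f :: "'a::euclidean_space \<Rightarrow> real"
  assumes "square_integrable (lebesgue_on C) f" "compact C"
  shows "integrable (lebesgue_on C) f"
proof (rule Bochner_Integration.integrable_bound)
  have "integrable (lebesgue_on C) (\<lambda>_. 1::real)"
    by (rule finite_measure.integrable_const[OF finite_measure_lebesgue_on[OF lmeasurable_compact[OF assms(2)]]])
  then show "integrable (lebesgue_on C) (\<lambda>x. 1 + (norm (f x))\<^sup>2)"
    using assms by (auto simp: square_integrable_def)
  have "\<bar>f x\<bar> \<le> 1 + (f x)\<^sup>2" for x
    using sum_squares_bound[of "\<bar>f x\<bar>" 1] zero_le_power2[of "f x"] by auto
  then show "AE x in lebesgue_on C. norm (f x) \<le> norm (1 + (norm (f x))\<^sup>2)" by simp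
  show "f \<in> borel_measurable (lebesgue_on C)" using assms by (simp add: square_integrable_def)
qed

lemma square_integrable_imp_locally_integrable:
  fixes f :: "'a::euclidean_space \<Rightarrow> real"
  assumes "square_integrable (lebesgue_on \<Omega>) f" "\<Omega> \<in> sets lebesgue"
  shows "locally_integrable \<Omega> f"
  unfolding locally_integrable_def
  using assms square_integrable_restrict(1) square_integrable_compact_imp_integrable sets_lebesgue_compact by blast

text \<open>The definition speaks about compact sets only; measurability on \<Omega> is assembled
  from countably many closed boxes that exhaust it.\<close>

lemma locally_integrable_measurable:
  fixes f :: "'a::euclidean_space \<Rightarrow> real"
  assumes "open \<Omega>" "locally_integrable \<Omega> f"
  shows "f \<in> borel_measurable (lebesgue_on \<Omega>)"
proof -
  obtain \<D> where D: "countable \<D>" "\<D> \<subseteq> Pow \<Omega>" "\<And>X. X \<in> \<D> \<Longrightarrow> \<exists>a b. X = cbox a b" "\<Union>\<D> = \<Omega>"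
    using open_countable_Union_open_cbox[OF assms(1)] by metis
  show ?thesis
  proof (rule measurable_piecewise_restrict[OF D(1)])
    fix X assume X: "X \<in> \<D>"
    then have c: "compact X" "X \<subseteq> \<Omega>" using D(2) D(3)[OF X] compact_cbox by auto
    then have "X = X \<inter> \<Omega>" by auto
    then show "X \<inter> space (lebesgue_on \<Omega>) \<in> sets (lebesgue_on \<Omega>)"
      using c sets_lebesgue_compact[of X] assms(1) by (auto simp: sets_restrict_space_iff sets_lebesgue_open)
    have "restrict_space (lebesgue_on \<Omega>) X = lebesgue_on X"
      using c assms(1) sets_lebesgue_compact[of X]
      by (simp add: restrict_restrict_space inf_absorb2 sets_lebesgue_open)
    then show "f \<in> restrict_space (lebesgue_on \<Omega>) X \<rightarrow>\<^sub>M borel"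
      using locally_integrableD[OF assms(2) c] by auto
  qed (use D(4) in auto)
qed

text \<open>The product lives on the compact support of \<phi>, where \<phi> is bounded. The third
  fact moves pairings to the whole space, where integration by parts and changes of variables are
  available.\<close>

lemma locally_integrable_mult_test:
  assumes f: "locally_integrable \<Omega> f" and \<phi>: "\<phi> \<in> test_functions \<Omega>" and \<Omega>: "open \<Omega>"
  shows "integrable (lebesgue_on \<Omega>) (\<lambda>x. f x * \<phi> x)"
    and "integrable lebesgue (\<lambda>x. f x * \<phi> x)"
    and "(\<integral>x. f x * \<phi> x \<partial>lebesgue_on \<Omega>) = (\<integral>x. f x * \<phi> x \<partial>lebesgue)"
proof -
  obtain C where C: "compact C" "C \<subseteq> \<Omega>" "\<And>x. x \<notin> C \<Longrightarrow> \<phi> x = 0" by (rule test_functionsE[OF \<phi>]) blast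
  have "bounded (\<phi> ` C)"
    by (intro compact_imp_bounded compact_continuous_image smooth_continuous_on C test_functions_smooth[OF \<phi>])
  then obtain B where B: "B > 0" "\<And>x. x \<in> C \<Longrightarrow> norm (\<phi> x) \<le> B" unfolding bounded_pos by blast
  have F: "integrable lebesgue (\<lambda>x. indicator C x * f x)" by (rule locally_integrable_indicator[OF f C(1,2)])
  have e: "f x * \<phi> x = (indicator C x * f x) * \<phi> x" for x using C(3)[of x] by (auto simp: indicator_def)
  have "integrable lebesgue (\<lambda>x. (indicator C x * f x) * \<phi> x)"
  proof (rule Bochner_Integration.integrable_bound)
    show "integrable lebesgue (\<lambda>x. B * (indicator C x * f x))" using F by simp
    show "(\<lambda>x. indicat_real C x * f x * \<phi> x) \<in> borel_measurable lebesgue"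
      using borel_measurable_times[OF borel_measurable_integrable[OF F] smooth_measurable_lebesgue[OF test_functions_smooth[OF \<phi>]]] .
    have "norm (indicat_real C x * f x * \<phi> x) \<le> norm (B * (indicat_real C x * f x))" for x
      using B by (auto simp: indicator_def abs_mult mult.commute[of "\<bar>f x\<bar>"] intro!: mult_right_mono)
    then show "AE x in lebesgue. norm (indicat_real C x * f x * \<phi> x) \<le> norm (B * (indicat_real C x * f x))" by simp
  qed
  then show i: "integrable lebesgue (\<lambda>x. f x * \<phi> x)" using e by presburger
  have ind: "indicator \<Omega> x *\<^sub>R (f x * \<phi> x) = f x * \<phi> x" for x
    using C(2) C(3)[of x] by (auto simp: indicator_def)
  show "integrable (lebesgue_on \<Omega>) (\<lambda>x. f x * \<phi> x)"
    by (subst integrable_restrict_space) (simp add: sets_lebesgue_open[OF \<Omega>], simp only: ind i)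
  show "(\<integral>x. f x * \<phi> x \<partial>lebesgue_on \<Omega>) = (\<integral>x. f x * \<phi> x \<partial>lebesgue)"
    by (subst integral_restrict_space) (simp add: sets_lebesgue_open[OF \<Omega>], simp only: ind)
qed

section \<open>Uniqueness, linearity and composition of weak derivatives\<close>

lemma has_weak_partialsD:
  assumes "has_weak_partials \<Omega> bs f g"
  shows "locally_integrable \<Omega> f" "locally_integrable \<Omega> g"
    "\<phi> \<in> test_functions \<Omega> \<Longrightarrow>
      (\<integral>x. f x * partials bs \<phi> x \<partial>lebesgue_on \<Omega>) = (-1) ^ length bs * (\<integral>x. g x * \<phi> x \<partial>lebesgue_on \<Omega>)"
  using assms by (auto simp: has_weak_partials_def)

lemma has_weak_partials_unique:
  assumes \<Omega>: "open \<Omega>" and g: "has_weak_partials \<Omega> bs f g" and h: "has_weak_partials \<Omega> bs f h"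
  shows "AE x in lebesgue_on \<Omega>. g x = h x"
proof -
  have li: "locally_integrable \<Omega> g" "locally_integrable \<Omega> h"
    using g h has_weak_partialsD by blast+
  then have "locally_integrable \<Omega> (\<lambda>x. g x - h x)"
    using locally_integrable_add[OF _ locally_integrable_cmult, of \<Omega> g h "-1"] by simp
  then have "AE x in lebesgue_on \<Omega>. g x - h x = 0"
  proof (rule fundamental_lemma[OF \<Omega>])
    fix \<phi> assume \<phi>: "\<phi> \<in> test_functions \<Omega>"
    have "(\<integral>x. g x * \<phi> x \<partial>lebesgue_on \<Omega>) = (\<integral>x. h x * \<phi> x \<partial>lebesgue_on \<Omega>)"
      using has_weak_partialsD(3)[OF g \<phi>] has_weak_partialsD(3)[OF h \<phi>] by simp
    then show "(\<integral>x. (g x - h x) * \<phi> x \<partial>lebesgue_on \<Omega>) = 0"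
      using li \<phi> \<Omega> by (simp add: left_diff_distrib locally_integrable_mult_test)
  qed
  then show ?thesis by simp
qed

lemma has_weak_partials_add:
  assumes \<Omega>: "open \<Omega>" and bs: "bs \<in> lists Basis"
    and f: "has_weak_partials \<Omega> bs f f'" and g: "has_weak_partials \<Omega> bs g g'"
  shows "has_weak_partials \<Omega> bs (\<lambda>x. f x + g x) (\<lambda>x. f' x + g' x)"
  unfolding has_weak_partials_def
proof (intro conjI ballI)
  note li = has_weak_partialsD(1,2)[OF f] has_weak_partialsD(1,2)[OF g]
  show "locally_integrable \<Omega> (\<lambda>x. f x + g x)" "locally_integrable \<Omega> (\<lambda>x. f' x + g' x)"
    using li by (auto intro: locally_integrable_add)
  fix \<phi> assume \<phi>: "\<phi> \<in> test_functions \<Omega>"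
  show "(\<integral>x. (f x + g x) * partials bs \<phi> x \<partial>lebesgue_on \<Omega>) = (-1) ^ length bs * (\<integral>x. (f' x + g' x) * \<phi> x \<partial>lebesgue_on \<Omega>)"
    using li \<phi> \<Omega> bs has_weak_partialsD(3)[OF f \<phi>] has_weak_partialsD(3)[OF g \<phi>]
    by (simp add: distrib_right locally_integrable_mult_test test_functions_partials distrib_left)
qed

lemma has_weak_partials_cmult:
  assumes f: "has_weak_partials \<Omega> bs f f'"
  shows "has_weak_partials \<Omega> bs (\<lambda>x. c * f x) (\<lambda>x. c * f' x)"
  using f by (auto simp: has_weak_partials_def locally_integrable_cmult mult.assoc)

lemma has_weak_partials_zero: "has_weak_partials \<Omega> bs (\<lambda>_. 0) (\<lambda>_. 0)"
  by (simp add: has_weak_partials_def locally_integrable_zero)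

lemma has_weak_partials_sum:
  assumes "open \<Omega>" "bs \<in> lists Basis" "\<And>i. i \<in> I \<Longrightarrow> has_weak_partials \<Omega> bs (f i) (f' i)"
  shows "has_weak_partials \<Omega> bs (\<lambda>x. \<Sum>i\<in>I. f i x) (\<lambda>x. \<Sum>i\<in>I. f' i x)"
  using assms(3)
  by (induction I rule: infinite_finite_induct)
     (auto simp: has_weak_partials_zero intro: has_weak_partials_add[OF assms(1,2)])

lemma has_weak_partials_smooth:
  assumes \<Omega>: "open \<Omega>" and f: "smooth f" and bs: "bs \<in> lists Basis"
  shows "has_weak_partials \<Omega> bs f (partials bs f)"
  unfolding has_weak_partials_def
proof (intro conjI ballI)
  show li: "locally_integrable \<Omega> f" "locally_integrable \<Omega> (partials bs f)"
    using f bs by (auto intro: locally_integrable_smooth smooth_partials)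
  fix \<phi> assume \<phi>: "\<phi> \<in> test_functions \<Omega>"
  have "(\<integral>x. partials bs f x * \<phi> x \<partial>lebesgue) = (-1) ^ length bs * (\<integral>x. f x * partials bs \<phi> x \<partial>lebesgue)"
    by (rule integral_partials_by_parts[OF f \<phi> bs])
  then have "(-1) ^ length bs * (\<integral>x. partials bs f x * \<phi> x \<partial>lebesgue) = (\<integral>x. f x * partials bs \<phi> x \<partial>lebesgue)"
    by (simp add: mult.assoc[symmetric] power_add[symmetric])
  then show "(\<integral>x. f x * partials bs \<phi> x \<partial>lebesgue_on \<Omega>) = (-1) ^ length bs * (\<integral>x. partials bs f x * \<phi> x \<partial>lebesgue_on \<Omega>)"
    using li \<phi> \<Omega> bs by (simp add: locally_integrable_mult_test test_functions_partials)
qed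

text \<open>The order is dual to that of \<open>partials_append\<close>: on test functions
  \<open>cs\<close> acts first, so on the weak side \<open>bs\<close> is the derivative taken
  first.\<close>

lemma has_weak_partials_append:
  assumes f: "has_weak_partials \<Omega> bs f g" and h: "has_weak_partials \<Omega> (bs @ cs) f h" and cs: "cs \<in> lists Basis"
  shows "has_weak_partials \<Omega> cs g h"
  unfolding has_weak_partials_def
proof (intro conjI ballI)
  show "locally_integrable \<Omega> g" "locally_integrable \<Omega> h" using f h has_weak_partialsD by blast+
  fix \<phi> assume \<phi>: "\<phi> \<in> test_functions \<Omega>"
  have "(-1) ^ length bs * (\<integral>x. g x * partials cs \<phi> x \<partial>lebesgue_on \<Omega>) = (\<integral>x. f x * partials bs (partials cs \<phi>) x \<partial>lebesgue_on \<Omega>)"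
    using has_weak_partialsD(3)[OF f test_functions_partials[OF \<phi> cs]] by simp
  also have "\<dots> = (-1) ^ length bs * ((-1) ^ length cs * (\<integral>x. h x * \<phi> x \<partial>lebesgue_on \<Omega>))"
    using has_weak_partialsD(3)[OF h \<phi>] by (simp add: partials_append power_add)
  finally show "(\<integral>x. g x * partials cs \<phi> x \<partial>lebesgue_on \<Omega>) = (-1) ^ length cs * (\<integral>x. h x * \<phi> x \<partial>lebesgue_on \<Omega>)"
    by simp
qed

lemma integral_mult_cong_AE:
  fixes f :: "'a::euclidean_space \<Rightarrow> real"
  assumes \<Omega>: "open \<Omega>" and li: "locally_integrable \<Omega> f" "locally_integrable \<Omega> f'"
    and ae: "AE x in lebesgue_on \<Omega>. f x = f' x" and \<phi>: "smooth \<phi>"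
  shows "(\<integral>x. f x * \<phi> x \<partial>lebesgue_on \<Omega>) = (\<integral>x. f' x * \<phi> x \<partial>lebesgue_on \<Omega>)"
proof (rule integral_cong_AE)
  show "AE x in lebesgue_on \<Omega>. f x * \<phi> x = f' x * \<phi> x" using ae by eventually_elim simp
qed (use li \<Omega> \<phi> in \<open>intro borel_measurable_times locally_integrable_measurable smooth_measurable_lebesgue_on sets_lebesgue_open; simp\<close>)+

text \<open>The conclusion is an equality of functions, not merely almost everywhere: both sides are
  chosen from the same set of candidates. This is what allows operators to be iterated on arguments
  known only almost everywhere.\<close>

lemma weak_partials_cong_AE:
  fixes f :: "'a::euclidean_space \<Rightarrow> real"
  assumes \<Omega>: "open \<Omega>" and bs: "bs \<in> lists Basis"
    and li: "locally_integrable \<Omega> f" "locally_integrable \<Omega> f'"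
    and ae: "AE x in lebesgue_on \<Omega>. f x = f' x"
  shows "weak_partials \<Omega> bs f = weak_partials \<Omega> bs f'"
proof -
  have "(\<integral>x. f x * partials bs \<phi> x \<partial>lebesgue_on \<Omega>) = (\<integral>x. f' x * partials bs \<phi> x \<partial>lebesgue_on \<Omega>)"
    if "\<phi> \<in> test_functions \<Omega>" for \<phi>
    using that bs by (intro integral_mult_cong_AE[OF \<Omega> li ae] smooth_partials test_functions_smooth)
  then have "has_weak_partials \<Omega> bs f g \<longleftrightarrow> has_weak_partials \<Omega> bs f' g" for g
    using li by (auto simp: has_weak_partials_def)
  then show ?thesis by (simp add: weak_partials_def)
qed

text \<open>No integrability over \<Omega> is demanded of the derivatives: those of lower order of
  an element of the completion are only controlled locally or with a weight.\<close>

definition weakly_diff :: "nat \<Rightarrow> 'a::euclidean_space set \<Rightarrow> ('a \<Rightarrow> real) \<Rightarrow> bool" where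
  "weakly_diff m \<Omega> f \<longleftrightarrow> (\<forall>bs\<in>lists Basis. length bs \<le> m \<longrightarrow> (\<exists>g. has_weak_partials \<Omega> bs f g))"

lemma weakly_diffD:
  "weakly_diff m \<Omega> f \<Longrightarrow> bs \<in> lists Basis \<Longrightarrow> length bs \<le> m \<Longrightarrow>
    has_weak_partials \<Omega> bs f (weak_partials \<Omega> bs f)"
  unfolding weakly_diff_def weak_partials_def by (metis someI_ex)

lemma weakly_diff_locally_integrable: "weakly_diff m \<Omega> f \<Longrightarrow> locally_integrable \<Omega> f"
  using weakly_diffD[of m \<Omega> f "[]"] has_weak_partialsD(1) by auto

lemma weak_partials_locally_integrable:
  "weakly_diff m \<Omega> f \<Longrightarrow> bs \<in> lists Basis \<Longrightarrow> length bs \<le> m \<Longrightarrow> locally_integrable \<Omega> (weak_partials \<Omega> bs f)"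
  using weakly_diffD has_weak_partialsD(2) by blast

lemma weakly_diff_mono: "weakly_diff m \<Omega> f \<Longrightarrow> k \<le> m \<Longrightarrow> weakly_diff k \<Omega> f"
  by (auto simp: weakly_diff_def)

lemma weakly_diff_smooth: "open \<Omega> \<Longrightarrow> smooth f \<Longrightarrow> weakly_diff m \<Omega> f"
  unfolding weakly_diff_def using has_weak_partials_smooth by blast

lemma weakly_diff_add:
  "open \<Omega> \<Longrightarrow> weakly_diff m \<Omega> f \<Longrightarrow> weakly_diff m \<Omega> g \<Longrightarrow> weakly_diff m \<Omega> (\<lambda>x. f x + g x)"
  unfolding weakly_diff_def using has_weak_partials_add by metis

lemma weakly_diff_cmult:
  "weakly_diff m \<Omega> f \<Longrightarrow> weakly_diff m \<Omega> (\<lambda>x. c * f x)"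
  unfolding weakly_diff_def using has_weak_partials_cmult by metis

lemma weakly_diff_diff:
  "open \<Omega> \<Longrightarrow> weakly_diff m \<Omega> f \<Longrightarrow> weakly_diff m \<Omega> g \<Longrightarrow> weakly_diff m \<Omega> (\<lambda>x. f x - g x)"
  using weakly_diff_add[OF _ _ weakly_diff_cmult, of \<Omega> m f g "-1"] by simp

lemma weakly_diff_sum:
  assumes "open \<Omega>" "\<And>i. i \<in> I \<Longrightarrow> weakly_diff m \<Omega> (f i)"
  shows "weakly_diff m \<Omega> (\<lambda>x. \<Sum>i\<in>I. f i x)"
  unfolding weakly_diff_def
proof (intro ballI impI)
  fix bs :: "'a list" assume "bs \<in> lists Basis" "length bs \<le> m"
  then show "\<exists>g. has_weak_partials \<Omega> bs (\<lambda>x. \<Sum>i\<in>I. f i x) g"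
    using has_weak_partials_sum[OF assms(1), of bs I f "\<lambda>i. weak_partials \<Omega> bs (f i)"] weakly_diffD[OF assms(2)] by blast
qed

lemma weak_partials_AE_unique:
  "open \<Omega> \<Longrightarrow> has_weak_partials \<Omega> bs f g \<Longrightarrow> AE x in lebesgue_on \<Omega>. weak_partials \<Omega> bs f x = g x"
  unfolding weak_partials_def using has_weak_partials_unique someI[of "has_weak_partials \<Omega> bs f" g] by blast

lemma weak_partials_AE_linear:
  assumes "open \<Omega>" "weakly_diff m \<Omega> f" "weakly_diff m \<Omega> g" "bs \<in> lists Basis" "length bs \<le> m"
  shows "AE x in lebesgue_on \<Omega>. weak_partials \<Omega> bs (\<lambda>x. c * f x + g x) x
    = c * weak_partials \<Omega> bs f x + weak_partials \<Omega> bs g x"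
  using assms by (intro weak_partials_AE_unique has_weak_partials_add has_weak_partials_cmult weakly_diffD)

lemma weak_partials_append:
  assumes "open \<Omega>" "weakly_diff m \<Omega> f" "bs @ cs \<in> lists Basis" "length (bs @ cs) \<le> m"
  shows "has_weak_partials \<Omega> cs (weak_partials \<Omega> bs f) (weak_partials \<Omega> (bs @ cs) f)"
  by (rule has_weak_partials_append[OF weakly_diffD[OF assms(2)] weakly_diffD[OF assms(2)]]) (use assms in auto)

lemma weakly_diff_weak_partials:
  assumes "open \<Omega>" "weakly_diff (length bs + k) \<Omega> f" "bs \<in> lists Basis"
  shows "weakly_diff k \<Omega> (weak_partials \<Omega> bs f)"
  unfolding weakly_diff_def
proof (intro ballI impI)
  fix cs :: "'a list" assume "cs \<in> lists Basis" "length cs \<le> k"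
  then show "\<exists>g. has_weak_partials \<Omega> cs (weak_partials \<Omega> bs f) g"
    using weak_partials_append[OF assms(1,2), of bs cs] assms(3) by auto
qed

lemma weakly_diff_weak_laplacian:
  assumes "open \<Omega>" "weakly_diff (2 + k) \<Omega> f"
  shows "weakly_diff k \<Omega> (weak_laplacian \<Omega> f)"
proof -
  have "weak_laplacian \<Omega> f = (\<lambda>x. \<Sum>b\<in>Basis. weak_partials \<Omega> [b, b] f x)"
    by (auto simp: weak_laplacian_def)
  then show ?thesis using assms by (auto intro!: weakly_diff_sum weakly_diff_weak_partials)
qed

lemma weakly_diff_funpow_laplacian:
  assumes "open \<Omega>" "weakly_diff (2 * k + j) \<Omega> f"
  shows "weakly_diff j \<Omega> ((weak_laplacian \<Omega> ^^ k) f)"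
  using assms(2)
proof (induction k arbitrary: j)
  case (Suc k)
  then have "weakly_diff (2 + j) \<Omega> ((weak_laplacian \<Omega> ^^ k) f)" by (simp add: algebra_simps)
  then show ?case using weakly_diff_weak_laplacian[OF assms(1)] by simp
qed simp

section \<open>Almost everywhere linearity and measurability of the iterated operators\<close>

lemma weak_laplacian_cong_AE:
  assumes "open \<Omega>" "locally_integrable \<Omega> f" "locally_integrable \<Omega> f'" "AE x in lebesgue_on \<Omega>. f x = f' x"
  shows "weak_laplacian \<Omega> f = weak_laplacian \<Omega> f'"
  unfolding weak_laplacian_def using weak_partials_cong_AE[OF assms(1) _ assms(2-4)] by auto

lemma weak_laplacian_AE_linear:
  assumes "open \<Omega>" "weakly_diff 2 \<Omega> f" "weakly_diff 2 \<Omega> g"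
  shows "AE x in lebesgue_on \<Omega>. weak_laplacian \<Omega> (\<lambda>x. c * f x + g x) x = c * weak_laplacian \<Omega> f x + weak_laplacian \<Omega> g x"
proof -
  have "AE x in lebesgue_on \<Omega>. \<forall>b\<in>Basis. weak_partials \<Omega> [b, b] (\<lambda>x. c * f x + g x) x
      = c * weak_partials \<Omega> [b, b] f x + weak_partials \<Omega> [b, b] g x"
    by (intro AE_finite_allI finite_Basis weak_partials_AE_linear[OF assms]) auto
  then show ?thesis
    by eventually_elim (simp add: weak_laplacian_def sum.distrib sum_distrib_left)
qed

text \<open>Each level yields an identity almost everywhere only;
  \<open>weak_laplacian_cong_AE\<close> turns it into equality of the next Laplacians, on which
  linearity applies once more.\<close>

lemma funpow_laplacian_AE_linear:
  assumes \<Omega>: "open \<Omega>" and "weakly_diff (2 * k) \<Omega> f" "weakly_diff (2 * k) \<Omega> g"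
  shows "AE x in lebesgue_on \<Omega>. (weak_laplacian \<Omega> ^^ k) (\<lambda>x. c * f x + g x) x
    = c * (weak_laplacian \<Omega> ^^ k) f x + (weak_laplacian \<Omega> ^^ k) g x"
  using assms(2,3)
proof (induction k)
  case (Suc k)
  let ?L = "weak_laplacian \<Omega> ^^ k" and ?h = "\<lambda>x. c * f x + g x"
  have wd: "weakly_diff 2 \<Omega> (?L f)" "weakly_diff 2 \<Omega> (?L g)" "weakly_diff 2 \<Omega> (?L ?h)"
    using Suc.prems by (intro weakly_diff_funpow_laplacian weakly_diff_add weakly_diff_cmult \<Omega>; simp)+
  have "AE x in lebesgue_on \<Omega>. ?L ?h x = c * ?L f x + ?L g x"
    using Suc by (intro Suc.IH) (auto elim: weakly_diff_mono)
  then have "weak_laplacian \<Omega> (?L ?h) = weak_laplacian \<Omega> (\<lambda>x. c * ?L f x + ?L g x)"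
    using wd by (intro weak_laplacian_cong_AE \<Omega>)
      (auto intro!: locally_integrable_add locally_integrable_cmult dest: weakly_diff_locally_integrable)
  then show ?case using weak_laplacian_AE_linear[OF \<Omega> wd(1,2)] by simp
qed simp

lemma weak_gradient_AE_linear:
  assumes "open \<Omega>" "weakly_diff 1 \<Omega> f" "weakly_diff 1 \<Omega> g"
  shows "AE x in lebesgue_on \<Omega>. weak_gradient \<Omega> (\<lambda>x. c * f x + g x) x = c *\<^sub>R weak_gradient \<Omega> f x + weak_gradient \<Omega> g x"
proof -
  have "AE x in lebesgue_on \<Omega>. \<forall>b\<in>Basis. weak_partials \<Omega> [b] (\<lambda>x. c * f x + g x) x
      = c * weak_partials \<Omega> [b] f x + weak_partials \<Omega> [b] g x"
    by (intro AE_finite_allI finite_Basis weak_partials_AE_linear[OF assms]) auto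
  then show ?thesis
    by eventually_elim (simp add: weak_gradient_def sum.distrib scaleR_sum_right algebra_simps)
qed

lemma weak_gradient_cong_AE:
  assumes "open \<Omega>" "locally_integrable \<Omega> f" "locally_integrable \<Omega> f'" "AE x in lebesgue_on \<Omega>. f x = f' x"
  shows "weak_gradient \<Omega> f = weak_gradient \<Omega> f'"
  unfolding weak_gradient_def using weak_partials_cong_AE[OF assms(1) _ assms(2-4)] by auto

lemma nabla_pow_AE_linear:
  assumes \<Omega>: "open \<Omega>" and f: "weakly_diff m \<Omega> f" and g: "weakly_diff m \<Omega> g"
  shows "AE x in lebesgue_on \<Omega>. nabla_pow m \<Omega> (\<lambda>x. c * f x + g x) x
    = c *\<^sub>R nabla_pow m \<Omega> f x + nabla_pow m \<Omega> g x"
proof -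
  let ?L = "weak_laplacian \<Omega> ^^ (m div 2)" and ?h = "\<lambda>x. c * f x + g x"
  have wd2: "weakly_diff (2 * (m div 2)) \<Omega> f" "weakly_diff (2 * (m div 2)) \<Omega> g"
    using f g by (auto elim: weakly_diff_mono)
  have ae: "AE x in lebesgue_on \<Omega>. ?L ?h x = c * ?L f x + ?L g x"
    by (rule funpow_laplacian_AE_linear[OF \<Omega> wd2])
  show ?thesis
  proof (cases "even m")
    case True
    then show ?thesis using ae by (simp add: nabla_pow_def)
  next
    case False
    then have m: "m = 2 * (m div 2) + 1" by presburger
    have wd: "weakly_diff 1 \<Omega> (?L f)" "weakly_diff 1 \<Omega> (?L g)" "weakly_diff 1 \<Omega> (?L ?h)"
      using f g m by (intro weakly_diff_funpow_laplacian weakly_diff_add weakly_diff_cmult \<Omega>; simp)+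
    have "weak_gradient \<Omega> (?L ?h) = weak_gradient \<Omega> (\<lambda>x. c * ?L f x + ?L g x)"
      using wd ae by (intro weak_gradient_cong_AE \<Omega>)
        (auto intro!: locally_integrable_add locally_integrable_cmult dest: weakly_diff_locally_integrable)
    then show ?thesis using weak_gradient_AE_linear[OF \<Omega> wd(1,2)] False by (simp add: nabla_pow_def)
  qed
qed

lemma weak_gradient_measurable:
  assumes "open \<Omega>" "weakly_diff 1 \<Omega> f"
  shows "weak_gradient \<Omega> f \<in> borel_measurable (lebesgue_on \<Omega>)"
  unfolding weak_gradient_def[abs_def] using assms
  by (intro borel_measurable_sum borel_measurable_scaleR locally_integrable_measurable weak_partials_locally_integrable[of 1]) auto

lemma nabla_pow_measurable:
  assumes \<Omega>: "open \<Omega>" and f: "weakly_diff m \<Omega> f"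
  shows "nabla_pow m \<Omega> f \<in> borel_measurable (lebesgue_on \<Omega>)"
proof (cases "even m")
  case True
  have "weakly_diff 0 \<Omega> ((weak_laplacian \<Omega> ^^ (m div 2)) f)"
    using f True by (intro weakly_diff_funpow_laplacian \<Omega>) simp
  then have "(weak_laplacian \<Omega> ^^ (m div 2)) f \<in> borel_measurable (lebesgue_on \<Omega>)"
    by (intro locally_integrable_measurable[OF \<Omega>]) (rule weakly_diff_locally_integrable)
  then show ?thesis using True by (simp add: nabla_pow_def[abs_def] borel_measurable_Pair)
next
  case False
  then have "m = 2 * (m div 2) + 1" by presburger
  then have "weakly_diff 1 \<Omega> ((weak_laplacian \<Omega> ^^ (m div 2)) f)"
    using f by (intro weakly_diff_funpow_laplacian \<Omega>) simp
  then show ?thesis using False weak_gradient_measurable[OF \<Omega>]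
    by (simp add: nabla_pow_def[abs_def] borel_measurable_Pair)
qed

subsection \<open>Energy and Sobolev norms\<close>

text \<open>The square root of the energy is a seminorm on functions of finite energy, so
  perturbations of competitors contribute additively.\<close>

definition enorm :: "nat \<Rightarrow> 'a::euclidean_space set \<Rightarrow> ('a \<Rightarrow> real) \<Rightarrow> real" where
  "enorm m \<Omega> f = l2norm (lebesgue_on \<Omega>) (nabla_pow m \<Omega> f)"

text \<open>Both conditions guard against default values: without weak derivatives
  \<open>nabla_pow\<close> is arbitrary, and the integral of a function that is not integrable is
  0.\<close>

definition finite_energy :: "nat \<Rightarrow> 'a::euclidean_space set \<Rightarrow> ('a \<Rightarrow> real) \<Rightarrow> bool" where
  "finite_energy m \<Omega> f \<longleftrightarrow> weakly_diff m \<Omega> f \<and> square_integrable (lebesgue_on \<Omega>) (nabla_pow m \<Omega> f)"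

lemma enorm_nonneg [simp]: "0 \<le> enorm m \<Omega> f"
  by (simp add: enorm_def)

lemma energy_eq: "energy m \<Omega> f = (enorm m \<Omega> f)\<^sup>2"
  by (simp add: energy_def enorm_def l2norm_power2)

lemma energy_norm_eq: "energy_norm m f = enorm m UNIV f"
  by (simp add: energy_norm_def energy_eq)

lemma finite_energy_linear:
  assumes \<Omega>: "open \<Omega>" and f: "finite_energy m \<Omega> f" and g: "finite_energy m \<Omega> g"
  shows "finite_energy m \<Omega> (\<lambda>x. c * f x + g x)"
    and "enorm m \<Omega> (\<lambda>x. c * f x + g x) \<le> \<bar>c\<bar> * enorm m \<Omega> f + enorm m \<Omega> g"
proof -
  let ?M = "lebesgue_on \<Omega>" and ?h = "\<lambda>x. c * f x + g x"
  have wd: "weakly_diff m \<Omega> ?h"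
    using f g by (intro weakly_diff_add weakly_diff_cmult \<Omega>) (auto simp: finite_energy_def)
  have sq: "square_integrable ?M (\<lambda>x. c *\<^sub>R nabla_pow m \<Omega> f x)" "square_integrable ?M (nabla_pow m \<Omega> g)"
    using f g by (auto simp: finite_energy_def intro: square_integrable_scaleR)
  have s: "square_integrable ?M (\<lambda>x. c *\<^sub>R nabla_pow m \<Omega> f x + nabla_pow m \<Omega> g x)"
    by (rule square_integrable_add[OF sq])
  have ae: "AE x in ?M. nabla_pow m \<Omega> ?h x = c *\<^sub>R nabla_pow m \<Omega> f x + nabla_pow m \<Omega> g x"
    using f g by (intro nabla_pow_AE_linear[OF \<Omega>]) (auto simp: finite_energy_def)
  note cong = nabla_pow_measurable[OF \<Omega> wd] square_integrable_measurable[OF s] ae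
  show "finite_energy m \<Omega> ?h"
    using square_integrable_cong_AE[OF cong] s wd by (simp add: finite_energy_def)
  have "enorm m \<Omega> ?h = l2norm ?M (\<lambda>x. c *\<^sub>R nabla_pow m \<Omega> f x + nabla_pow m \<Omega> g x)"
    unfolding enorm_def by (rule l2norm_cong_AE[OF cong])
  also have "\<dots> \<le> l2norm ?M (\<lambda>x. c *\<^sub>R nabla_pow m \<Omega> f x) + l2norm ?M (nabla_pow m \<Omega> g)"
    by (rule l2norm_triangle[OF sq])
  finally show "enorm m \<Omega> ?h \<le> \<bar>c\<bar> * enorm m \<Omega> f + enorm m \<Omega> g"
    by (simp add: enorm_def l2norm_scaleR)
qed

lemma finite_energy_add:
  assumes "open \<Omega>" "finite_energy m \<Omega> f" "finite_energy m \<Omega> g"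
  shows "finite_energy m \<Omega> (\<lambda>x. f x + g x)" "enorm m \<Omega> (\<lambda>x. f x + g x) \<le> enorm m \<Omega> f + enorm m \<Omega> g"
  using finite_energy_linear[OF assms, of 1] by simp_all

lemma finite_energy_diff:
  assumes "open \<Omega>" "finite_energy m \<Omega> f" "finite_energy m \<Omega> g"
  shows "finite_energy m \<Omega> (\<lambda>x. f x - g x)" "enorm m \<Omega> (\<lambda>x. f x - g x) \<le> enorm m \<Omega> f + enorm m \<Omega> g"
  using finite_energy_linear[OF assms(1,3,2), of "-1"] by (simp_all add: add.commute)

lemma enorm_triangle_diff:
  assumes "open \<Omega>" "finite_energy m \<Omega> f" "finite_energy m \<Omega> g"
  shows "enorm m \<Omega> f \<le> enorm m \<Omega> g + enorm m \<Omega> (\<lambda>x. f x - g x)"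
  using finite_energy_add(2)[OF assms(1,3) finite_energy_diff(1)[OF assms]] by simp

section \<open>Bounding the energy by all partial derivatives of order m\<close>

definition basis_lists :: "nat \<Rightarrow> 'a::euclidean_space list set" where
  "basis_lists n = {bs \<in> lists Basis. length bs = n}"

lemma finite_basis_lists [simp]: "finite (basis_lists n :: 'a::euclidean_space list set)"
proof -
  have "basis_lists n = {bs. set bs \<subseteq> (Basis :: 'a set) \<and> length bs = n}" by (auto simp: basis_lists_def)
  then show ?thesis by (simp add: finite_lists_length_eq)
qed

lemma finite_basis_lists_le [simp]: "finite {bs. bs \<in> lists (Basis :: 'a::euclidean_space set) \<and> length bs \<le> m}"
proof -
  have "{bs. bs \<in> lists (Basis :: 'a set) \<and> length bs \<le> m} = {bs. set bs \<subseteq> Basis \<and> length bs \<le> m}" by auto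
  then show ?thesis by (simp add: finite_lists_length_le)
qed

lemma weak_partials_weak_laplacian:
  assumes \<Omega>: "open \<Omega>" and f: "weakly_diff (2 + length bs) \<Omega> f" and bs: "bs \<in> lists Basis"
  shows "AE x in lebesgue_on \<Omega>. weak_partials \<Omega> bs (weak_laplacian \<Omega> f) x
    = (\<Sum>b\<in>Basis. weak_partials \<Omega> ([b, b] @ bs) f x)"
proof (rule weak_partials_AE_unique[OF \<Omega>])
  have "has_weak_partials \<Omega> bs (\<lambda>x. \<Sum>b\<in>Basis. weak_partials \<Omega> [b, b] f x) (\<lambda>x. \<Sum>b\<in>Basis. weak_partials \<Omega> ([b, b] @ bs) f x)"
    by (rule has_weak_partials_sum[OF \<Omega> bs], rule weak_partials_append[OF \<Omega> f]) (use bs in auto)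
  then show "has_weak_partials \<Omega> bs (weak_laplacian \<Omega> f) (\<lambda>x. \<Sum>b\<in>Basis. weak_partials \<Omega> ([b, b] @ bs) f x)"
    by (simp add: weak_laplacian_def[abs_def])
qed

text \<open>The induction removes the innermost Laplacian, so the hypothesis applies to
  \<open>weak_laplacian \<Omega> f\<close>, whose weak derivatives are sums of those of f. One
  constant has to work for all functions, hence the quantifier order.\<close>

lemma weak_partials_funpow_laplacian_bound:
  fixes \<Omega> :: "'a::euclidean_space set"
  assumes \<Omega>: "open \<Omega>"
  shows "\<exists>C\<ge>0. \<forall>f cs. weakly_diff (2 * k + n) \<Omega> f \<longrightarrow> cs \<in> basis_lists n \<longrightarrow>
    (AE x in lebesgue_on \<Omega>. \<bar>weak_partials \<Omega> cs ((weak_laplacian \<Omega> ^^ k) f) x\<bar>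
      \<le> C * (\<Sum>bs\<in>basis_lists (2 * k + n). \<bar>weak_partials \<Omega> bs f x\<bar>))"
proof (induction k)
  case 0
  have "\<bar>weak_partials \<Omega> cs f x\<bar> \<le> (\<Sum>bs\<in>basis_lists n. \<bar>weak_partials \<Omega> bs f x\<bar>)" if "cs \<in> basis_lists n" for f cs x
    using that member_le_sum[of cs "basis_lists n" "\<lambda>bs. \<bar>weak_partials \<Omega> bs f x\<bar>"] by simp
  then show ?case by (intro exI[of _ 1]) simp
next
  case (Suc k)
  then obtain C where C: "C \<ge> 0" "\<And>f cs. weakly_diff (2 * k + n) \<Omega> f \<Longrightarrow> cs \<in> basis_lists n \<Longrightarrow>
    (AE x in lebesgue_on \<Omega>. \<bar>weak_partials \<Omega> cs ((weak_laplacian \<Omega> ^^ k) f) x\<bar>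
      \<le> C * (\<Sum>bs\<in>basis_lists (2 * k + n). \<bar>weak_partials \<Omega> bs f x\<bar>))" by blast
  \<comment> \<open>A count of terms: each of the listed derivatives of the Laplacian is bounded by
    the number of directions times the sum of the derivatives of f two orders higher.\<close>
  let ?C = "C * (real (card (basis_lists (2 * k + n) :: 'a list set)) * real DIM('a))"
  have "AE x in lebesgue_on \<Omega>. \<bar>weak_partials \<Omega> cs ((weak_laplacian \<Omega> ^^ Suc k) f) x\<bar>
      \<le> ?C * (\<Sum>bs\<in>basis_lists (2 * Suc k + n). \<bar>weak_partials \<Omega> bs f x\<bar>)"
    if f: "weakly_diff (2 * Suc k + n) \<Omega> f" and cs: "cs \<in> basis_lists n" for f cs
  proof -
    let ?S = "\<lambda>x. \<Sum>bs\<in>basis_lists (2 * Suc k + n). \<bar>weak_partials \<Omega> bs f x\<bar>"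
    have f': "weakly_diff (2 + (2 * k + n)) \<Omega> f" using f by simp
    have 1: "AE x in lebesgue_on \<Omega>. \<bar>weak_partials \<Omega> cs ((weak_laplacian \<Omega> ^^ k) (weak_laplacian \<Omega> f)) x\<bar>
      \<le> C * (\<Sum>bs\<in>basis_lists (2 * k + n). \<bar>weak_partials \<Omega> bs (weak_laplacian \<Omega> f) x\<bar>)"
      by (rule C(2)[OF weakly_diff_weak_laplacian[OF \<Omega> f'] cs])
    have 2: "AE x in lebesgue_on \<Omega>. \<forall>bs\<in>basis_lists (2 * k + n). weak_partials \<Omega> bs (weak_laplacian \<Omega> f) x
      = (\<Sum>b\<in>Basis. weak_partials \<Omega> ([b, b] @ bs) f x)"
      using f' by (intro AE_finite_allI finite_basis_lists weak_partials_weak_laplacian[OF \<Omega>]) (auto simp: basis_lists_def)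
    show ?thesis using 1 2
    proof eventually_elim
      case (elim x)
      have "\<bar>weak_partials \<Omega> bs (weak_laplacian \<Omega> f) x\<bar> \<le> real DIM('a) * ?S x" if bs: "bs \<in> basis_lists (2 * k + n)" for bs
      proof -
        have "\<bar>weak_partials \<Omega> bs (weak_laplacian \<Omega> f) x\<bar> \<le> (\<Sum>b\<in>Basis. \<bar>weak_partials \<Omega> ([b, b] @ bs) f x\<bar>)"
          using elim(2) bs by (simp add: sum_abs)
        also have "\<dots> \<le> (\<Sum>b\<in>(Basis :: 'a set). ?S x)"
        proof (rule sum_mono)
          fix b :: 'a assume "b \<in> Basis"
          then have "[b, b] @ bs \<in> basis_lists (2 * Suc k + n)" using bs by (auto simp: basis_lists_def)
          then show "\<bar>weak_partials \<Omega> ([b, b] @ bs) f x\<bar> \<le> ?S x"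
            by (intro member_le_sum[of _ _ "\<lambda>bs. \<bar>weak_partials \<Omega> bs f x\<bar>"]) auto
        qed
        finally show ?thesis by simp
      qed
      then have "(\<Sum>bs\<in>basis_lists (2 * k + n). \<bar>weak_partials \<Omega> bs (weak_laplacian \<Omega> f) x\<bar>)
        \<le> (\<Sum>bs\<in>(basis_lists (2 * k + n) :: 'a list set). real DIM('a) * ?S x)" by (rule sum_mono)
      then have "C * (\<Sum>bs\<in>basis_lists (2 * k + n). \<bar>weak_partials \<Omega> bs (weak_laplacian \<Omega> f) x\<bar>) \<le> ?C * ?S x"
        using C(1) mult_left_mono by (fastforce simp: mult.assoc)
      then show ?case using elim(1) by (simp only: funpow_Suc_right o_apply)
    qed
  qed
  then show ?case using C(1) by (intro exI[of _ ?C]) auto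
qed

lemma nabla_pow_bound:
  fixes \<Omega> :: "'a::euclidean_space set"
  assumes \<Omega>: "open \<Omega>"
  obtains C where "C \<ge> 0" "\<And>f. weakly_diff m \<Omega> f \<Longrightarrow>
    AE x in lebesgue_on \<Omega>. norm (nabla_pow m \<Omega> f x) \<le> C * (\<Sum>bs\<in>basis_lists m. \<bar>weak_partials \<Omega> bs f x\<bar>)"
proof -
  let ?k = "m div 2"
  show thesis
  proof (cases "even m")
    case True
    then have m: "2 * ?k + 0 = m" by simp
    obtain C where C: "C \<ge> 0" "\<And>f cs. weakly_diff m \<Omega> f \<Longrightarrow> cs \<in> basis_lists 0 \<Longrightarrow>
      (AE x in lebesgue_on \<Omega>. \<bar>weak_partials \<Omega> cs ((weak_laplacian \<Omega> ^^ ?k) f) x\<bar>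
        \<le> C * (\<Sum>bs\<in>basis_lists m. \<bar>weak_partials \<Omega> bs f x\<bar>))"
      using weak_partials_funpow_laplacian_bound[OF \<Omega>, of ?k 0] unfolding m by blast
    have "AE x in lebesgue_on \<Omega>. norm (nabla_pow m \<Omega> f x) \<le> C * (\<Sum>bs\<in>basis_lists m. \<bar>weak_partials \<Omega> bs f x\<bar>)"
      if f: "weakly_diff m \<Omega> f" for f
    proof -
      let ?u = "(weak_laplacian \<Omega> ^^ ?k) f"
      have "weakly_diff 0 \<Omega> ?u" using f m by (intro weakly_diff_funpow_laplacian \<Omega>) simp
      \<comment> \<open>Even for the empty list \<open>weak_partials\<close> returns a chosen
        representative, which agrees with \<open>?u\<close> only almost everywhere.\<close>
      then have "has_weak_partials \<Omega> [] ?u ?u" by (simp add: has_weak_partials_def weakly_diff_locally_integrable)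
      then have 1: "AE x in lebesgue_on \<Omega>. weak_partials \<Omega> [] ?u x = ?u x" by (rule weak_partials_AE_unique[OF \<Omega>])
      have 2: "AE x in lebesgue_on \<Omega>. \<bar>weak_partials \<Omega> [] ?u x\<bar> \<le> C * (\<Sum>bs\<in>basis_lists m. \<bar>weak_partials \<Omega> bs f x\<bar>)"
        by (rule C(2)[OF f]) (simp add: basis_lists_def)
      from 1 2 show ?thesis by eventually_elim (use True in \<open>simp add: nabla_pow_def norm_Pair\<close>)
    qed
    with C(1) that show ?thesis by blast
  next
    case False
    then have m: "2 * ?k + 1 = m" by presburger
    obtain C where C: "C \<ge> 0" "\<And>f cs. weakly_diff m \<Omega> f \<Longrightarrow> cs \<in> basis_lists 1 \<Longrightarrow>
      (AE x in lebesgue_on \<Omega>. \<bar>weak_partials \<Omega> cs ((weak_laplacian \<Omega> ^^ ?k) f) x\<bar>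
        \<le> C * (\<Sum>bs\<in>basis_lists m. \<bar>weak_partials \<Omega> bs f x\<bar>))"
      using weak_partials_funpow_laplacian_bound[OF \<Omega>, of ?k 1] unfolding m by blast
    have bd: "AE x in lebesgue_on \<Omega>. norm (nabla_pow m \<Omega> f x) \<le> (real DIM('a) * C) * (\<Sum>bs\<in>basis_lists m. \<bar>weak_partials \<Omega> bs f x\<bar>)"
      if f: "weakly_diff m \<Omega> f" for f
    proof -
      let ?u = "(weak_laplacian \<Omega> ^^ ?k) f" and ?S = "\<lambda>x. \<Sum>bs\<in>basis_lists m. \<bar>weak_partials \<Omega> bs f x\<bar>"
      have "AE x in lebesgue_on \<Omega>. \<forall>b\<in>Basis. \<bar>weak_partials \<Omega> [b] ?u x\<bar> \<le> C * ?S x"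
        by (intro AE_finite_allI finite_Basis C(2)[OF f]) (simp add: basis_lists_def)
      then show ?thesis
      proof eventually_elim
        case (elim x)
        have "norm (nabla_pow m \<Omega> f x) = norm (weak_gradient \<Omega> ?u x)" using False by (simp add: nabla_pow_def norm_Pair)
        also have "\<dots> \<le> (\<Sum>b\<in>Basis. norm (weak_partials \<Omega> [b] ?u x *\<^sub>R b))"
          unfolding weak_gradient_def by (rule norm_sum)
        also have "\<dots> \<le> (\<Sum>b\<in>(Basis :: 'a set). C * ?S x)" using elim by (intro sum_mono) simp
        finally show ?case by (simp add: mult.assoc)
      qed
    qed
    show ?thesis by (rule that[OF _ bd]) (use C(1) in auto)
  qed
qed

lemma l2norm_sum_le:
  fixes f :: "'i \<Rightarrow> 'x \<Rightarrow> real"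
  assumes "\<And>i. i \<in> I \<Longrightarrow> square_integrable M (f i)"
  shows "l2norm M (\<lambda>x. \<Sum>i\<in>I. f i x) \<le> (\<Sum>i\<in>I. l2norm M (f i))"
  using assms
proof (induction I rule: infinite_finite_induct)
  case (insert i I)
  then have "l2norm M (\<lambda>x. f i x + (\<Sum>i\<in>I. f i x)) \<le> l2norm M (f i) + l2norm M (\<lambda>x. \<Sum>i\<in>I. f i x)"
    by (intro l2norm_triangle square_integrable_sum) auto
  then show ?case using insert by fastforce
qed (auto simp: l2norm_def)

lemma enorm_bound:
  fixes \<Omega> :: "'a::euclidean_space set"
  assumes \<Omega>: "open \<Omega>"
  obtains C where "C \<ge> 0"
    "\<And>f. weakly_diff m \<Omega> f \<Longrightarrow> (\<And>bs. bs \<in> basis_lists m \<Longrightarrow> square_integrable (lebesgue_on \<Omega>) (weak_partials \<Omega> bs f))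
      \<Longrightarrow> finite_energy m \<Omega> f \<and> enorm m \<Omega> f \<le> C * (\<Sum>bs\<in>basis_lists m. l2norm (lebesgue_on \<Omega>) (weak_partials \<Omega> bs f))"
proof -
  obtain C where C: "C \<ge> 0" "\<And>f. weakly_diff m \<Omega> f \<Longrightarrow>
    AE x in lebesgue_on \<Omega>. norm (nabla_pow m \<Omega> f x) \<le> C * (\<Sum>bs\<in>basis_lists m. \<bar>weak_partials \<Omega> bs f x\<bar>)"
    by (rule nabla_pow_bound[OF \<Omega>, of m]) blast
  have "finite_energy m \<Omega> f \<and> enorm m \<Omega> f \<le> C * (\<Sum>bs\<in>basis_lists m. l2norm (lebesgue_on \<Omega>) (weak_partials \<Omega> bs f))"
    if f: "weakly_diff m \<Omega> f" and sq: "\<And>bs. bs \<in> basis_lists m \<Longrightarrow> square_integrable (lebesgue_on \<Omega>) (weak_partials \<Omega> bs f)" for f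
  proof -
    let ?M = "lebesgue_on \<Omega>" and ?S = "\<lambda>x. \<Sum>bs\<in>basis_lists m. norm (weak_partials \<Omega> bs f x)"
    have S: "square_integrable ?M ?S" by (intro square_integrable_sum square_integrable_norm sq)
    have le: "AE x in ?M. norm (nabla_pow m \<Omega> f x) \<le> norm (C * ?S x)"
      using C(2)[OF f] by eventually_elim simp
    note b = square_integrable_bound[OF square_integrable_cmult[OF S] nabla_pow_measurable[OF \<Omega> f] le]
    have "enorm m \<Omega> f \<le> l2norm ?M (\<lambda>x. C * ?S x)" unfolding enorm_def by (rule b(2))
    also have "\<dots> = C * l2norm ?M ?S" using C(1) by (simp add: l2norm_cmult)
    also have "\<dots> \<le> C * (\<Sum>bs\<in>basis_lists m. l2norm ?M (\<lambda>x. norm (weak_partials \<Omega> bs f x)))"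
      using sq by (intro mult_left_mono C l2norm_sum_le square_integrable_norm)
    also have "\<dots> = C * (\<Sum>bs\<in>basis_lists m. l2norm ?M (weak_partials \<Omega> bs f))" by (simp add: l2norm_def)
    finally show ?thesis using b(1) f by (simp add: finite_energy_def)
  qed
  with C(1) that show ?thesis by blast
qed

section \<open>The Sobolev space and an equivalent norm\<close>

lemma Lp_2_iff: "f \<in> Lp 2 \<Omega> \<longleftrightarrow> square_integrable (lebesgue_on \<Omega>) f"
  by (auto simp: Lp_def square_integrable_def)

lemma Lp_norm_2: "Lp_norm 2 \<Omega> f = l2norm (lebesgue_on \<Omega>) f"
  by (simp add: Lp_norm_def l2norm_def powr_half_sqrt)

text \<open>The square integrable derivative that exists agrees almost everywhere with the chosen
  one, so the choice inherits its integrability.\<close>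

lemma sobolev_space_iff:
  assumes \<Omega>: "open \<Omega>"
  shows "f \<in> sobolev_space m \<Omega> \<longleftrightarrow> weakly_diff m \<Omega> f \<and>
    (\<forall>bs\<in>lists Basis. length bs \<le> m \<longrightarrow> square_integrable (lebesgue_on \<Omega>) (weak_partials \<Omega> bs f))"
proof
  assume f: "f \<in> sobolev_space m \<Omega>"
  then have wd: "weakly_diff m \<Omega> f" by (auto simp: sobolev_space_def weakly_diff_def)
  have "square_integrable (lebesgue_on \<Omega>) (weak_partials \<Omega> bs f)" if bs: "bs \<in> lists Basis" "length bs \<le> m" for bs
  proof -
    obtain g where g: "square_integrable (lebesgue_on \<Omega>) g" "has_weak_partials \<Omega> bs f g"
      using f bs by (auto simp: sobolev_space_def Lp_2_iff)
    have "AE x in lebesgue_on \<Omega>. weak_partials \<Omega> bs f x = g x" by (rule weak_partials_AE_unique[OF \<Omega> g(2)])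
    with g(1) show ?thesis
      using square_integrable_cong_AE[OF _ square_integrable_measurable[OF g(1)]]
        locally_integrable_measurable[OF \<Omega> weak_partials_locally_integrable[OF wd bs]] by blast
  qed
  with wd show "weakly_diff m \<Omega> f \<and>
    (\<forall>bs\<in>lists Basis. length bs \<le> m \<longrightarrow> square_integrable (lebesgue_on \<Omega>) (weak_partials \<Omega> bs f))" by blast
next
  assume "weakly_diff m \<Omega> f \<and>
    (\<forall>bs\<in>lists Basis. length bs \<le> m \<longrightarrow> square_integrable (lebesgue_on \<Omega>) (weak_partials \<Omega> bs f))"
  then have wd: "weakly_diff m \<Omega> f"
    and sq: "\<And>bs. bs \<in> lists Basis \<Longrightarrow> length bs \<le> m \<Longrightarrow> square_integrable (lebesgue_on \<Omega>) (weak_partials \<Omega> bs f)"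
    by blast+
  show "f \<in> sobolev_space m \<Omega>"
    unfolding sobolev_space_def mem_Collect_eq
  proof (intro ballI impI)
    fix bs :: "'a list" assume bs: "bs \<in> lists Basis" "length bs \<le> m"
    show "\<exists>g\<in>Lp 2 \<Omega>. has_weak_partials \<Omega> bs f g"
      by (rule bexI[of _ "weak_partials \<Omega> bs f"]) (use weakly_diffD[OF wd bs] sq[OF bs] in \<open>simp_all add: Lp_2_iff\<close>)
  qed
qed

lemma sobolev_spaceD:
  assumes "open \<Omega>" "f \<in> sobolev_space m \<Omega>"
  shows "weakly_diff m \<Omega> f"
    "bs \<in> lists Basis \<Longrightarrow> length bs \<le> m \<Longrightarrow> square_integrable (lebesgue_on \<Omega>) (weak_partials \<Omega> bs f)"
  using assms sobolev_space_iff by blast+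

text \<open>Equivalent to \<open>sobolev_norm\<close>, but a plain sum of L^2 norms, so the triangle
  inequality and estimates for single derivatives can be used term by term.\<close>

definition sob_sum :: "nat \<Rightarrow> 'a::euclidean_space set \<Rightarrow> ('a \<Rightarrow> real) \<Rightarrow> real" where
  "sob_sum m \<Omega> f = (\<Sum>bs | bs \<in> lists Basis \<and> length bs \<le> m. l2norm (lebesgue_on \<Omega>) (weak_partials \<Omega> bs f))"

lemma sob_sum_nonneg [simp]: "0 \<le> sob_sum m \<Omega> f"
  by (simp add: sob_sum_def sum_nonneg)

lemma sobolev_norm_nonneg [simp]: "0 \<le> sobolev_norm m \<Omega> f"
  by (simp add: sobolev_norm_def sum_nonneg)

lemma sobolev_norm_le_sob_sum: "sobolev_norm m \<Omega> f \<le> sob_sum m \<Omega> f"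
  unfolding sobolev_norm_def sob_sum_def Lp_norm_2
  using L2_set_le_sum[of _ "\<lambda>bs. l2norm (lebesgue_on \<Omega>) (weak_partials \<Omega> bs f)"] by (simp add: L2_set_def)

lemma l2norm_le_sobolev_norm:
  assumes "bs \<in> lists Basis" "length bs \<le> m"
  shows "l2norm (lebesgue_on \<Omega>) (weak_partials \<Omega> bs f) \<le> sobolev_norm m \<Omega> f"
proof -
  have "(l2norm (lebesgue_on \<Omega>) (weak_partials \<Omega> bs f))\<^sup>2
    \<le> (\<Sum>bs | bs \<in> lists Basis \<and> length bs \<le> m. (l2norm (lebesgue_on \<Omega>) (weak_partials \<Omega> bs f))\<^sup>2)"
    using assms by (intro member_le_sum[of _ _ "\<lambda>bs. (l2norm (lebesgue_on \<Omega>) (weak_partials \<Omega> bs f))\<^sup>2"]) auto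
  then show ?thesis unfolding sobolev_norm_def Lp_norm_2 by (rule real_le_rsqrt)
qed

lemma sob_sum_le_sobolev_norm:
  fixes \<Omega> :: "'a::euclidean_space set"
  shows "sob_sum m \<Omega> f \<le> real (card {bs. bs \<in> lists (Basis :: 'a set) \<and> length bs \<le> m}) * sobolev_norm m \<Omega> f"
  unfolding sob_sum_def by (rule sum_bounded_above) (simp add: l2norm_le_sobolev_norm)

lemma sobolev_norm_tendsto_iff:
  "((\<lambda>n. sobolev_norm m \<Omega> (f n)) \<longlongrightarrow> 0) F \<longleftrightarrow> ((\<lambda>n. sob_sum m \<Omega> (f n)) \<longlongrightarrow> 0) F"
proof
  assume L: "((\<lambda>n. sobolev_norm m \<Omega> (f n)) \<longlongrightarrow> 0) F"
  show "((\<lambda>n. sob_sum m \<Omega> (f n)) \<longlongrightarrow> 0) F"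
    by (rule Lim_null_comparison[OF _ tendsto_mult_right_zero[OF L]]) (auto intro: always_eventually sob_sum_le_sobolev_norm)
next
  assume R: "((\<lambda>n. sob_sum m \<Omega> (f n)) \<longlongrightarrow> 0) F"
  show "((\<lambda>n. sobolev_norm m \<Omega> (f n)) \<longlongrightarrow> 0) F"
    by (rule Lim_null_comparison[OF _ R]) (auto intro: always_eventually sobolev_norm_le_sob_sum)
qed

lemma sobolev_space_linear:
  assumes \<Omega>: "open \<Omega>" and f: "f \<in> sobolev_space m \<Omega>" and g: "g \<in> sobolev_space m \<Omega>"
  shows "(\<lambda>x. c * f x + g x) \<in> sobolev_space m \<Omega>"
    and "sob_sum m \<Omega> (\<lambda>x. c * f x + g x) \<le> \<bar>c\<bar> * sob_sum m \<Omega> f + sob_sum m \<Omega> g"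
proof -
  let ?h = "\<lambda>x. c * f x + g x" and ?M = "lebesgue_on \<Omega>"
  note fd = sobolev_spaceD[OF \<Omega> f] and gd = sobolev_spaceD[OF \<Omega> g]
  have wd: "weakly_diff m \<Omega> ?h" using fd(1) gd(1) by (intro weakly_diff_add weakly_diff_cmult \<Omega>)
  have *: "square_integrable ?M (weak_partials \<Omega> bs ?h) \<and>
      l2norm ?M (weak_partials \<Omega> bs ?h) \<le> \<bar>c\<bar> * l2norm ?M (weak_partials \<Omega> bs f) + l2norm ?M (weak_partials \<Omega> bs g)"
    if bs: "bs \<in> lists Basis" "length bs \<le> m" for bs
  proof -
    let ?r = "\<lambda>x. c * weak_partials \<Omega> bs f x + weak_partials \<Omega> bs g x"
    have sq: "square_integrable ?M (\<lambda>x. c * weak_partials \<Omega> bs f x)" "square_integrable ?M (weak_partials \<Omega> bs g)"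
      using fd(2) gd(2) bs by (auto intro: square_integrable_cmult)
    then have r: "square_integrable ?M ?r" by (rule square_integrable_add)
    note cong = locally_integrable_measurable[OF \<Omega> weak_partials_locally_integrable[OF wd bs]]
      square_integrable_measurable[OF r] weak_partials_AE_linear[OF \<Omega> fd(1) gd(1) bs]
    show ?thesis using square_integrable_cong_AE[OF cong] l2norm_cong_AE[OF cong] r l2norm_triangle[OF sq]
      by (simp add: l2norm_cmult)
  qed
  show "?h \<in> sobolev_space m \<Omega>" using wd * by (simp add: sobolev_space_iff[OF \<Omega>])
  have "sob_sum m \<Omega> ?h \<le> (\<Sum>bs | bs \<in> lists Basis \<and> length bs \<le> m.
      \<bar>c\<bar> * l2norm ?M (weak_partials \<Omega> bs f) + l2norm ?M (weak_partials \<Omega> bs g))"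
    unfolding sob_sum_def using * by (intro sum_mono) auto
  then show "sob_sum m \<Omega> ?h \<le> \<bar>c\<bar> * sob_sum m \<Omega> f + sob_sum m \<Omega> g"
    by (simp add: sob_sum_def sum.distrib sum_distrib_left)
qed

lemma sobolev_space_add:
  assumes "open \<Omega>" "f \<in> sobolev_space m \<Omega>" "g \<in> sobolev_space m \<Omega>"
  shows "(\<lambda>x. f x + g x) \<in> sobolev_space m \<Omega>" "sob_sum m \<Omega> (\<lambda>x. f x + g x) \<le> sob_sum m \<Omega> f + sob_sum m \<Omega> g"
  using sobolev_space_linear[OF assms, of 1] by simp_all

lemma sobolev_space_diff:
  assumes "open \<Omega>" "f \<in> sobolev_space m \<Omega>" "g \<in> sobolev_space m \<Omega>"
  shows "(\<lambda>x. f x - g x) \<in> sobolev_space m \<Omega>" "sob_sum m \<Omega> (\<lambda>x. f x - g x) \<le> sob_sum m \<Omega> f + sob_sum m \<Omega> g"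
  using sobolev_space_linear[OF assms(1,3,2), of "-1"] by (simp_all add: add.commute)

lemma sobolev_enorm_bound:
  fixes \<Omega> :: "'a::euclidean_space set"
  assumes \<Omega>: "open \<Omega>"
  obtains C where "C \<ge> 0"
    "\<And>f. f \<in> sobolev_space m \<Omega> \<Longrightarrow> finite_energy m \<Omega> f \<and> enorm m \<Omega> f \<le> C * sob_sum m \<Omega> f"
proof -
  obtain C where C: "C \<ge> 0"
    "\<And>f. weakly_diff m \<Omega> f \<Longrightarrow> (\<And>bs. bs \<in> basis_lists m \<Longrightarrow> square_integrable (lebesgue_on \<Omega>) (weak_partials \<Omega> bs f))
      \<Longrightarrow> finite_energy m \<Omega> f \<and> enorm m \<Omega> f \<le> C * (\<Sum>bs\<in>basis_lists m. l2norm (lebesgue_on \<Omega>) (weak_partials \<Omega> bs f))"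
    by (rule enorm_bound[OF \<Omega>, of m]) blast
  have "finite_energy m \<Omega> f \<and> enorm m \<Omega> f \<le> C * sob_sum m \<Omega> f" if f: "f \<in> sobolev_space m \<Omega>" for f
  proof -
    have "(\<Sum>bs\<in>basis_lists m. l2norm (lebesgue_on \<Omega>) (weak_partials \<Omega> bs f)) \<le> sob_sum m \<Omega> f"
      unfolding sob_sum_def by (rule sum_mono2) (auto simp: basis_lists_def)
    then have "C * (\<Sum>bs\<in>basis_lists m. l2norm (lebesgue_on \<Omega>) (weak_partials \<Omega> bs f)) \<le> C * sob_sum m \<Omega> f"
      by (rule mult_left_mono[OF _ C(1)])
    with C(2)[of f] sobolev_spaceD[OF \<Omega> f] show ?thesis by (force simp: basis_lists_def)
  qed
  with C(1) that show ?thesis by blast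
qed

lemma test_functions_square_integrable:
  assumes "\<phi> \<in> test_functions U" "S \<in> sets lebesgue"
  shows "square_integrable (lebesgue_on S) \<phi>"
proof -
  have "(\<lambda>x. \<phi> x * \<phi> x) \<in> test_functions U"
    by (rule test_functions_mult[OF assms(1) test_functions_smooth[OF assms(1)]])
  then have "integrable lebesgue (\<lambda>x. \<phi> x * \<phi> x)" by (rule test_functions_integrable)
  then have "square_integrable lebesgue \<phi>"
    using smooth_measurable_lebesgue[OF test_functions_smooth[OF assms(1)]]
    by (simp add: square_integrable_def power2_eq_square)
  then show ?thesis using square_integrable_restrict(1)[of UNIV \<phi> S] assms(2) by (simp add: lebesgue_on_UNIV_eq)
qed

lemma weak_partials_smooth:
  assumes "open \<Omega>" "smooth f" "bs \<in> lists Basis"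
  shows "AE x in lebesgue_on \<Omega>. weak_partials \<Omega> bs f x = partials bs f x"
    "l2norm (lebesgue_on \<Omega>) (weak_partials \<Omega> bs f) = l2norm (lebesgue_on \<Omega>) (partials bs f)"
    "square_integrable (lebesgue_on \<Omega>) (weak_partials \<Omega> bs f) \<longleftrightarrow> square_integrable (lebesgue_on \<Omega>) (partials bs f)"
proof -
  show ae: "AE x in lebesgue_on \<Omega>. weak_partials \<Omega> bs f x = partials bs f x"
    by (rule weak_partials_AE_unique[OF assms(1) has_weak_partials_smooth[OF assms]])
  have m: "weak_partials \<Omega> bs f \<in> borel_measurable (lebesgue_on \<Omega>)" "partials bs f \<in> borel_measurable (lebesgue_on \<Omega>)"
    using assms locally_integrable_measurable[OF assms(1) weak_partials_locally_integrable[OF weakly_diff_smooth[OF assms(1,2)] assms(3) le_refl]]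
    by (auto intro: smooth_measurable_lebesgue_on smooth_partials sets_lebesgue_open)
  show "l2norm (lebesgue_on \<Omega>) (weak_partials \<Omega> bs f) = l2norm (lebesgue_on \<Omega>) (partials bs f)"
    by (rule l2norm_cong_AE[OF m ae])
  show "square_integrable (lebesgue_on \<Omega>) (weak_partials \<Omega> bs f) \<longleftrightarrow> square_integrable (lebesgue_on \<Omega>) (partials bs f)"
    by (rule square_integrable_cong_AE[OF m ae])
qed

lemma test_functions_sobolev_space:
  assumes "open \<Omega>" "\<phi> \<in> test_functions U"
  shows "\<phi> \<in> sobolev_space m \<Omega>"
  unfolding sobolev_space_iff[OF assms(1)]
  using assms weak_partials_smooth(3)[OF assms(1) test_functions_smooth[OF assms(2)]]
  by (auto intro!: weakly_diff_smooth test_functions_smooth[OF assms(2)] test_functions_square_integrable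
      test_functions_partials sets_lebesgue_open)

lemma test_functions_finite_energy:
  assumes "open \<Omega>" "\<phi> \<in> test_functions U"
  shows "finite_energy m \<Omega> \<phi>"
  using test_functions_sobolev_space[OF assms] by (rule_tac sobolev_enorm_bound[OF assms(1), of m]) blast

subsection \<open>Limits of smooth functions\<close>

lemma locally_integrable_mult_smooth:
  assumes f: "locally_integrable \<Omega> f" and s: "smooth s"
  shows "locally_integrable \<Omega> (\<lambda>x. f x * s x)"
  unfolding locally_integrable_def
proof (intro allI impI)
  fix C assume C: "compact C \<and> C \<subseteq> \<Omega>"
  then have fC: "integrable (lebesgue_on C) f" using locally_integrableD[OF f] by blast
  have "bounded (s ` C)" using C by (intro compact_imp_bounded compact_continuous_image smooth_continuous_on s) auto
  then obtain B where B: "B > 0" "\<And>x. x \<in> C \<Longrightarrow> norm (s x) \<le> B" unfolding bounded_pos by blast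
  show "integrable (lebesgue_on C) (\<lambda>x. f x * s x)"
  proof (rule Bochner_Integration.integrable_bound)
    show "integrable (lebesgue_on C) (\<lambda>x. B * f x)" using fC by simp
    show "(\<lambda>x. f x * s x) \<in> borel_measurable (lebesgue_on C)"
      using C by (intro borel_measurable_times borel_measurable_integrable[OF fC] smooth_measurable_lebesgue_on s sets_lebesgue_compact) auto
    show "AE x in lebesgue_on C. norm (f x * s x) \<le> norm (B * f x)"
      using B by (intro AE_I2) (auto simp: abs_mult mult.commute[of "\<bar>f _\<bar>"] intro!: mult_right_mono)
  qed
qed

text \<open>The test function is bounded and lives on one compact set, where convergence in L^1 is
  enough.\<close>

lemma l1_loc_tendsto_integral_test:
  assumes \<Omega>: "open \<Omega>" and \<phi>: "\<And>n. locally_integrable \<Omega> (\<phi> n)" and f: "locally_integrable \<Omega> f"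
    and lim: "\<And>C. compact C \<Longrightarrow> C \<subseteq> \<Omega> \<Longrightarrow> (\<lambda>n::nat. \<integral>x. \<bar>\<phi> n x - f x\<bar> \<partial>lebesgue_on C) \<longlonglongrightarrow> 0"
    and \<psi>: "\<psi> \<in> test_functions \<Omega>"
  shows "(\<lambda>n. \<integral>x. \<phi> n x * \<psi> x \<partial>lebesgue_on \<Omega>) \<longlonglongrightarrow> (\<integral>x. f x * \<psi> x \<partial>lebesgue_on \<Omega>)"
proof -
  obtain C where C: "compact C" "C \<subseteq> \<Omega>" "\<And>x. x \<notin> C \<Longrightarrow> \<psi> x = 0" by (rule test_functionsE[OF \<psi>]) blast
  have "bounded (\<psi> ` C)" using C by (intro compact_imp_bounded compact_continuous_image smooth_continuous_on test_functions_smooth[OF \<psi>])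
  then obtain B where B: "B > 0" "\<And>x. x \<in> C \<Longrightarrow> norm (\<psi> x) \<le> B" unfolding bounded_pos by blast
  have "(\<lambda>n. (\<integral>x. \<phi> n x * \<psi> x \<partial>lebesgue_on \<Omega>) - (\<integral>x. f x * \<psi> x \<partial>lebesgue_on \<Omega>)) \<longlonglongrightarrow> 0"
  proof (rule Lim_null_comparison)
    show "(\<lambda>n. B * (\<integral>x. \<bar>\<phi> n x - f x\<bar> \<partial>lebesgue_on C)) \<longlonglongrightarrow> 0"
      by (rule tendsto_mult_right_zero[OF lim[OF C(1,2)]])
    have "norm ((\<integral>x. \<phi> n x * \<psi> x \<partial>lebesgue_on \<Omega>) - (\<integral>x. f x * \<psi> x \<partial>lebesgue_on \<Omega>))
      \<le> B * (\<integral>x. \<bar>\<phi> n x - f x\<bar> \<partial>lebesgue_on C)" for n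
    proof -
      have li: "locally_integrable \<Omega> (\<lambda>x. \<phi> n x - f x)"
        using locally_integrable_add[OF \<phi> locally_integrable_cmult[OF f], of n "-1"] by simp
      have iC: "integrable (lebesgue_on C) (\<lambda>x. \<phi> n x - f x)" by (rule locally_integrableD[OF li C(1,2)])
      note m = locally_integrable_mult_test[OF li \<psi> \<Omega>]
      have e: "indicat_real C x *\<^sub>R \<bar>(\<phi> n x - f x) * \<psi> x\<bar> = \<bar>(\<phi> n x - f x) * \<psi> x\<bar>" for x
        using C(3)[of x] by (auto simp: indicator_def)
      have "(\<integral>x. \<phi> n x * \<psi> x \<partial>lebesgue_on \<Omega>) - (\<integral>x. f x * \<psi> x \<partial>lebesgue_on \<Omega>)
        = (\<integral>x. (\<phi> n x - f x) * \<psi> x \<partial>lebesgue_on \<Omega>)"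
        by (simp add: left_diff_distrib locally_integrable_mult_test[OF \<phi> \<psi> \<Omega>] locally_integrable_mult_test[OF f \<psi> \<Omega>])
      also have "\<dots> = (\<integral>x. (\<phi> n x - f x) * \<psi> x \<partial>lebesgue)" by (rule m(3))
      finally have "norm ((\<integral>x. \<phi> n x * \<psi> x \<partial>lebesgue_on \<Omega>) - (\<integral>x. f x * \<psi> x \<partial>lebesgue_on \<Omega>))
        \<le> (\<integral>x. \<bar>(\<phi> n x - f x) * \<psi> x\<bar> \<partial>lebesgue)" using integral_abs_bound by simp
      also have "\<dots> = (\<integral>x. \<bar>(\<phi> n x - f x) * \<psi> x\<bar> \<partial>lebesgue_on C)"
        by (subst integral_restrict_space) (simp add: sets_lebesgue_compact C, simp only: e)
      also have "\<dots> \<le> (\<integral>x. B * \<bar>\<phi> n x - f x\<bar> \<partial>lebesgue_on C)"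
      proof (rule integral_mono)
        have "integrable lebesgue (\<lambda>x. \<bar>(\<phi> n x - f x) * \<psi> x\<bar>)" using m(2) by simp
        then show "integrable (lebesgue_on C) (\<lambda>x. \<bar>(\<phi> n x - f x) * \<psi> x\<bar>)"
          by (subst integrable_restrict_space) (simp add: sets_lebesgue_compact C, simp only: e)
        show "integrable (lebesgue_on C) (\<lambda>x. B * \<bar>\<phi> n x - f x\<bar>)" using iC by simp
        fix x assume "x \<in> space (lebesgue_on C)"
        then show "\<bar>(\<phi> n x - f x) * \<psi> x\<bar> \<le> B * \<bar>\<phi> n x - f x\<bar>"
          using B(2)[of x] by (simp add: abs_mult mult.commute[of "\<bar>\<phi> n x - f x\<bar>"] mult_right_mono)
      qed
      finally show ?thesis by simp
    qed
    then show "\<forall>\<^sub>F n in sequentially. norm ((\<integral>x. \<phi> n x * \<psi> x \<partial>lebesgue_on \<Omega>) - (\<integral>x. f x * \<psi> x \<partial>lebesgue_on \<Omega>))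
      \<le> B * (\<integral>x. \<bar>\<phi> n x - f x\<bar> \<partial>lebesgue_on C)" by simp
  qed
  then show ?thesis using Lim_null by blast
qed

text \<open>Weak differentiation is closed, here with a weight: the derivatives converge in L^2
  after multiplication by \<open>w\<close>, and the limit divided by \<open>w\<close> is the weak
  derivative of f. Products with a cutoff use the constant weight 1, elements of the completion a
  power of \<open>hardy_weight\<close>.\<close>

lemma weak_partials_limit:
  fixes \<Omega> :: "'a::euclidean_space set"
  assumes \<Omega>: "open \<Omega>" and bs: "bs \<in> lists Basis" and \<phi>: "\<And>n::nat. smooth (\<phi> n)" and f: "locally_integrable \<Omega> f"
    and lim: "\<And>C. compact C \<Longrightarrow> C \<subseteq> \<Omega> \<Longrightarrow> (\<lambda>n. \<integral>x. \<bar>\<phi> n x - f x\<bar> \<partial>lebesgue_on C) \<longlonglongrightarrow> 0"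
    and w: "smooth w" "\<And>x. w x \<noteq> 0"
    and sq: "\<And>n. square_integrable (lebesgue_on \<Omega>) (\<lambda>x. w x * partials bs (\<phi> n) x)"
    and cauchy: "\<And>e. e > 0 \<Longrightarrow> \<exists>N. \<forall>i\<ge>N. \<forall>j\<ge>N.
      l2norm (lebesgue_on \<Omega>) (\<lambda>x. w x * partials bs (\<phi> i) x - w x * partials bs (\<phi> j) x) < e"
  obtains g where "has_weak_partials \<Omega> bs f g" "square_integrable (lebesgue_on \<Omega>) (\<lambda>x. w x * g x)"
    "(\<lambda>n. l2norm (lebesgue_on \<Omega>) (\<lambda>x. w x * partials bs (\<phi> n) x - w x * g x)) \<longlonglongrightarrow> 0"
proof -
  let ?M = "lebesgue_on \<Omega>"
  have Os: "\<Omega> \<in> sets lebesgue" by (rule sets_lebesgue_open[OF \<Omega>])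
  obtain h where h: "square_integrable ?M h" "(\<lambda>n. l2norm ?M (\<lambda>x. w x * partials bs (\<phi> n) x - h x)) \<longlonglongrightarrow> 0"
    using l2_complete[OF sigma_finite_lebesgue_on[OF Os] sq cauchy] by blast
  define g where "g x = h x * inverse (w x)" for x
  have wg: "w x * g x = h x" for x using w(2)[of x] by (simp add: g_def)
  have iw: "smooth (\<lambda>x. inverse (w x))" by (rule smooth_inverse[OF w])
  have lg: "locally_integrable \<Omega> g"
    unfolding g_def[abs_def] by (intro locally_integrable_mult_smooth iw square_integrable_imp_locally_integrable h Os)
  have "has_weak_partials \<Omega> bs f g"
    unfolding has_weak_partials_def
  proof (intro conjI ballI f lg)
    fix \<psi> assume \<psi>: "\<psi> \<in> test_functions \<Omega>"
    have "(\<lambda>n. \<integral>x. \<phi> n x * partials bs \<psi> x \<partial>?M) \<longlonglongrightarrow> (\<integral>x. f x * partials bs \<psi> x \<partial>?M)"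
      by (rule l1_loc_tendsto_integral_test[OF \<Omega> locally_integrable_smooth[OF \<phi>] f lim test_functions_partials[OF \<psi> bs]])
    moreover have "(\<lambda>n. \<integral>x. \<phi> n x * partials bs \<psi> x \<partial>?M) \<longlonglongrightarrow> (-1) ^ length bs * (\<integral>x. g x * \<psi> x \<partial>?M)"
    proof -
      \<comment> \<open>The inverse weight is moved onto \<psi>, which remains a test function
        because \<open>w\<close> is smooth and has no zeros.\<close>
      have t: "(\<lambda>x. inverse (w x) * \<psi> x) \<in> test_functions \<Omega>" by (rule test_functions_mult[OF \<psi> iw])
      have "(\<lambda>n. \<integral>x. (w x * partials bs (\<phi> n) x) * (inverse (w x) * \<psi> x) \<partial>?M) \<longlonglongrightarrow> (\<integral>x. h x * (inverse (w x) * \<psi> x) \<partial>?M)"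
        by (rule l2_tendsto_integral_mult[OF sq h(1) test_functions_square_integrable[OF t Os] h(2)])
      moreover have "(w x * partials bs (\<phi> n) x) * (inverse (w x) * \<psi> x) = partials bs (\<phi> n) x * \<psi> x" for n x
        using w(2)[of x] by simp
      moreover have "h x * (inverse (w x) * \<psi> x) = g x * \<psi> x" for x by (simp add: g_def)
      ultimately have "(\<lambda>n. \<integral>x. partials bs (\<phi> n) x * \<psi> x \<partial>?M) \<longlonglongrightarrow> (\<integral>x. g x * \<psi> x \<partial>?M)" by simp
      from tendsto_mult_left[OF this, of "(-1) ^ length bs"]
      show ?thesis using has_weak_partialsD(3)[OF has_weak_partials_smooth[OF \<Omega> \<phi> bs] \<psi>] by simp
    qed
    ultimately show "(\<integral>x. f x * partials bs \<psi> x \<partial>?M) = (-1) ^ length bs * (\<integral>x. g x * \<psi> x \<partial>?M)"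
      by (rule LIMSEQ_unique)
  qed
  then show ?thesis using h by (intro that[of g]) (simp_all add: wg)
qed

subsection \<open>Multiplication by smooth functions\<close>

text \<open>A Leibniz rule reduced to an estimate. The innermost derivative is split by the product
  rule; \<open>partial b \<eta>\<close> is again a test function, so the induction hypothesis,
  general in \<eta>, covers both terms.\<close>

lemma partials_mult_bound:
  assumes \<eta>: "\<eta> \<in> test_functions (UNIV :: 'a::euclidean_space set)" and bs: "bs \<in> lists Basis"
  shows "\<exists>C\<ge>0. \<forall>v. smooth v \<longrightarrow> (\<forall>x. \<bar>partials bs (\<lambda>x. \<eta> x * v x) x\<bar>
    \<le> C * (\<Sum>cs | cs \<in> lists Basis \<and> length cs \<le> length bs. \<bar>partials cs v x\<bar>))"
  using bs \<eta>
proof (induction bs arbitrary: \<eta> rule: rev_induct)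
  case Nil
  obtain K where K: "compact K" "\<And>x. x \<notin> K \<Longrightarrow> \<eta> x = 0" by (rule test_functionsE[OF Nil(2)]) blast
  have "bounded (\<eta> ` K)" by (intro compact_imp_bounded compact_continuous_image smooth_continuous_on test_functions_smooth[OF Nil(2)] K)
  then obtain B where B: "B > 0" "\<And>x. x \<in> K \<Longrightarrow> norm (\<eta> x) \<le> B" unfolding bounded_pos by blast
  have eq: "{cs. cs \<in> lists Basis \<and> length cs \<le> length ([] :: 'a list)} = {[] :: 'a list}" by auto
  have "\<bar>\<eta> x * v x\<bar> \<le> B * \<bar>v x\<bar>" for v x
    using B K(2)[of x] by (cases "x \<in> K") (auto simp: abs_mult intro!: mult_right_mono)
  then show ?case unfolding eq using B(1) by (intro exI[of _ B]) simp
next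
  case (snoc b bs)
  let ?L = "\<lambda>n. {cs. cs \<in> lists (Basis :: 'a set) \<and> length cs \<le> n}"
  let ?n = "length bs"
  let ?S = "\<lambda>n v x. \<Sum>cs\<in>?L n. \<bar>partials cs v x\<bar>"
  have b: "b \<in> Basis" "bs \<in> lists Basis" using snoc.prems by auto
  have \<eta>b: "partial b \<eta> \<in> test_functions UNIV" using snoc.prems b by (intro test_functions_partial)
  have s\<eta>: "smooth \<eta>" "smooth (partial b \<eta>)" using snoc.prems(2) \<eta>b test_functions_smooth by blast+
  obtain C1 where C1: "C1 \<ge> 0" "\<And>v x. smooth v \<Longrightarrow> \<bar>partials bs (\<lambda>x. partial b \<eta> x * v x) x\<bar> \<le> C1 * ?S ?n v x"
    using snoc.IH[OF b(2) \<eta>b] by blast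
  obtain C2 where C2: "C2 \<ge> 0" "\<And>v x. smooth v \<Longrightarrow> \<bar>partials bs (\<lambda>x. \<eta> x * v x) x\<bar> \<le> C2 * ?S ?n v x"
    using snoc.IH[OF b(2) snoc.prems(2)] by blast
  let ?C = "C1 + C2 * real (card (?L ?n))"
  have "\<bar>partials (bs @ [b]) (\<lambda>x. \<eta> x * v x) x\<bar> \<le> ?C * ?S (Suc ?n) v x" if v: "smooth v" for v x
  proof -
    have vb: "smooth (partial b v)" by (rule smooth_partial[OF v b(1)])
    have "partials (bs @ [b]) (\<lambda>x. \<eta> x * v x) = partials bs (\<lambda>x. partial b \<eta> x * v x + \<eta> x * partial b v x)"
      by (simp add: partials_append partials_Cons partial_mult smooth_differentiable s\<eta> v)
    also have "\<dots> = (\<lambda>x. partials bs (\<lambda>x. partial b \<eta> x * v x) x + partials bs (\<lambda>x. \<eta> x * partial b v x) x)"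
      by (intro partials_add smooth_mult s\<eta> v vb b)
    finally have "\<bar>partials (bs @ [b]) (\<lambda>x. \<eta> x * v x) x\<bar>
      \<le> \<bar>partials bs (\<lambda>x. partial b \<eta> x * v x) x\<bar> + \<bar>partials bs (\<lambda>x. \<eta> x * partial b v x) x\<bar>"
      by (simp add: abs_triangle_ineq)
    also have "\<dots> \<le> C1 * ?S ?n v x + C2 * ?S ?n (partial b v) x"
      by (intro add_mono C1 C2 v vb)
    also have "\<dots> \<le> C1 * ?S (Suc ?n) v x + C2 * (real (card (?L ?n)) * ?S (Suc ?n) v x)"
    proof (intro add_mono mult_left_mono C1 C2)
      show "?S ?n v x \<le> ?S (Suc ?n) v x" by (rule sum_mono2) auto
      show "?S ?n (partial b v) x \<le> real (card (?L ?n)) * ?S (Suc ?n) v x"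
      proof (rule sum_bounded_above)
        fix cs assume cs: "cs \<in> ?L ?n"
        then have "cs @ [b] \<in> ?L (Suc ?n)" using b by auto
        then have "\<bar>partials (cs @ [b]) v x\<bar> \<le> ?S (Suc ?n) v x"
          by (intro member_le_sum[of _ _ "\<lambda>cs. \<bar>partials cs v x\<bar>"]) auto
        then show "\<bar>partials cs (partial b v) x\<bar> \<le> ?S (Suc ?n) v x" by (simp add: partials_append partials_Cons)
      qed
    qed
    also have "\<dots> = ?C * ?S (Suc ?n) v x" by (simp add: algebra_simps)
    finally show ?thesis .
  qed
  moreover have "?C \<ge> 0" using C1(1) C2(1) by simp
  ultimately show ?case by (intro exI[of _ ?C]) simp
qed

lemma l2norm_partials_mult_bound:
  fixes \<Omega> :: "'a::euclidean_space set"
  assumes \<eta>: "\<eta> \<in> test_functions UNIV" and bs: "bs \<in> lists Basis" and \<Omega>: "\<Omega> \<in> sets lebesgue"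
  obtains C where "C \<ge> 0" "\<And>v. smooth v \<Longrightarrow> (\<And>cs. cs \<in> lists Basis \<Longrightarrow> square_integrable (lebesgue_on \<Omega>) (partials cs v)) \<Longrightarrow>
    l2norm (lebesgue_on \<Omega>) (partials bs (\<lambda>x. \<eta> x * v x))
      \<le> C * (\<Sum>cs | cs \<in> lists Basis \<and> length cs \<le> length bs. l2norm (lebesgue_on \<Omega>) (partials cs v))"
proof -
  let ?L = "{cs. cs \<in> lists (Basis :: 'a set) \<and> length cs \<le> length bs}" and ?M = "lebesgue_on \<Omega>"
  obtain C where C: "C \<ge> 0" "\<And>v x. smooth v \<Longrightarrow> \<bar>partials bs (\<lambda>x. \<eta> x * v x) x\<bar> \<le> C * (\<Sum>cs\<in>?L. \<bar>partials cs v x\<bar>)"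
    using partials_mult_bound[OF \<eta> bs] by blast
  have "l2norm ?M (partials bs (\<lambda>x. \<eta> x * v x)) \<le> C * (\<Sum>cs\<in>?L. l2norm ?M (partials cs v))"
    if v: "smooth v" and sq: "\<And>cs. cs \<in> lists Basis \<Longrightarrow> square_integrable ?M (partials cs v)" for v
  proof -
    let ?S = "\<lambda>x. \<Sum>cs\<in>?L. norm (partials cs v x)"
    have S: "square_integrable ?M ?S" by (intro square_integrable_sum square_integrable_norm sq) auto
    have m: "partials bs (\<lambda>x. \<eta> x * v x) \<in> borel_measurable ?M"
      using bs by (intro smooth_measurable_lebesgue_on smooth_partials smooth_mult test_functions_smooth[OF \<eta>] v \<Omega>)
    have "l2norm ?M (partials bs (\<lambda>x. \<eta> x * v x)) \<le> l2norm ?M (\<lambda>x. C * ?S x)"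
      by (rule square_integrable_bound(2)[OF square_integrable_cmult[OF S] m])
         (use C(1) C(2)[OF v] in \<open>auto intro!: AE_I2 order_trans[OF C(2)[OF v]] simp: sum_nonneg\<close>)
    also have "\<dots> = C * l2norm ?M ?S" using C(1) by (simp add: l2norm_cmult)
    also have "\<dots> \<le> C * (\<Sum>cs\<in>?L. l2norm ?M (\<lambda>x. norm (partials cs v x)))"
      by (intro mult_left_mono C l2norm_sum_le square_integrable_norm sq) auto
    also have "\<dots> = C * (\<Sum>cs\<in>?L. l2norm ?M (partials cs v))" by (simp add: l2norm_def)
    finally show ?thesis .
  qed
  with C(1) that show ?thesis by blast
qed

lemma l1_le_l2_compact:
  fixes h :: "'a::euclidean_space \<Rightarrow> real"
  assumes "square_integrable (lebesgue_on \<Omega>) h" "compact C" "C \<subseteq> \<Omega>" "\<Omega> \<in> sets lebesgue"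
  shows "(\<integral>x. \<bar>h x\<bar> \<partial>lebesgue_on C) \<le> l2norm (lebesgue_on C) (\<lambda>_. 1::real) * l2norm (lebesgue_on \<Omega>) h"
proof -
  note h = square_integrable_restrict[OF assms(1,3) sets_lebesgue_compact[OF assms(2)] assms(4)]
  have one: "square_integrable (lebesgue_on C) (\<lambda>_. 1::real)"
    using finite_measure.integrable_const[OF finite_measure_lebesgue_on[OF lmeasurable_compact[OF assms(2)]], of "1::real"]
    by (simp add: square_integrable_def)
  have "(\<integral>x. \<bar>h x\<bar> \<partial>lebesgue_on C) \<le> l2norm (lebesgue_on C) (\<lambda>_. 1::real) * l2norm (lebesgue_on C) h"
    using square_integrable_mult(2)[OF one square_integrable_norm[OF h(1)]] by (simp add: l2norm_def)
  also have "\<dots> \<le> l2norm (lebesgue_on C) (\<lambda>_. 1::real) * l2norm (lebesgue_on \<Omega>) h"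
    by (intro mult_left_mono h(2)) simp
  finally show ?thesis .
qed

lemma weak_partials_diff_smooth:
  assumes \<Omega>: "open \<Omega>" and v: "v \<in> test_functions U" and u: "u \<in> sobolev_space m \<Omega>"
    and bs: "bs \<in> lists Basis" "length bs \<le> m"
  shows "l2norm (lebesgue_on \<Omega>) (weak_partials \<Omega> bs (\<lambda>x. v x - u x))
    = l2norm (lebesgue_on \<Omega>) (\<lambda>x. partials bs v x - weak_partials \<Omega> bs u x)"
proof (rule l2norm_cong_AE)
  have vs: "smooth v" by (rule test_functions_smooth[OF v])
  note ud = sobolev_spaceD[OF \<Omega> u]
  have wd: "weakly_diff m \<Omega> (\<lambda>x. v x - u x)" by (intro weakly_diff_diff weakly_diff_smooth \<Omega> vs ud(1))
  show "weak_partials \<Omega> bs (\<lambda>x. v x - u x) \<in> borel_measurable (lebesgue_on \<Omega>)"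
    by (rule locally_integrable_measurable[OF \<Omega> weak_partials_locally_integrable[OF wd bs]])
  show "(\<lambda>x. partials bs v x - weak_partials \<Omega> bs u x) \<in> borel_measurable (lebesgue_on \<Omega>)"
    by (intro borel_measurable_diff square_integrable_measurable[OF ud(2)[OF bs]])
       (intro smooth_measurable_lebesgue_on smooth_partials vs bs sets_lebesgue_open \<Omega>)
  have "has_weak_partials \<Omega> bs (\<lambda>x. v x + (-1) * u x) (\<lambda>x. partials bs v x + (-1) * weak_partials \<Omega> bs u x)"
    by (intro has_weak_partials_add has_weak_partials_cmult has_weak_partials_smooth weakly_diffD[OF ud(1)] \<Omega> vs bs)
  then show "AE x in lebesgue_on \<Omega>. weak_partials \<Omega> bs (\<lambda>x. v x - u x) x = partials bs v x - weak_partials \<Omega> bs u x"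
    using weak_partials_AE_unique[OF \<Omega>] by simp
qed

text \<open>The Leibniz rule is available for smooth factors only, so u enters through test
  functions \<open>v n\<close> that approximate it. The bound applied to \<open>v i - v j\<close>
  makes the derivatives of \<open>\<eta> * v n\<close> Cauchy in L^2, and
  \<open>weak_partials_limit\<close> identifies their limits as derivatives of
  \<open>\<eta> * u\<close>.\<close>

lemma sobolev_space_mult:
  fixes \<Omega> :: "'a::euclidean_space set"
  assumes \<Omega>: "open \<Omega>" and \<eta>: "\<eta> \<in> test_functions UNIV"
    and v: "\<And>n::nat. v n \<in> test_functions U" and u: "u \<in> sobolev_space m \<Omega>"
    and lim: "(\<lambda>n. sobolev_norm m \<Omega> (\<lambda>x. v n x - u x)) \<longlonglongrightarrow> 0"
  shows "(\<lambda>x. \<eta> x * u x) \<in> sobolev_space m \<Omega>"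
    and "(\<lambda>n. sobolev_norm m \<Omega> (\<lambda>x. \<eta> x * v n x - \<eta> x * u x)) \<longlonglongrightarrow> 0"
proof -
  let ?M = "lebesgue_on \<Omega>"
  have Os: "\<Omega> \<in> sets lebesgue" by (rule sets_lebesgue_open[OF \<Omega>])
  note ud = sobolev_spaceD[OF \<Omega> u]
  have vs: "smooth (v n)" for n by (rule test_functions_smooth[OF v])
  have \<eta>v: "(\<lambda>x. \<eta> x * v n x) \<in> test_functions U" for n by (rule test_functions_mult[OF v test_functions_smooth[OF \<eta>]])
  define a where "a cs n = l2norm ?M (\<lambda>x. partials cs (v n) x - weak_partials \<Omega> cs u x)" for cs n
  have a: "a cs \<longlonglongrightarrow> 0" if cs: "cs \<in> lists Basis" "length cs \<le> m" for cs
  proof (rule Lim_null_comparison[OF _ lim])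
    have "norm (a cs n) \<le> sobolev_norm m \<Omega> (\<lambda>x. v n x - u x)" for n
      using l2norm_le_sobolev_norm[OF cs, of \<Omega> "\<lambda>x. v n x - u x"]
      unfolding weak_partials_diff_smooth[OF \<Omega> v u cs] by (simp add: a_def)
    then show "\<forall>\<^sub>F n in sequentially. norm (a cs n) \<le> sobolev_norm m \<Omega> (\<lambda>x. v n x - u x)" by simp
  qed
  have sqv: "square_integrable ?M (partials cs (v n))" if "cs \<in> lists Basis" for cs n
    by (rule test_functions_square_integrable[OF test_functions_partials[OF v that] Os])
  have vv: "l2norm ?M (partials cs (\<lambda>x. v i x - v j x)) \<le> a cs i + a cs j"
    if cs: "cs \<in> lists Basis" "length cs \<le> m" for cs i j
  proof -
    have "l2norm ?M (partials cs (\<lambda>x. v i x - v j x))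
      = l2norm ?M (\<lambda>x. (partials cs (v i) x - weak_partials \<Omega> cs u x) + (weak_partials \<Omega> cs u x - partials cs (v j) x))"
      by (simp add: partials_diff vs cs)
    also have "\<dots> \<le> a cs i + l2norm ?M (\<lambda>x. weak_partials \<Omega> cs u x - partials cs (v j) x)"
      unfolding a_def by (intro l2norm_triangle square_integrable_diff sqv ud(2) cs)
    finally show ?thesis by (subst (asm) l2norm_minus) (simp add: a_def)
  qed
  have wl: "\<exists>g. has_weak_partials \<Omega> bs (\<lambda>x. \<eta> x * u x) g \<and> square_integrable ?M g
      \<and> (\<lambda>n. l2norm ?M (\<lambda>x. partials bs (\<lambda>x. \<eta> x * v n x) x - g x)) \<longlonglongrightarrow> 0"
    if bs: "bs \<in> lists Basis" "length bs \<le> m" for bs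
  proof -
    let ?L = "{cs. cs \<in> lists (Basis :: 'a set) \<and> length cs \<le> length bs}"
    define A where "A n = (\<Sum>cs\<in>?L. a cs n)" for n
    have A0: "A \<longlonglongrightarrow> 0"
    proof -
      have "(\<lambda>n. \<Sum>cs\<in>?L. a cs n) \<longlonglongrightarrow> (\<Sum>cs\<in>?L. 0)" by (intro tendsto_sum a) (use bs in auto)
      then show ?thesis by (simp add: A_def[abs_def])
    qed
    obtain C where C: "C \<ge> 0" "\<And>v. smooth v \<Longrightarrow> (\<And>cs. cs \<in> lists Basis \<Longrightarrow> square_integrable ?M (partials cs v)) \<Longrightarrow>
      l2norm ?M (partials bs (\<lambda>x. \<eta> x * v x)) \<le> C * (\<Sum>cs\<in>?L. l2norm ?M (partials cs v))"
      by (rule l2norm_partials_mult_bound[OF \<eta> bs(1) Os]) blast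
    have cau: "l2norm ?M (\<lambda>x. 1 * partials bs (\<lambda>x. \<eta> x * v i x) x - 1 * partials bs (\<lambda>x. \<eta> x * v j x) x) \<le> C * A i + C * A j" for i j
    proof -
      have vij: "(\<lambda>x. v i x - v j x) \<in> test_functions U" by (rule test_functions_diff[OF v v])
      have "partials bs (\<lambda>x. \<eta> x * (v i x - v j x)) = (\<lambda>x. partials bs (\<lambda>x. \<eta> x * v i x) x - partials bs (\<lambda>x. \<eta> x * v j x) x)"
        unfolding right_diff_distrib by (intro partials_diff test_functions_smooth[OF \<eta>v] bs)
      then have "l2norm ?M (\<lambda>x. 1 * partials bs (\<lambda>x. \<eta> x * v i x) x - 1 * partials bs (\<lambda>x. \<eta> x * v j x) x)
        = l2norm ?M (partials bs (\<lambda>x. \<eta> x * (v i x - v j x)))" by simp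
      also have "\<dots> \<le> C * (\<Sum>cs\<in>?L. l2norm ?M (partials cs (\<lambda>x. v i x - v j x)))"
        by (intro C(2) test_functions_smooth[OF vij] test_functions_square_integrable[OF test_functions_partials[OF vij] Os])
      also have "\<dots> \<le> C * (\<Sum>cs\<in>?L. a cs i + a cs j)"
        by (intro mult_left_mono sum_mono vv C(1)) (use bs in auto)
      finally show ?thesis by (simp add: A_def sum.distrib distrib_left)
    qed
    have "\<exists>g. has_weak_partials \<Omega> bs (\<lambda>x. \<eta> x * u x) g \<and> square_integrable ?M (\<lambda>x. 1 * g x)
      \<and> (\<lambda>n. l2norm ?M (\<lambda>x. 1 * partials bs (\<lambda>x. \<eta> x * v n x) x - 1 * g x)) \<longlonglongrightarrow> 0"
    proof (rule weak_partials_limit[where w="\<lambda>_. 1" and bs=bs and f="\<lambda>x. \<eta> x * u x" and \<phi>="\<lambda>n x. \<eta> x * v n x", OF \<Omega> bs(1)])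
      show "smooth (\<lambda>x. \<eta> x * v n x)" for n by (rule test_functions_smooth[OF \<eta>v])
      show "locally_integrable \<Omega> (\<lambda>x. \<eta> x * u x)"
        using locally_integrable_mult_smooth[OF weakly_diff_locally_integrable[OF ud(1)] test_functions_smooth[OF \<eta>]]
        by (simp add: mult.commute)
      show "smooth (\<lambda>_. 1)" by (rule smooth_const)
      show "square_integrable ?M (\<lambda>x. 1 * partials bs (\<lambda>x. \<eta> x * v n x) x)" for n
        using test_functions_square_integrable[OF test_functions_partials[OF \<eta>v bs(1)] Os] by simp
      show "\<exists>N. \<forall>i\<ge>N. \<forall>j\<ge>N. l2norm ?M (\<lambda>x. 1 * partials bs (\<lambda>x. \<eta> x * v i x) x - 1 * partials bs (\<lambda>x. \<eta> x * v j x) x) < e"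
        if "e > 0" for e
      proof -
        have "(\<lambda>n. C * A n) \<longlonglongrightarrow> 0" by (rule tendsto_mult_right_zero[OF A0])
        then have "\<forall>\<^sub>F n in sequentially. C * A n < e / 2" using that by (intro order_tendstoD) auto
        then obtain N where N: "\<And>n. n \<ge> N \<Longrightarrow> C * A n < e / 2" by (auto simp: eventually_sequentially)
        show ?thesis
        proof (intro exI[of _ N] allI impI)
          fix i j assume "N \<le> i" "N \<le> j"
          then show "l2norm ?M (\<lambda>x. 1 * partials bs (\<lambda>x. \<eta> x * v i x) x - 1 * partials bs (\<lambda>x. \<eta> x * v j x) x) < e"
            using cau[of i j] N[of i] N[of j] by linarith
        qed
      qed
      \<comment> \<open>Local L^1 convergence of the products comes from the term of order zero:
        \<eta> is bounded on \<open>K\<close>, and on a compact set the L^1 norm is controlled by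
        the L^2 norm.\<close>
      fix K assume K: "compact K" "K \<subseteq> \<Omega>"
      have "bounded (\<eta> ` K)" by (intro compact_imp_bounded compact_continuous_image smooth_continuous_on test_functions_smooth[OF \<eta>] K)
      then obtain B where B: "B > 0" "\<And>x. x \<in> K \<Longrightarrow> norm (\<eta> x) \<le> B" unfolding bounded_pos by blast
      let ?c = "l2norm (lebesgue_on K) (\<lambda>_. 1::real)"
      have u0: "has_weak_partials \<Omega> [] u u" using weakly_diff_locally_integrable[OF ud(1)] by (simp add: has_weak_partials_def)
      have ae0: "AE x in ?M. weak_partials \<Omega> [] u x = u x" by (rule weak_partials_AE_unique[OF \<Omega> u0])
      have mu: "u \<in> borel_measurable ?M" by (rule locally_integrable_measurable[OF \<Omega> weakly_diff_locally_integrable[OF ud(1)]])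
      have squ: "square_integrable ?M u"
        using square_integrable_cong_AE[OF square_integrable_measurable[OF ud(2)[of "[]"]] mu ae0] ud(2)[of "[]"] by simp
      have sqd: "square_integrable ?M (\<lambda>x. v n x - u x)" for n
        using sqv[of "[]"] by (intro square_integrable_diff squ) auto
      have a0: "a [] n = l2norm ?M (\<lambda>x. v n x - u x)" for n
        unfolding a_def
      proof (rule l2norm_cong_AE)
        show "AE x in ?M. partials [] (v n) x - weak_partials \<Omega> [] u x = v n x - u x" using ae0 by eventually_elim simp
      qed (use sqv[of "[]" n] ud(2)[of "[]"] sqd[of n] in \<open>auto simp: square_integrable_def\<close>)
      have "(\<integral>x. \<bar>\<eta> x * v n x - \<eta> x * u x\<bar> \<partial>lebesgue_on K) \<le> B * (?c * a [] n)" for n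
      proof -
        have iK: "integrable (lebesgue_on K) (\<lambda>x. v n x - u x)"
          by (rule locally_integrableD[OF square_integrable_imp_locally_integrable[OF sqd Os] K])
        have "(\<integral>x. \<bar>\<eta> x * v n x - \<eta> x * u x\<bar> \<partial>lebesgue_on K) \<le> (\<integral>x. B * \<bar>v n x - u x\<bar> \<partial>lebesgue_on K)"
        proof (rule integral_mono)
          have "integrable (lebesgue_on K) (\<lambda>x. (v n x - u x) * \<eta> x)"
            by (rule locally_integrableD[OF locally_integrable_mult_smooth[OF square_integrable_imp_locally_integrable[OF sqd Os] test_functions_smooth[OF \<eta>]] K])
          then have "integrable (lebesgue_on K) (\<lambda>x. \<bar>(v n x - u x) * \<eta> x\<bar>)" by simp
          then show "integrable (lebesgue_on K) (\<lambda>x. \<bar>\<eta> x * v n x - \<eta> x * u x\<bar>)" by (simp add: algebra_simps)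
          show "integrable (lebesgue_on K) (\<lambda>x. B * \<bar>v n x - u x\<bar>)" using iK by simp
          fix x assume "x \<in> space (lebesgue_on K)"
          then show "\<bar>\<eta> x * v n x - \<eta> x * u x\<bar> \<le> B * \<bar>v n x - u x\<bar>"
            using B(2)[of x] by (simp add: right_diff_distrib[symmetric] abs_mult mult_right_mono)
        qed
        also have "\<dots> \<le> B * (?c * a [] n)"
          using l1_le_l2_compact[OF sqd K Os] B(1) by (simp add: a0)
        finally show ?thesis .
      qed
      then have "\<forall>\<^sub>F n in sequentially. norm (\<integral>x. \<bar>\<eta> x * v n x - \<eta> x * u x\<bar> \<partial>lebesgue_on K) \<le> B * (?c * a [] n)"
        by (intro always_eventually allI) simp
      moreover have "(\<lambda>n. B * (?c * a [] n)) \<longlonglongrightarrow> 0" by (intro tendsto_mult_right_zero a) auto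
      ultimately show "(\<lambda>n. \<integral>x. \<bar>\<eta> x * v n x - \<eta> x * u x\<bar> \<partial>lebesgue_on K) \<longlonglongrightarrow> 0" by (rule Lim_null_comparison)
    qed auto
    then show ?thesis by simp
  qed
  show su: "(\<lambda>x. \<eta> x * u x) \<in> sobolev_space m \<Omega>"
    unfolding sobolev_space_def mem_Collect_eq
  proof (intro ballI impI)
    fix bs :: "'a list" assume "bs \<in> lists Basis" "length bs \<le> m"
    from wl[OF this] obtain g where "has_weak_partials \<Omega> bs (\<lambda>x. \<eta> x * u x) g" "square_integrable ?M g" by blast
    then show "\<exists>g\<in>Lp 2 \<Omega>. has_weak_partials \<Omega> bs (\<lambda>x. \<eta> x * u x) g"
      by (intro bexI[of _ g]) (simp_all add: Lp_2_iff)
  qed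
  have "(\<lambda>n. sob_sum m \<Omega> (\<lambda>x. \<eta> x * v n x - \<eta> x * u x)) \<longlonglongrightarrow> (\<Sum>bs | bs \<in> lists (Basis :: 'a set) \<and> length bs \<le> m. 0)"
    unfolding sob_sum_def
  proof (intro tendsto_sum)
    fix bs assume "bs \<in> {bs \<in> lists (Basis :: 'a set). length bs \<le> m}"
    then have bs: "bs \<in> lists Basis" "length bs \<le> m" by auto
    obtain g where g: "has_weak_partials \<Omega> bs (\<lambda>x. \<eta> x * u x) g" "square_integrable ?M g"
      "(\<lambda>n. l2norm ?M (\<lambda>x. partials bs (\<lambda>x. \<eta> x * v n x) x - g x)) \<longlonglongrightarrow> 0" using wl[OF bs] by blast
    have ae: "AE x in ?M. weak_partials \<Omega> bs (\<lambda>x. \<eta> x * u x) x = g x" by (rule weak_partials_AE_unique[OF \<Omega> g(1)])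
    have "l2norm ?M (weak_partials \<Omega> bs (\<lambda>x. \<eta> x * v n x - \<eta> x * u x))
      = l2norm ?M (\<lambda>x. partials bs (\<lambda>x. \<eta> x * v n x) x - g x)" for n
    proof -
      have sqp: "square_integrable ?M (partials bs (\<lambda>x. \<eta> x * v n x))"
        by (rule test_functions_square_integrable[OF test_functions_partials[OF \<eta>v bs(1)] Os])
      have "l2norm ?M (weak_partials \<Omega> bs (\<lambda>x. \<eta> x * v n x - \<eta> x * u x))
        = l2norm ?M (\<lambda>x. partials bs (\<lambda>x. \<eta> x * v n x) x - weak_partials \<Omega> bs (\<lambda>x. \<eta> x * u x) x)"
        by (rule weak_partials_diff_smooth[OF \<Omega> \<eta>v su bs])
      also have "\<dots> = l2norm ?M (\<lambda>x. partials bs (\<lambda>x. \<eta> x * v n x) x - g x)"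
      proof (rule l2norm_cong_AE)
        show "AE x in ?M. partials bs (\<lambda>x. \<eta> x * v n x) x - weak_partials \<Omega> bs (\<lambda>x. \<eta> x * u x) x
          = partials bs (\<lambda>x. \<eta> x * v n x) x - g x" using ae by eventually_elim simp
      qed (use sqp g(2) sobolev_spaceD(2)[OF \<Omega> su bs] in \<open>auto simp: square_integrable_def\<close>)
      finally show ?thesis .
    qed
    then show "(\<lambda>n. l2norm ?M (weak_partials \<Omega> bs (\<lambda>x. \<eta> x * v n x - \<eta> x * u x))) \<longlonglongrightarrow> 0" using g(3) by simp
  qed
  then show "(\<lambda>n. sobolev_norm m \<Omega> (\<lambda>x. \<eta> x * v n x - \<eta> x * u x)) \<longlonglongrightarrow> 0"
    by (simp add: sobolev_norm_tendsto_iff)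
qed

subsection \<open>Scaling\<close>

lemma locally_integrable_scale:
  fixes f :: "'a::euclidean_space \<Rightarrow> real"
  assumes f: "locally_integrable \<Omega> f" and c: "c \<noteq> 0" and sub: "\<And>x. x \<in> B \<Longrightarrow> c *\<^sub>R x \<in> \<Omega>"
  shows "locally_integrable B (\<lambda>x. f (c *\<^sub>R x))"
  unfolding locally_integrable_def
proof (intro allI impI)
  fix C assume C: "compact C \<and> C \<subseteq> B"
  let ?C = "(*\<^sub>R) c ` C"
  have cC: "compact ?C" using C by (simp add: compact_scaling)
  have "?C \<subseteq> \<Omega>" using C sub by auto
  then have i: "integrable lebesgue (\<lambda>x. indicator ?C x * f x)" by (rule locally_integrable_indicator[OF f cC])
  have "integrable lebesgue (\<lambda>x. indicator ?C (0 + c *\<^sub>R x) * f (0 + c *\<^sub>R x))"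
    using integral_lebesgue_affine(2)[OF c borel_measurable_integrable[OF i], of 0] i by blast
  moreover have "indicat_real ?C (0 + c *\<^sub>R x) = indicator C x" for x
    using c by (auto simp: indicator_def)
  ultimately have "integrable lebesgue (\<lambda>x. indicator C x *\<^sub>R f (c *\<^sub>R x))" by simp
  then show "integrable (lebesgue_on C) (\<lambda>x. f (c *\<^sub>R x))"
    using C by (subst integrable_restrict_space) (auto simp: sets_lebesgue_compact)
qed

text \<open>Test functions on \<open>B\<close> are carried to \<Omega> by the inverse dilation. The
  Jacobian appears on both sides and cancels; the power of \<open>c\<close> comes from the
  derivatives of the dilated test function.\<close>

lemma has_weak_partials_scale:
  fixes f :: "'a::euclidean_space \<Rightarrow> real"
  assumes fg: "has_weak_partials \<Omega> bs f g" and c: "c > 0" and sub: "\<And>x. x \<in> B \<Longrightarrow> c *\<^sub>R x \<in> \<Omega>"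
    and \<Omega>: "open \<Omega>" and B: "open B" and bs: "bs \<in> lists Basis"
  shows "has_weak_partials B bs (\<lambda>x. f (c *\<^sub>R x)) (\<lambda>x. c ^ length bs * g (c *\<^sub>R x))"
  unfolding has_weak_partials_def
proof (intro conjI ballI)
  note li = has_weak_partialsD(1,2)[OF fg]
  have c0: "c \<noteq> 0" using c by simp
  show lf: "locally_integrable B (\<lambda>x. f (c *\<^sub>R x))" by (rule locally_integrable_scale[OF li(1) c0 sub])
  show lg: "locally_integrable B (\<lambda>x. c ^ length bs * g (c *\<^sub>R x))"
    by (intro locally_integrable_cmult locally_integrable_scale[OF li(2) c0 sub])
  fix \<psi> assume \<psi>: "\<psi> \<in> test_functions B"
  let ?s = "\<lambda>\<phi> x. \<phi> ((1 / c) *\<^sub>R x)"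
  have img: "(*\<^sub>R) (1 / (1 / c)) ` B \<subseteq> \<Omega>" using sub by auto
  have ts: "?s \<phi> \<in> test_functions \<Omega>" if "\<phi> \<in> test_functions B" for \<phi> :: "'a \<Rightarrow> real"
    by (rule test_functions_scale[OF that _ img]) (use c in simp)
  have \<psi>b: "partials bs \<psi> \<in> test_functions B" by (rule test_functions_partials[OF \<psi> bs])
  have int: "(\<integral>x. h x * ?s \<phi> x \<partial>lebesgue_on \<Omega>) = c ^ DIM('a) * (\<integral>x. h (c *\<^sub>R x) * \<phi> x \<partial>lebesgue_on B)"
    if h: "locally_integrable \<Omega> h" and \<phi>: "\<phi> \<in> test_functions B" for h \<phi> :: "'a \<Rightarrow> real"
  proof -
    note m = locally_integrable_mult_test[OF h ts[OF \<phi>] \<Omega>]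
    have "(\<integral>x. h x * ?s \<phi> x \<partial>lebesgue) = \<bar>c\<bar> ^ DIM('a) * (\<integral>x. h (0 + c *\<^sub>R x) * ?s \<phi> (0 + c *\<^sub>R x) \<partial>lebesgue)"
      by (rule integral_lebesgue_affine(1)[OF c0 borel_measurable_integrable[OF m(2)]])
    then show ?thesis
      using m(3) locally_integrable_mult_test(3)[OF locally_integrable_scale[OF h c0 sub] \<phi> B] c by simp
  qed
  have "partials bs (?s \<psi>) = (\<lambda>x. (1 / c) ^ length bs * ?s (partials bs \<psi>) x)"
    by (rule partials_scale[OF test_functions_smooth[OF \<psi>] bs])
  then have "(\<integral>x. f x * ((1 / c) ^ length bs * ?s (partials bs \<psi>) x) \<partial>lebesgue_on \<Omega>)
      = (-1) ^ length bs * (\<integral>x. g x * ?s \<psi> x \<partial>lebesgue_on \<Omega>)"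
    using has_weak_partialsD(3)[OF fg ts[OF \<psi>]] by simp
  moreover have "(\<integral>x. f x * ((1 / c) ^ length bs * ?s (partials bs \<psi>) x) \<partial>lebesgue_on \<Omega>)
    = (1 / c) ^ length bs * (\<integral>x. f x * ?s (partials bs \<psi>) x \<partial>lebesgue_on \<Omega>)"
    by (subst integral_mult_right_zero[symmetric]) (simp add: mult.left_commute)
  ultimately have "(1 / c) ^ length bs * (c ^ DIM('a) * (\<integral>x. f (c *\<^sub>R x) * partials bs \<psi> x \<partial>lebesgue_on B))
    = (-1) ^ length bs * (c ^ DIM('a) * (\<integral>x. g (c *\<^sub>R x) * \<psi> x \<partial>lebesgue_on B))"
    unfolding int[OF li(1) \<psi>b] int[OF li(2) \<psi>] by simp
  then have "(\<integral>x. f (c *\<^sub>R x) * partials bs \<psi> x \<partial>lebesgue_on B)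
    = (-1) ^ length bs * (c ^ length bs * (\<integral>x. g (c *\<^sub>R x) * \<psi> x \<partial>lebesgue_on B))"
    using c by (simp add: power_one_over field_simps)
  then show "(\<integral>x. f (c *\<^sub>R x) * partials bs \<psi> x \<partial>lebesgue_on B)
    = (-1) ^ length bs * (\<integral>x. c ^ length bs * g (c *\<^sub>R x) * \<psi> x \<partial>lebesgue_on B)"
    by (simp add: mult.assoc)
qed

lemma square_integrable_scale:
  fixes h :: "'a::euclidean_space \<Rightarrow> real"
  assumes h: "square_integrable (lebesgue_on \<Omega>) h" and c: "c > 0" and sub: "\<And>x. x \<in> B \<Longrightarrow> c *\<^sub>R x \<in> \<Omega>"
    and \<Omega>: "\<Omega> \<in> sets lebesgue" and B: "B \<in> sets lebesgue"
  shows "square_integrable (lebesgue_on B) (\<lambda>x. h (c *\<^sub>R x))"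
    and "l2norm (lebesgue_on B) (\<lambda>x. h (c *\<^sub>R x)) \<le> sqrt (1 / c ^ DIM('a)) * l2norm (lebesgue_on \<Omega>) h"
proof -
  \<comment> \<open>Extension by zero: the change of variables is stated on the whole space and
    nothing is known about \<open>h\<close> outside \<Omega>. Since the dilated \<open>B\<close> may
    be a proper part of \<Omega>, only an inequality results.\<close>
  let ?h = "\<lambda>x. if x \<in> \<Omega> then h x else 0"
  have c0: "c \<noteq> 0" using c by simp
  have mh: "?h \<in> borel_measurable lebesgue"
    using h \<Omega> by (subst borel_measurable_if) (auto simp: square_integrable_def)
  have e: "indicator \<Omega> x *\<^sub>R (norm (h x))\<^sup>2 = (?h x)\<^sup>2" for x by (simp add: indicator_def)
  have O: "\<Omega> \<inter> space lebesgue \<in> sets lebesgue" using \<Omega> by simp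
  have "integrable (lebesgue_on \<Omega>) (\<lambda>x. (norm (h x))\<^sup>2)" using h by (simp add: square_integrable_def)
  then have i: "integrable lebesgue (\<lambda>x. (?h x)\<^sup>2)"
    unfolding integrable_restrict_space[OF O] e .
  have L: "(l2norm (lebesgue_on \<Omega>) h)\<^sup>2 = (\<integral>x. (?h x)\<^sup>2 \<partial>lebesgue)"
    unfolding l2norm_power2 integral_restrict_space[OF O] e ..
  have mq: "(\<lambda>x. (?h x)\<^sup>2) \<in> borel_measurable lebesgue" using i by auto
  have j: "integrable lebesgue (\<lambda>x. (?h (0 + c *\<^sub>R x))\<^sup>2)"
    using integral_lebesgue_affine(2)[OF c0 mq, of 0] i by simp
  have "?h \<circ> (\<lambda>x. 0 + c *\<^sub>R x) \<in> borel_measurable lebesgue"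
    by (rule measurable_comp[OF lebesgue_affine_eq(2)[OF c0] mh])
  then have hB: "?h \<circ> (\<lambda>x. 0 + c *\<^sub>R x) \<in> borel_measurable (lebesgue_on B)" by (rule measurable_restrict_space1)
  have hc: "(?h \<circ> (\<lambda>x. 0 + c *\<^sub>R x)) x = h (c *\<^sub>R x)" if "x \<in> space (lebesgue_on B)" for x
    using that sub[of x] by simp
  have m: "(\<lambda>x. h (c *\<^sub>R x)) \<in> borel_measurable (lebesgue_on B)"
    by (rule measurable_cong[THEN iffD1, OF hc hB])
  have "integrable lebesgue (\<lambda>x. indicator B x *\<^sub>R (?h (0 + c *\<^sub>R x))\<^sup>2)"
    by (rule integrable_mult_indicator[OF B j])
  moreover have e2: "indicator B x *\<^sub>R (?h (0 + c *\<^sub>R x))\<^sup>2 = indicator B x *\<^sub>R (norm (h (c *\<^sub>R x)))\<^sup>2" for x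
    using sub[of x] by (simp add: indicator_def)
  ultimately have k: "integrable lebesgue (\<lambda>x. indicator B x *\<^sub>R (norm (h (c *\<^sub>R x)))\<^sup>2)" by (simp only: e2)
  show "square_integrable (lebesgue_on B) (\<lambda>x. h (c *\<^sub>R x))"
    unfolding square_integrable_def using m k by (subst integrable_restrict_space) (simp_all add: B)
  have "(l2norm (lebesgue_on B) (\<lambda>x. h (c *\<^sub>R x)))\<^sup>2 = (\<integral>x. indicator B x *\<^sub>R (norm (h (c *\<^sub>R x)))\<^sup>2 \<partial>lebesgue)"
    unfolding l2norm_power2 by (subst integral_restrict_space) (simp_all add: B)
  also have "\<dots> \<le> (\<integral>x. (?h (0 + c *\<^sub>R x))\<^sup>2 \<partial>lebesgue)"
  proof (rule integral_mono[OF k j])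
    fix x show "indicator B x *\<^sub>R (norm (h (c *\<^sub>R x)))\<^sup>2 \<le> (?h (0 + c *\<^sub>R x))\<^sup>2"
      unfolding e2[symmetric] by (simp add: indicator_def)
  qed
  also have "\<dots> = 1 / c ^ DIM('a) * (l2norm (lebesgue_on \<Omega>) h)\<^sup>2"
    unfolding L using integral_lebesgue_affine(1)[OF c0 mq, of 0] c by simp
  finally have "l2norm (lebesgue_on B) (\<lambda>x. h (c *\<^sub>R x)) \<le> sqrt (1 / c ^ DIM('a) * (l2norm (lebesgue_on \<Omega>) h)\<^sup>2)"
    by (rule real_le_rsqrt)
  then show "l2norm (lebesgue_on B) (\<lambda>x. h (c *\<^sub>R x)) \<le> sqrt (1 / c ^ DIM('a)) * l2norm (lebesgue_on \<Omega>) h"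
    unfolding real_sqrt_mult by simp
qed

lemma sobolev_space_scale:
  fixes f :: "'a::euclidean_space \<Rightarrow> real"
  assumes f: "f \<in> sobolev_space m \<Omega>" and c: "c > 0" and sub: "\<And>x. x \<in> B \<Longrightarrow> c *\<^sub>R x \<in> \<Omega>"
    and \<Omega>: "open \<Omega>" and B: "open B"
  shows "(\<lambda>x. f (c *\<^sub>R x)) \<in> sobolev_space m B"
    and "sob_sum m B (\<lambda>x. f (c *\<^sub>R x)) \<le> (1 + c) ^ m * sqrt (1 / c ^ DIM('a)) * sob_sum m \<Omega> f"
proof -
  note fd = sobolev_spaceD[OF \<Omega> f]
  note Os = sets_lebesgue_open[OF \<Omega>] and Bs = sets_lebesgue_open[OF B]
  have hw: "has_weak_partials B bs (\<lambda>x. f (c *\<^sub>R x)) (\<lambda>x. c ^ length bs * weak_partials \<Omega> bs f (c *\<^sub>R x))"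
    if bs: "bs \<in> lists Basis" "length bs \<le> m" for bs
    by (rule has_weak_partials_scale[OF weakly_diffD[OF fd(1) bs] c sub \<Omega> B bs(1)])
  have sq: "square_integrable (lebesgue_on B) (\<lambda>x. c ^ length bs * weak_partials \<Omega> bs f (c *\<^sub>R x))"
    if bs: "bs \<in> lists Basis" "length bs \<le> m" for bs
    by (rule square_integrable_cmult[OF square_integrable_scale(1)[OF fd(2)[OF bs] c sub Os Bs]])
  show s: "(\<lambda>x. f (c *\<^sub>R x)) \<in> sobolev_space m B"
    unfolding sobolev_space_def mem_Collect_eq
  proof (intro ballI impI)
    fix bs :: "'a list" assume bs: "bs \<in> lists Basis" "length bs \<le> m"
    show "\<exists>g\<in>Lp 2 B. has_weak_partials B bs (\<lambda>x. f (c *\<^sub>R x)) g"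
      by (rule bexI[of _ "\<lambda>x. c ^ length bs * weak_partials \<Omega> bs f (c *\<^sub>R x)"]) (use hw[OF bs] sq[OF bs] in \<open>simp_all add: Lp_2_iff\<close>)
  qed
  have "l2norm (lebesgue_on B) (weak_partials B bs (\<lambda>x. f (c *\<^sub>R x)))
      \<le> (1 + c) ^ m * sqrt (1 / c ^ DIM('a)) * l2norm (lebesgue_on \<Omega>) (weak_partials \<Omega> bs f)"
    if bs: "bs \<in> lists Basis" "length bs \<le> m" for bs
  proof -
    have "l2norm (lebesgue_on B) (weak_partials B bs (\<lambda>x. f (c *\<^sub>R x)))
      = l2norm (lebesgue_on B) (\<lambda>x. c ^ length bs * weak_partials \<Omega> bs f (c *\<^sub>R x))"
      by (rule l2norm_cong_AE[OF square_integrable_measurable[OF sobolev_spaceD(2)[OF B s bs]]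
            square_integrable_measurable[OF sq[OF bs]] weak_partials_AE_unique[OF B hw[OF bs]]])
    also have "\<dots> = c ^ length bs * l2norm (lebesgue_on B) (\<lambda>x. weak_partials \<Omega> bs f (c *\<^sub>R x))"
      using c by (simp add: l2norm_cmult)
    also have "\<dots> \<le> (1 + c) ^ m * (sqrt (1 / c ^ DIM('a)) * l2norm (lebesgue_on \<Omega>) (weak_partials \<Omega> bs f))"
    proof (rule mult_mono)
      \<comment> \<open>Replacing \<open>c\<close> by \<open>1 + c\<close> gives one factor for all
        orders up to m, whether \<open>c\<close> is below or above 1.\<close>
      have "c ^ length bs \<le> (1 + c) ^ length bs" using c by (intro power_mono) auto
      also have "\<dots> \<le> (1 + c) ^ m" using c bs by (intro power_increasing) auto
      finally show "c ^ length bs \<le> (1 + c) ^ m" .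
      show "l2norm (lebesgue_on B) (\<lambda>x. weak_partials \<Omega> bs f (c *\<^sub>R x))
        \<le> sqrt (1 / c ^ DIM('a)) * l2norm (lebesgue_on \<Omega>) (weak_partials \<Omega> bs f)"
        by (rule square_integrable_scale(2)[OF fd(2)[OF bs] c sub Os Bs])
    qed (use c in auto)
    finally show ?thesis by (simp add: mult.assoc)
  qed
  then show "sob_sum m B (\<lambda>x. f (c *\<^sub>R x)) \<le> (1 + c) ^ m * sqrt (1 / c ^ DIM('a)) * sob_sum m \<Omega> f"
    unfolding sob_sum_def sum_distrib_left by (intro sum_mono) auto
qed

subsection \<open>The energy of test functions\<close>

lemma laplacian_eq: "laplacian \<phi> = (\<lambda>x. \<Sum>b\<in>Basis. partials [b, b] \<phi> x)"
  by (auto simp: laplacian_def)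

lemma smooth_laplacian: "smooth \<phi> \<Longrightarrow> smooth (laplacian \<phi>)"
  unfolding laplacian_eq by (intro smooth_sum smooth_partials) auto

lemma smooth_funpow_laplacian: "smooth \<phi> \<Longrightarrow> smooth ((laplacian ^^ k) \<phi>)"
  by (induction k) (auto intro: smooth_laplacian)

lemma test_functions_laplacian: "\<phi> \<in> test_functions U \<Longrightarrow> laplacian \<phi> \<in> test_functions U"
  unfolding laplacian_eq by (intro test_functions_sum test_functions_partials) auto

lemma test_functions_funpow_laplacian: "\<phi> \<in> test_functions U \<Longrightarrow> (laplacian ^^ k) \<phi> \<in> test_functions U"
  by (induction k) (auto intro: test_functions_laplacian)

lemma funpow_weak_laplacian_smooth:
  assumes \<Omega>: "open \<Omega>" and \<phi>: "smooth \<phi>"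
  shows "AE x in lebesgue_on \<Omega>. (weak_laplacian \<Omega> ^^ k) \<phi> x = (laplacian ^^ k) \<phi> x"
proof (induction k)
  case (Suc k)
  let ?u = "(weak_laplacian \<Omega> ^^ k) \<phi>" and ?v = "(laplacian ^^ k) \<phi>"
  have v: "smooth ?v" by (rule smooth_funpow_laplacian[OF \<phi>])
  have "weakly_diff 0 \<Omega> ?u" by (intro weakly_diff_funpow_laplacian \<Omega> weakly_diff_smooth \<phi>)
  then have "weak_laplacian \<Omega> ?u = weak_laplacian \<Omega> ?v"
    by (intro weak_laplacian_cong_AE \<Omega> locally_integrable_smooth[OF v] Suc weakly_diff_locally_integrable)
  moreover have "AE x in lebesgue_on \<Omega>. \<forall>b\<in>Basis. weak_partials \<Omega> [b, b] ?v x = partials [b, b] ?v x"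
    by (intro AE_finite_allI finite_Basis weak_partials_smooth(1)[OF \<Omega> v]) auto
  then have "AE x in lebesgue_on \<Omega>. weak_laplacian \<Omega> ?v x = laplacian ?v x"
    by eventually_elim (simp add: weak_laplacian_def laplacian_def)
  ultimately show ?case by simp
qed simp

text \<open>The pointwise counterpart of \<open>nabla_pow\<close>, which even for smooth functions
  is fixed only up to null sets; integrations by parts are carried out on this version.\<close>

definition classical_nabla :: "nat \<Rightarrow> ('a::euclidean_space \<Rightarrow> real) \<Rightarrow> 'a \<Rightarrow> real \<times> 'a" where
  "classical_nabla m \<phi> x =
     (if even m then ((laplacian ^^ (m div 2)) \<phi> x, 0)
      else (0, \<Sum>b\<in>Basis. partial b ((laplacian ^^ (m div 2)) \<phi>) x *\<^sub>R b))"

lemma nabla_pow_smooth: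
  assumes \<Omega>: "open \<Omega>" and \<phi>: "smooth \<phi>"
  shows "AE x in lebesgue_on \<Omega>. nabla_pow m \<Omega> \<phi> x = classical_nabla m \<phi> x"
proof (cases "even m")
  case True
  then show ?thesis using funpow_weak_laplacian_smooth[OF \<Omega> \<phi>, of "m div 2"]
    by (simp add: nabla_pow_def classical_nabla_def)
next
  case False
  let ?u = "(weak_laplacian \<Omega> ^^ (m div 2)) \<phi>" and ?v = "(laplacian ^^ (m div 2)) \<phi>"
  have v: "smooth ?v" by (rule smooth_funpow_laplacian[OF \<phi>])
  have "weakly_diff 0 \<Omega> ?u" by (intro weakly_diff_funpow_laplacian \<Omega> weakly_diff_smooth \<phi>)
  then have e: "weak_gradient \<Omega> ?u = weak_gradient \<Omega> ?v"
    by (intro weak_gradient_cong_AE \<Omega> locally_integrable_smooth[OF v] funpow_weak_laplacian_smooth \<phi> weakly_diff_locally_integrable)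
  have "AE x in lebesgue_on \<Omega>. \<forall>b\<in>Basis. weak_partials \<Omega> [b] ?v x = partials [b] ?v x"
    by (intro AE_finite_allI finite_Basis weak_partials_smooth(1)[OF \<Omega> v]) auto
  then show ?thesis
    by eventually_elim (use False e in \<open>simp add: nabla_pow_def classical_nabla_def weak_gradient_def partials_Cons\<close>)
qed

text \<open>The squared L^2 norm of the full tensor of derivatives of order m; a multi-index is
  counted once for each of its orderings.\<close>

definition hessian_energy :: "nat \<Rightarrow> ('a::euclidean_space \<Rightarrow> real) \<Rightarrow> real" where
  "hessian_energy m \<phi> = (\<Sum>bs\<in>basis_lists m. \<integral>x. (partials bs \<phi> x)\<^sup>2 \<partial>lebesgue)"

lemma sum_basis_lists_Suc:
  fixes F :: "'a::euclidean_space list \<Rightarrow> real"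
  shows "(\<Sum>bs\<in>basis_lists (Suc n). F bs) = (\<Sum>b\<in>Basis. \<Sum>bs\<in>basis_lists n. F (b # bs))"
proof -
  have e: "basis_lists (Suc n) = (\<lambda>(b, bs). b # bs) ` ((Basis :: 'a set) \<times> basis_lists n)"
    by (auto simp: basis_lists_def image_def length_Suc_conv)
  have "inj_on (\<lambda>(b, bs). b # bs) ((Basis :: 'a set) \<times> basis_lists n)" by (auto simp: inj_on_def)
  then show ?thesis unfolding e by (simp add: sum.reindex sum.cartesian_product case_prod_unfold)
qed

lemma basis_lists_0: "basis_lists 0 = {[]}"
  by (auto simp: basis_lists_def)

section \<open>The energy of a test function is the norm of its full derivative tensor\<close>

lemma integrable_mult_test:
  assumes "\<phi> \<in> test_functions U" "\<psi> \<in> test_functions V"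
  shows "integrable lebesgue (\<lambda>x. \<phi> x * \<psi> x)"
  by (rule test_functions_integrable[OF test_functions_mult[OF assms(2) test_functions_smooth[OF assms(1)]]])

text \<open>One integration by parts moves a derivative along \<open>b\<close>, another moves one
  along \<open>c\<close>, and commutation makes the two factors equal. Summation over
  \<open>b\<close> and \<open>c\<close> shows that the Laplacian controls the whole Hessian.\<close>

lemma integral_second_partials:
  assumes \<psi>: "\<psi> \<in> test_functions U" and b: "b \<in> Basis" and c: "c \<in> Basis"
  shows "(\<integral>x. partials [b, b] \<psi> x * partials [c, c] \<psi> x \<partial>lebesgue) = (\<integral>x. (partials [b, c] \<psi> x)\<^sup>2 \<partial>lebesgue)"
proof -
  note t = test_functions_partial[OF _ b] test_functions_partial[OF _ c]
  have s: "smooth \<psi>" by (rule test_functions_smooth[OF \<psi>])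
  note sb = smooth_partial[OF s b] and sc = smooth_partial[OF s c]
  have "(\<integral>x. partials [b, b] \<psi> x * partials [c, c] \<psi> x \<partial>lebesgue)
      = - (\<integral>x. partial b \<psi> x * partial b (partial c (partial c \<psi>)) x \<partial>lebesgue)"
    unfolding partials_Cons partials_Nil using \<psi> by (intro integral_partial_by_parts[of _ _ U] sb t b)
  also have "partial b (partial c (partial c \<psi>)) = partial c (partial b (partial c \<psi>))"
    by (rule partial_commute[OF sc b c])
  also have "- (\<integral>x. partial b \<psi> x * partial c (partial b (partial c \<psi>)) x \<partial>lebesgue)
      = (\<integral>x. partial c (partial b \<psi>) x * partial b (partial c \<psi>) x \<partial>lebesgue)"
    using integral_partial_by_parts[OF sb, of "partial b (partial c \<psi>)" U c] \<psi> t c by simp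
  also have "partial c (partial b \<psi>) = partial b (partial c \<psi>)"
    by (rule partial_commute[OF s c b])
  finally show ?thesis by (simp add: partials_Cons power2_eq_square)
qed

lemma integral_laplacian_square:
  assumes \<psi>: "\<psi> \<in> test_functions U"
  shows "(\<integral>x. (laplacian \<psi> x)\<^sup>2 \<partial>lebesgue) = (\<Sum>b\<in>Basis. \<Sum>c\<in>Basis. \<integral>x. (partials [b, c] \<psi> x)\<^sup>2 \<partial>lebesgue)"
proof -
  have i: "integrable lebesgue (\<lambda>x. partials [b, b] \<psi> x * partials [c, c] \<psi> x)" if "b \<in> Basis" "c \<in> Basis" for b c
    using that by (intro integrable_mult_test[of _ U _ U] test_functions_partials[OF \<psi>]) auto
  have "(\<integral>x. (laplacian \<psi> x)\<^sup>2 \<partial>lebesgue) = (\<integral>x. (\<Sum>b\<in>Basis. \<Sum>c\<in>Basis. partials [b, b] \<psi> x * partials [c, c] \<psi> x) \<partial>lebesgue)"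
    by (simp add: laplacian_def power2_eq_square sum_product)
  also have "\<dots> = (\<Sum>b\<in>Basis. \<Sum>c\<in>Basis. \<integral>x. partials [b, b] \<psi> x * partials [c, c] \<psi> x \<partial>lebesgue)"
    using i by (simp add: Bochner_Integration.integral_sum Bochner_Integration.integrable_sum)
  also have "\<dots> = (\<Sum>b\<in>Basis. \<Sum>c\<in>Basis. \<integral>x. (partials [b, c] \<psi> x)\<^sup>2 \<partial>lebesgue)"
    by (intro sum.cong refl integral_second_partials[OF \<psi>])
  finally show ?thesis .
qed

lemma partials_laplacian:
  assumes "smooth \<phi>" "bs \<in> lists Basis"
  shows "partials bs (laplacian \<phi>) = laplacian (partials bs \<phi>)"
proof -
  have "partials bs (laplacian \<phi>) = (\<lambda>x. \<Sum>b\<in>Basis. partials bs (partials [b, b] \<phi>) x)"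
    unfolding laplacian_eq by (rule partials_sum) (use assms in \<open>auto intro: smooth_partials\<close>)
  also have "\<dots> = (\<lambda>x. \<Sum>b\<in>Basis. partials [b, b] (partials bs \<phi>) x)"
    using partials_commute[OF assms] by (intro ext sum.cong) auto
  finally show ?thesis by (simp add: laplacian_eq)
qed

text \<open>The identity for the squared Laplacian is applied to each
  \<open>partials bs \<phi>\<close>, with the two outermost derivatives playing the role of the
  Hessian.\<close>

lemma hessian_energy_laplacian:
  assumes \<phi>: "\<phi> \<in> test_functions U"
  shows "hessian_energy (Suc (Suc n)) \<phi> = hessian_energy n (laplacian \<phi>)"
proof -
  have "hessian_energy (Suc (Suc n)) \<phi>
    = (\<Sum>bs\<in>basis_lists n. \<Sum>b\<in>Basis. \<Sum>c\<in>Basis. \<integral>x. (partials (b # c # bs) \<phi> x)\<^sup>2 \<partial>lebesgue)"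
    unfolding hessian_energy_def sum_basis_lists_Suc
    by (subst (2) sum.swap, subst sum.swap) (rule refl)
  also have "\<dots> = (\<Sum>bs\<in>basis_lists n. \<integral>x. (partials bs (laplacian \<phi>) x)\<^sup>2 \<partial>lebesgue)"
  proof (rule sum.cong[OF refl])
    fix bs :: "'a list" assume "bs \<in> basis_lists n"
    then have bs: "bs \<in> lists Basis" by (simp add: basis_lists_def)
    show "(\<Sum>b\<in>Basis. \<Sum>c\<in>Basis. \<integral>x. (partials (b # c # bs) \<phi> x)\<^sup>2 \<partial>lebesgue) = (\<integral>x. (partials bs (laplacian \<phi>) x)\<^sup>2 \<partial>lebesgue)"
      unfolding partials_laplacian[OF test_functions_smooth[OF \<phi>] bs] integral_laplacian_square[OF test_functions_partials[OF \<phi> bs]]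
      by (simp add: partials_Cons)
  qed
  finally show ?thesis by (simp add: hessian_energy_def)
qed

lemma hessian_energy_funpow_laplacian:
  "\<phi> \<in> test_functions U \<Longrightarrow> hessian_energy (2 * k + j) \<phi> = hessian_energy j ((laplacian ^^ k) \<phi>)"
proof (induction k arbitrary: \<phi>)
  case (Suc k)
  have "hessian_energy (2 * Suc k + j) \<phi> = hessian_energy (2 * k + j) (laplacian \<phi>)"
    using hessian_energy_laplacian[OF Suc.prems, of "2 * k + j"] by simp
  also have "\<dots> = hessian_energy j ((laplacian ^^ Suc k) \<phi>)"
    by (simp only: Suc.IH[OF test_functions_laplacian[OF Suc.prems]] funpow_Suc_right o_apply)
  finally show ?case .
qed simp

text \<open>Trading pairs of derivatives for Laplacians m div 2 times reduces the tensor norm to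
  order 0 for even m and to order 1, the gradient, for odd m.\<close>

lemma integral_classical_nabla:
  fixes \<phi> :: "'a::euclidean_space \<Rightarrow> real"
  assumes \<phi>: "\<phi> \<in> test_functions U"
  shows "(\<integral>x. (norm (classical_nabla m \<phi> x))\<^sup>2 \<partial>lebesgue) = hessian_energy m \<phi>"
proof (cases "even m")
  case True
  then have "hessian_energy m \<phi> = hessian_energy 0 ((laplacian ^^ (m div 2)) \<phi>)"
    using hessian_energy_funpow_laplacian[OF \<phi>, of "m div 2" 0] by simp
  then show ?thesis using True by (simp add: classical_nabla_def norm_Pair hessian_energy_def basis_lists_0)
next
  case False
  let ?u = "(laplacian ^^ (m div 2)) \<phi>"
  have m: "m = 2 * (m div 2) + 1" using False by presburger
  have u: "?u \<in> test_functions U" by (rule test_functions_funpow_laplacian[OF \<phi>])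
  have sq: "(norm (\<Sum>b\<in>Basis. f b *\<^sub>R b :: 'a))\<^sup>2 = (\<Sum>b\<in>Basis. (f b)\<^sup>2)" for f
    unfolding power2_norm_eq_inner by (subst euclidean_inner) (simp add: power2_eq_square)
  have i: "integrable lebesgue (\<lambda>x. (partial b ?u x)\<^sup>2)" if "b \<in> Basis" for b
    unfolding power2_eq_square using that by (intro integrable_mult_test[of _ U _ U] test_functions_partial[OF u])
  have "(\<integral>x. (norm (classical_nabla m \<phi> x))\<^sup>2 \<partial>lebesgue) = (\<integral>x. (\<Sum>b\<in>Basis. (partial b ?u x)\<^sup>2) \<partial>lebesgue)"
    using False by (simp add: classical_nabla_def norm_Pair sq sum_nonneg)
  also have "\<dots> = (\<Sum>b\<in>Basis. \<integral>x. (partial b ?u x)\<^sup>2 \<partial>lebesgue)" using i by simp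
  also have "\<dots> = hessian_energy 1 ?u"
    by (simp add: hessian_energy_def sum_basis_lists_Suc basis_lists_0 partials_Cons)
  also have "\<dots> = hessian_energy m \<phi>" using hessian_energy_funpow_laplacian[OF \<phi>, of "m div 2" 1] m by simp
  finally show ?thesis .
qed

lemma classical_nabla_measurable:
  assumes "smooth \<phi>" "S \<in> sets lebesgue"
  shows "classical_nabla m \<phi> \<in> borel_measurable (lebesgue_on S)"
proof (cases "even m")
  case True
  then show ?thesis using assms
    by (auto simp: classical_nabla_def[abs_def] intro!: borel_measurable_Pair smooth_measurable_lebesgue_on smooth_funpow_laplacian)
next
  case False
  have "(\<lambda>x. \<Sum>b\<in>Basis. partial b ((laplacian ^^ (m div 2)) \<phi>) x *\<^sub>R b) \<in> borel_measurable (lebesgue_on S)"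
    using assms by (intro borel_measurable_sum borel_measurable_scaleR borel_measurable_const
      smooth_measurable_lebesgue_on smooth_partial smooth_funpow_laplacian)
  then show ?thesis using False by (simp add: classical_nabla_def[abs_def] borel_measurable_Pair)
qed

lemma enorm_test_function:
  assumes \<Omega>: "open \<Omega>" and \<phi>: "\<phi> \<in> test_functions \<Omega>"
  shows "(enorm m \<Omega> \<phi>)\<^sup>2 = hessian_energy m \<phi>"
proof -
  have s: "smooth \<phi>" by (rule test_functions_smooth[OF \<phi>])
  have O: "\<Omega> \<inter> space lebesgue \<in> sets lebesgue" using sets_lebesgue_open[OF \<Omega>] by simp
  have u: "(laplacian ^^ (m div 2)) \<phi> \<in> test_functions \<Omega>" by (rule test_functions_funpow_laplacian[OF \<phi>])
  have z: "classical_nabla m \<phi> x = 0" if "x \<notin> \<Omega>" for x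
    using test_functions_zero_outside[OF u that] test_functions_zero_outside[OF test_functions_partial[OF u] that]
    by (simp add: classical_nabla_def zero_prod_def)
  have "(enorm m \<Omega> \<phi>)\<^sup>2 = (l2norm (lebesgue_on \<Omega>) (classical_nabla m \<phi>))\<^sup>2"
    unfolding enorm_def
    by (subst l2norm_cong_AE[OF nabla_pow_measurable[OF \<Omega> weakly_diff_smooth[OF \<Omega> s]]
          classical_nabla_measurable[OF s sets_lebesgue_open[OF \<Omega>]] nabla_pow_smooth[OF \<Omega> s]]) simp
  also have "\<dots> = (\<integral>x. indicator \<Omega> x *\<^sub>R (norm (classical_nabla m \<phi> x))\<^sup>2 \<partial>lebesgue)"
    unfolding l2norm_power2 integral_restrict_space[OF O] ..
  also have "\<dots> = (\<integral>x. (norm (classical_nabla m \<phi> x))\<^sup>2 \<partial>lebesgue)"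
    by (rule Bochner_Integration.integral_cong) (auto simp: indicator_def z)
  finally show ?thesis using integral_classical_nabla[OF \<phi>] by simp
qed

lemma enorm_test_function_UNIV:
  assumes "\<phi> \<in> test_functions U"
  shows "(enorm m UNIV \<phi>)\<^sup>2 = hessian_energy m \<phi>"
  using enorm_test_function[OF open_UNIV test_functions_UNIV[OF assms]] .

text \<open>Both sides are the same integral over the whole space, because derivatives of \<phi>
  vanish outside \<Omega>. This is the passage between competitors in \<Omega> and in the whole
  space.\<close>

lemma enorm_test_function_eq:
  assumes "open \<Omega>" "\<phi> \<in> test_functions \<Omega>"
  shows "enorm m \<Omega> \<phi> = enorm m UNIV \<phi>"
proof -
  have "(enorm m \<Omega> \<phi>)\<^sup>2 = (enorm m UNIV \<phi>)\<^sup>2"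
    using enorm_test_function[OF assms] enorm_test_function_UNIV[OF assms(2)] by simp
  then show ?thesis using power2_eq_imp_eq[of "enorm m \<Omega> \<phi>" "enorm m UNIV \<phi>"] by simp
qed

text \<open>The Jacobian contributes \<open>c ^ DIM('a)\<close> and each of the two equal factors of
  the square contributes \<open>c ^ m\<close>; writing the identity without division avoids negative
  exponents.\<close>

lemma hessian_energy_scale:
  fixes \<phi> :: "'a::euclidean_space \<Rightarrow> real"
  assumes \<phi>: "\<phi> \<in> test_functions U" and c: "c > 0"
  shows "c ^ DIM('a) * hessian_energy m (\<lambda>x. \<phi> (c *\<^sub>R x)) = c ^ (2 * m) * hessian_energy m \<phi>"
proof -
  have "c ^ DIM('a) * (\<integral>x. (partials bs (\<lambda>x. \<phi> (c *\<^sub>R x)) x)\<^sup>2 \<partial>lebesgue)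
    = c ^ (2 * m) * (\<integral>x. (partials bs \<phi> x)\<^sup>2 \<partial>lebesgue)" if "bs \<in> basis_lists m" for bs
  proof -
    have bs: "bs \<in> lists Basis" "length bs = m" using that by (auto simp: basis_lists_def)
    note t = test_functions_partials[OF \<phi> bs(1)]
    have "(\<lambda>x. (partials bs \<phi> x)\<^sup>2) \<in> borel_measurable lebesgue"
      by (intro borel_measurable_power smooth_measurable_lebesgue test_functions_smooth[OF t])
    from integral_lebesgue_affine(1)[OF _ this, of c 0] c
    have "(\<integral>x. (partials bs \<phi> x)\<^sup>2 \<partial>lebesgue) = c ^ DIM('a) * (\<integral>x. (partials bs \<phi> (c *\<^sub>R x))\<^sup>2 \<partial>lebesgue)" by simp
    then show ?thesis
      by (simp add: partials_scale[OF test_functions_smooth[OF \<phi>] bs(1)] bs(2) power_mult_distrib power_even_eq mult.left_commute)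
  qed
  then show ?thesis unfolding hessian_energy_def sum_distrib_left by (rule sum.cong[OF refl])
qed

lemma hessian_energy_zero: "hessian_energy m (\<lambda>_. 0) = 0"
  unfolding hessian_energy_def by (intro sum.neutral) (simp add: basis_lists_def partials_zero)

text \<open>Not a matter of unfolding: the weak derivatives of the zero function are chosen
  representatives, so the value is computed through the formula for test functions.\<close>

lemma enorm_zero: "enorm m UNIV (\<lambda>_. 0) = 0"
proof -
  have "(\<lambda>_. 0) \<in> test_functions UNIV" by (simp add: test_functions_iff smooth_const exI[of _ "{}"])
  from enorm_test_function_UNIV[OF this, of m] show ?thesis by (simp add: hessian_energy_zero)
qed

lemma l2norm_partials_le_enorm:
  assumes \<phi>: "\<phi> \<in> test_functions U" and bs: "bs \<in> basis_lists m"
  shows "(\<integral>x. (partials bs \<phi> x)\<^sup>2 \<partial>lebesgue) \<le> (enorm m UNIV \<phi>)\<^sup>2"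
  unfolding enorm_test_function_UNIV[OF \<phi>] hessian_energy_def
  by (rule member_le_sum[OF bs, of "\<lambda>bs. \<integral>x. (partials bs \<phi> x)\<^sup>2 \<partial>lebesgue"]) auto

subsection \<open>A weighted Hardy inequality\<close>

text \<open>A smooth substitute for 1/|x|^2: it has the same decay at infinity but no singularity at
  the origin, so its powers may multiply test functions and may be inverted.\<close>

definition hardy_weight :: "'a::euclidean_space \<Rightarrow> real" where
  "hardy_weight x = inverse (1 + x \<bullet> x)"

lemma hardy_weight_bounds: "0 < hardy_weight x" "hardy_weight x \<le> 1" "(x \<bullet> x) * hardy_weight x \<le> 1"
proof -
  have p: "0 < 1 + x \<bullet> x" by (simp add: add_pos_nonneg)
  then show "0 < hardy_weight x" by (simp add: hardy_weight_def)
  show "hardy_weight x \<le> 1" by (simp add: hardy_weight_def inverse_le_1_iff)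
  show "(x \<bullet> x) * hardy_weight x \<le> 1" using p by (simp add: hardy_weight_def field_simps)
qed

lemma smooth_inner_left: "smooth (\<lambda>x. x \<bullet> v)"
  by (rule smooth_bounded_linear[OF bounded_linear_inner_left])

lemma smooth_hardy_weight: "smooth (hardy_weight :: 'a::euclidean_space \<Rightarrow> real)"
proof -
  have "smooth (\<lambda>x::'a. 1 + (\<Sum>b\<in>Basis. (x \<bullet> b) * (x \<bullet> b)))"
    by (intro smooth_add smooth_const smooth_sum smooth_mult smooth_inner_left)
  then have "smooth (\<lambda>x::'a. 1 + x \<bullet> x)" by (simp add: euclidean_inner[symmetric])
  then have "smooth (\<lambda>x::'a. inverse (1 + x \<bullet> x))"
  proof (rule smooth_inverse)
    fix x :: 'a show "1 + x \<bullet> x \<noteq> 0" by (metis add_pos_nonneg inner_ge_zero less_irrefl zero_less_one)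
  qed
  then show ?thesis by (simp add: hardy_weight_def[abs_def])
qed

lemma partial_hardy_weight_power:
  "partial b (\<lambda>x. hardy_weight x ^ Suc k) = (\<lambda>x. - (2 * real (Suc k) * (x \<bullet> b) * hardy_weight x ^ Suc (Suc k)))"
proof -
  have p: "1 + x \<bullet> x \<noteq> 0" for x :: 'a by (metis add_pos_nonneg inner_ge_zero less_irrefl zero_less_one)
  have w: "(hardy_weight has_derivative (\<lambda>h. - (2 * (x \<bullet> h)) * hardy_weight x ^ 2)) (at x)" for x :: 'a
  proof -
    have "((\<lambda>x. 1 + x \<bullet> x) has_derivative (\<lambda>h. x \<bullet> h + h \<bullet> x)) (at x)"
      by (auto intro!: derivative_eq_intros)
    from Deriv.has_derivative_inverse[OF p this]
    show ?thesis by (simp add: hardy_weight_def[abs_def] inner_commute power2_eq_square algebra_simps)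
  qed
  have "((\<lambda>x. hardy_weight x ^ Suc k) has_derivative
      (\<lambda>h. - (2 * real (Suc k) * (x \<bullet> h) * hardy_weight x ^ Suc (Suc k)))) (at x)" for x :: 'a
    by (rule has_derivative_eq_rhs[OF has_derivative_power[OF w]])
       (auto simp: power2_eq_square algebra_simps)
  from partial_eqI[OF this] show ?thesis .
qed

text \<open>
  The vector field \<open>x \<mapsto> (1 + |x|\<^sup>2)\<^sup>-\<^sup>k \<phi>(x)\<^sup>2 x\<close> has integral divergence zero, and its divergence
  bounds \<open>(1 + |x|\<^sup>2)\<^sup>-\<^sup>k \<phi>\<^sup>2\<close> up to a gradient term as soon as \<open>2 k < N\<close>.
\<close>

lemma weighted_hardy:
  fixes \<phi> :: "'a::euclidean_space \<Rightarrow> real"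
  assumes \<phi>: "\<phi> \<in> test_functions U" and k: "2 * Suc k < DIM('a)"
  shows "(\<integral>x. hardy_weight x ^ Suc k * (\<phi> x)\<^sup>2 \<partial>lebesgue)
    \<le> 4 * (\<Sum>b\<in>Basis. \<integral>x. hardy_weight x ^ k * (partial b \<phi> x)\<^sup>2 \<partial>lebesgue)"
proof -
  let ?q = "hardy_weight :: 'a \<Rightarrow> real"
  let ?g = "\<lambda>x. ?q x ^ Suc k * (\<phi> x * \<phi> x)"
  let ?F = "\<lambda>b x. (x \<bullet> b) * ?g x"
  have s: "smooth \<phi>" by (rule test_functions_smooth[OF \<phi>])
  have sq: "smooth (\<lambda>x. ?q x ^ n)" for n by (intro smooth_power smooth_hardy_weight)
  have tg: "?g \<in> test_functions U" by (intro test_functions_mult sq \<phi> s)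
  have tF: "?F b \<in> test_functions U" for b by (intro test_functions_mult[OF tg] smooth_inner_left)
  have dF: "partial b (?F b) x = ?q x ^ Suc k * (\<phi> x)\<^sup>2
      - 2 * real (Suc k) * (x \<bullet> b)\<^sup>2 * ?q x ^ Suc (Suc k) * (\<phi> x)\<^sup>2
      + 2 * ?q x ^ Suc k * \<phi> x * ((x \<bullet> b) * partial b \<phi> x)" if b: "b \<in> Basis" for b x
  proof -
    have d1: "partial b (\<lambda>x. x \<bullet> b) = (\<lambda>_. b \<bullet> b)"
      by (rule partial_eqI) (auto intro!: derivative_eq_intros)
    have d2: "partial b ?g = (\<lambda>x. partial b (\<lambda>x. ?q x ^ Suc k) x * (\<phi> x * \<phi> x) + ?q x ^ Suc k * (partial b \<phi> x * \<phi> x + \<phi> x * partial b \<phi> x))"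
      by (subst partial_mult, intro smooth_differentiable sq, intro smooth_differentiable smooth_mult s)
         (simp add: partial_mult smooth_differentiable s)
    have "partial b (?F b) = (\<lambda>x. partial b (\<lambda>x. x \<bullet> b) x * ?g x + (x \<bullet> b) * partial b ?g x)"
      by (rule partial_mult) (intro smooth_differentiable smooth_inner_left test_functions_smooth[OF tg])+
    then show ?thesis unfolding d1 d2 partial_hardy_weight_power using b
      by (simp add: power2_eq_square algebra_simps)
  qed
  let ?A = "\<lambda>x. \<Sum>b\<in>Basis. partial b (?F b) x"
  let ?G = "\<lambda>x. \<Sum>b\<in>Basis. ?q x ^ k * (partial b \<phi> x)\<^sup>2"
  have iF: "integrable lebesgue (partial b (?F b))" if "b \<in> Basis" for b
    by (rule test_functions_integrable[OF test_functions_partial[OF tF that]])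
  have i1: "integrable lebesgue ?A" using iF by auto
  have "(\<integral>x. ?A x \<partial>lebesgue) = (\<Sum>b\<in>Basis. \<integral>x. partial b (?F b) x \<partial>lebesgue)"
    using iF by (intro Bochner_Integration.integral_sum)
  also have "\<dots> = 0" by (intro sum.neutral ballI integral_partial_test_function[OF tF])
  finally have A0: "(\<integral>x. ?A x \<partial>lebesgue) = 0" .
  have i2: "integrable lebesgue (\<lambda>x. ?q x ^ Suc k * (\<phi> x)\<^sup>2)"
    using test_functions_integrable[OF tg] by (simp add: power2_eq_square)
  have i3: "integrable lebesgue (\<lambda>x. ?q x ^ k * (partial b \<phi> x)\<^sup>2)" if "b \<in> Basis" for b
    unfolding power2_eq_square
    by (intro test_functions_integrable[of _ U] test_functions_mult sq test_functions_partial[OF \<phi> that] smooth_partial[OF s that])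
  have i4: "integrable lebesgue ?G" using i3 by auto
  have pw: "1 / 2 * (?q x ^ Suc k * (\<phi> x)\<^sup>2) \<le> ?A x + 2 * ?G x" for x
  proof -
    let ?S = "\<Sum>b\<in>Basis. (x \<bullet> b) * partial b \<phi> x" and ?D = "\<Sum>b\<in>Basis. (partial b \<phi> x)\<^sup>2"
    let ?r = "?q x ^ Suc k" and ?N = "real DIM('a)"
    note q = hardy_weight_bounds[of x]
    have r0: "0 \<le> ?r" "0 \<le> ?q x ^ k" using q(1) by (simp_all add: less_imp_le)
    have xx: "(\<Sum>b\<in>Basis. (x \<bullet> b)\<^sup>2) = x \<bullet> x"
      by (simp add: power2_eq_square euclidean_inner[of x x])
    have A: "?A x = ?N * (?r * (\<phi> x)\<^sup>2) - 2 * real (Suc k) * (x \<bullet> x) * ?q x ^ Suc (Suc k) * (\<phi> x)\<^sup>2 + 2 * ?r * \<phi> x * ?S"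
    proof -
      have "?A x = (\<Sum>b\<in>(Basis :: 'a set). ?r * (\<phi> x)\<^sup>2) - (\<Sum>b\<in>Basis. 2 * real (Suc k) * (x \<bullet> b)\<^sup>2 * ?q x ^ Suc (Suc k) * (\<phi> x)\<^sup>2)
          + (\<Sum>b\<in>Basis. 2 * ?r * \<phi> x * ((x \<bullet> b) * partial b \<phi> x))"
        by (simp only: dF sum.distrib sum_subtractf cong: sum.cong)
      also have "(\<Sum>b\<in>Basis. 2 * real (Suc k) * (x \<bullet> b)\<^sup>2 * ?q x ^ Suc (Suc k) * (\<phi> x)\<^sup>2)
          = 2 * real (Suc k) * (x \<bullet> x) * ?q x ^ Suc (Suc k) * (\<phi> x)\<^sup>2"
        unfolding xx[symmetric] by (simp only: sum_distrib_left sum_distrib_right)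
      finally show ?thesis by (simp only: sum_distrib_left sum_constant)
    qed
    have "(x \<bullet> x) * ?q x ^ Suc (Suc k) = ((x \<bullet> x) * ?q x) * ?r" by simp
    also have "\<dots> \<le> 1 * ?r" by (intro mult_right_mono q r0)
    finally have "2 * real (Suc k) * (\<phi> x)\<^sup>2 * ((x \<bullet> x) * ?q x ^ Suc (Suc k)) \<le> 2 * real (Suc k) * (\<phi> x)\<^sup>2 * ?r"
      by (intro mult_left_mono) auto
    then have 1: "2 * real (Suc k) * (x \<bullet> x) * ?q x ^ Suc (Suc k) * (\<phi> x)\<^sup>2 \<le> 2 * real (Suc k) * (?r * (\<phi> x)\<^sup>2)"
      by (simp only: ac_simps)
    \<comment> \<open>Strict inequality between integers leaves a margin of at least 1 in the
      coefficient of the weighted square of \<phi>.\<close>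
    have "2 * real (Suc k) + 1 \<le> ?N" using k by linarith
    then have 2: "(2 * real (Suc k) + 1) * (?r * (\<phi> x)\<^sup>2) \<le> ?N * (?r * (\<phi> x)\<^sup>2)"
      by (intro mult_right_mono mult_nonneg_nonneg r0) auto
    \<comment> \<open>This square absorbs the mixed term at the price of half of that margin and of
      \<open>2 * ?r * ?S\<^sup>2\<close>; the remaining half and this factor 2 produce the constant
      4.\<close>
    have "0 \<le> ?r * (\<phi> x + 2 * ?S)\<^sup>2 / 2" using r0 by simp
    also have "?r * (\<phi> x + 2 * ?S)\<^sup>2 / 2 = 1 / 2 * (?r * (\<phi> x)\<^sup>2) + 2 * ?r * \<phi> x * ?S + 2 * (?r * ?S\<^sup>2)"
      by (simp add: power2_eq_square algebra_simps)
    finally have 3: "0 \<le> 1 / 2 * (?r * (\<phi> x)\<^sup>2) + 2 * ?r * \<phi> x * ?S + 2 * (?r * ?S\<^sup>2)" .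
    have "?S\<^sup>2 \<le> (\<Sum>b\<in>Basis. (x \<bullet> b)\<^sup>2) * ?D" by (rule Cauchy_Schwarz_ineq_sum)
    then have "?r * ?S\<^sup>2 \<le> ?r * ((x \<bullet> x) * ?D)" unfolding xx by (rule mult_left_mono[OF _ r0(1)])
    \<comment> \<open>The factor |x|^2 from Cauchy-Schwarz consumes one power of the weight, so the
      gradient term carries the exponent k.\<close>
    also have "\<dots> = (x \<bullet> x * ?q x) * (?q x ^ k * ?D)" by simp
    also have "\<dots> \<le> 1 * (?q x ^ k * ?D)"
      by (intro mult_right_mono q mult_nonneg_nonneg r0 sum_nonneg) auto
    also have "1 * (?q x ^ k * ?D) = ?G x" by (simp only: sum_distrib_left mult_1)
    finally have 4: "?r * ?S\<^sup>2 \<le> ?G x" .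
    have 5: "(2 * real (Suc k) + 1) * (?r * (\<phi> x)\<^sup>2) = 2 * real (Suc k) * (?r * (\<phi> x)\<^sup>2) + ?r * (\<phi> x)\<^sup>2"
      by (simp only: distrib_right mult_1)
    show ?thesis unfolding A using 1 2 3 4 5 by linarith
  qed
  have "(\<integral>x. 1 / 2 * (?q x ^ Suc k * (\<phi> x)\<^sup>2) \<partial>lebesgue) \<le> (\<integral>x. ?A x + 2 * ?G x \<partial>lebesgue)"
  proof (rule integral_mono)
    show "integrable lebesgue (\<lambda>x. 1 / 2 * (?q x ^ Suc k * (\<phi> x)\<^sup>2))" by (intro integrable_mult_right i2)
    show "integrable lebesgue (\<lambda>x. ?A x + 2 * ?G x)" by (intro Bochner_Integration.integrable_add i1 integrable_mult_right i4)
  qed (rule pw)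
  also have "\<dots> = (\<integral>x. ?A x \<partial>lebesgue) + 2 * (\<integral>x. ?G x \<partial>lebesgue)"
    by (subst Bochner_Integration.integral_add[OF i1 integrable_mult_right[OF i4]]) (simp only: integral_mult_right_zero)
  also have "(\<integral>x. ?G x \<partial>lebesgue) = (\<Sum>b\<in>Basis. \<integral>x. ?q x ^ k * (partial b \<phi> x)\<^sup>2 \<partial>lebesgue)"
    using i3 by (intro Bochner_Integration.integral_sum)
  finally show ?thesis unfolding A0 integral_mult_right_zero by linarith
qed

text \<open>Each application of the weighted inequality lowers the exponent of the weight by one and
  raises the order of differentiation by one, so \<open>n\<close> and \<open>bs\<close> vary in the
  induction. It costs the Hardy constant 4 times the number of directions. At exponent 0 the order
  is n + j, where the energy takes over.\<close>

lemma iterated_hardy: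
  fixes \<phi> :: "'a::euclidean_space \<Rightarrow> real"
  assumes \<phi>: "\<phi> \<in> test_functions U" and bs: "bs \<in> basis_lists n" and m: "2 * (n + j) < DIM('a)"
  shows "(\<integral>x. hardy_weight x ^ j * (partials bs \<phi> x)\<^sup>2 \<partial>lebesgue)
    \<le> (4 * real DIM('a)) ^ j * (enorm (n + j) UNIV \<phi>)\<^sup>2"
  using bs m
proof (induction j arbitrary: n bs)
  case 0
  then show ?case using l2norm_partials_le_enorm[OF \<phi>, of bs n] by simp
next
  case (Suc j)
  have bs: "bs \<in> lists Basis" using Suc.prems by (simp add: basis_lists_def)
  let ?K = "(4 * real DIM('a)) ^ j * (enorm (n + Suc j) UNIV \<phi>)\<^sup>2"
  have "(\<integral>x. hardy_weight x ^ Suc j * (partials bs \<phi> x)\<^sup>2 \<partial>lebesgue)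
    \<le> 4 * (\<Sum>b\<in>Basis. \<integral>x. hardy_weight x ^ j * (partial b (partials bs \<phi>) x)\<^sup>2 \<partial>lebesgue)"
    by (rule weighted_hardy[OF test_functions_partials[OF \<phi> bs]]) (use Suc.prems in simp)
  also have "\<dots> \<le> 4 * (\<Sum>b\<in>(Basis :: 'a set). ?K)"
  proof (intro mult_left_mono sum_mono)
    fix b :: 'a assume "b \<in> Basis"
    then have "b # bs \<in> basis_lists (Suc n)" using Suc.prems by (auto simp: basis_lists_def)
    from Suc.IH[OF this] Suc.prems
    show "(\<integral>x. hardy_weight x ^ j * (partial b (partials bs \<phi>) x)\<^sup>2 \<partial>lebesgue) \<le> ?K"
      by (simp add: partials_Cons)
  qed simp
  also have "\<dots> = (4 * real DIM('a)) ^ Suc j * (enorm (n + Suc j) UNIV \<phi>)\<^sup>2" by simp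
  finally show ?case .
qed

text \<open>Applied to differences, this makes all derivatives up to order m of an energy Cauchy
  sequence Cauchy in weighted L^2; the exponent is 0 at order m, so the top order has no
  weight.\<close>

lemma weighted_partials_le_enorm:
  fixes \<phi> :: "'a::euclidean_space \<Rightarrow> real"
  assumes \<phi>: "\<phi> \<in> test_functions U" and bs: "bs \<in> lists Basis" "length bs \<le> m" and m: "2 * m < DIM('a)"
  shows "l2norm lebesgue (\<lambda>x. hardy_weight x ^ (m - length bs) * partials bs \<phi> x)
    \<le> sqrt ((4 * real DIM('a)) ^ (m - length bs)) * enorm m UNIV \<phi>"
proof -
  let ?j = "m - length bs" and ?q = "hardy_weight :: 'a \<Rightarrow> real"
  have t: "partials bs \<phi> \<in> test_functions U" by (rule test_functions_partials[OF \<phi> bs(1)])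
  have sq: "smooth (\<lambda>x. ?q x ^ n)" for n by (intro smooth_power smooth_hardy_weight)
  have "(l2norm lebesgue (\<lambda>x. ?q x ^ ?j * partials bs \<phi> x))\<^sup>2 = (\<integral>x. (?q x ^ ?j)\<^sup>2 * (partials bs \<phi> x)\<^sup>2 \<partial>lebesgue)"
    by (simp add: l2norm_power2 power_mult_distrib abs_mult)
  \<comment> \<open>The L^2 norm squares the weight; as the weight is at most 1, its square is
    bounded by the weight in the Hardy inequality.\<close>
  also have "\<dots> \<le> (\<integral>x. ?q x ^ ?j * (partials bs \<phi> x)\<^sup>2 \<partial>lebesgue)"
  proof (rule integral_mono)
    show "integrable lebesgue (\<lambda>x. (?q x ^ ?j)\<^sup>2 * (partials bs \<phi> x)\<^sup>2)"
      "integrable lebesgue (\<lambda>x. ?q x ^ ?j * (partials bs \<phi> x)\<^sup>2)"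
      unfolding power2_eq_square
      by (intro test_functions_integrable[of _ U] test_functions_mult smooth_mult sq t test_functions_smooth[OF t])+
    fix x
    have "(?q x ^ ?j)\<^sup>2 \<le> ?q x ^ ?j"
      unfolding power2_eq_square using hardy_weight_bounds[of x]
      by (intro mult_left_le_one_le) (auto intro: power_le_one less_imp_le)
    then show "(?q x ^ ?j)\<^sup>2 * (partials bs \<phi> x)\<^sup>2 \<le> ?q x ^ ?j * (partials bs \<phi> x)\<^sup>2" by (intro mult_right_mono) auto
  qed
  also have "\<dots> \<le> (4 * real DIM('a)) ^ ?j * (enorm m UNIV \<phi>)\<^sup>2"
    using iterated_hardy[OF \<phi>, of bs "length bs" ?j] bs m by (simp add: basis_lists_def)
  finally have "l2norm lebesgue (\<lambda>x. ?q x ^ ?j * partials bs \<phi> x) \<le> sqrt ((4 * real DIM('a)) ^ ?j * (enorm m UNIV \<phi>)\<^sup>2)"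
    by (rule real_le_rsqrt)
  then show ?thesis unfolding real_sqrt_mult by simp
qed

subsection \<open>The homogeneous Sobolev space\<close>

lemma Lp_UNIV_iff: "f \<in> Lp p UNIV \<longleftrightarrow> f \<in> borel_measurable lebesgue \<and> integrable lebesgue (\<lambda>x. \<bar>f x\<bar> powr p)"
  by (simp add: Lp_def lebesgue_on_UNIV_eq)

lemma test_functions_Lp:
  assumes "\<phi> \<in> test_functions U" "p > 0"
  shows "\<phi> \<in> Lp p UNIV"
proof -
  have s: "smooth \<phi>" by (rule test_functions_smooth[OF assms(1)])
  obtain C where C: "compact C" "\<And>x. x \<notin> C \<Longrightarrow> \<phi> x = 0" by (rule test_functionsE[OF assms(1)]) blast
  have "integrable lebesgue (\<lambda>x. \<bar>\<phi> x\<bar> powr p)"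
  proof (rule integrable_lebesgue_compact_support[OF _ C(1)])
    show "continuous_on UNIV (\<lambda>x. \<bar>\<phi> x\<bar> powr p)"
      using assms(2) by (intro continuous_on_powr' continuous_intros smooth_continuous_on s) auto
  qed (simp add: C(2))
  then show ?thesis by (simp add: Lp_UNIV_iff smooth_measurable_lebesgue[OF s])
qed

lemma Lp_diff:
  assumes f: "f \<in> Lp p UNIV" and g: "g \<in> Lp p UNIV" and p: "p > 0"
  shows "(\<lambda>x. f x - g x) \<in> Lp p UNIV"
proof -
  have m: "f \<in> borel_measurable lebesgue" "g \<in> borel_measurable lebesgue" using f g by (auto simp: Lp_UNIV_iff)
  have b: "\<bar>a - b\<bar> powr p \<le> 2 powr p * (\<bar>a\<bar> powr p + \<bar>b\<bar> powr p)" for a b :: real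
  proof -
    have "\<bar>a - b\<bar> powr p \<le> (2 * max \<bar>a\<bar> \<bar>b\<bar>) powr p" using p by (intro powr_mono2) auto
    also have "\<dots> = 2 powr p * max \<bar>a\<bar> \<bar>b\<bar> powr p" by (simp add: powr_mult)
    also have "max \<bar>a\<bar> \<bar>b\<bar> powr p \<le> \<bar>a\<bar> powr p + \<bar>b\<bar> powr p" by (simp add: max_def)
    finally show ?thesis by simp
  qed
  have "integrable lebesgue (\<lambda>x. \<bar>f x - g x\<bar> powr p)"
  proof (rule Bochner_Integration.integrable_bound)
    show "integrable lebesgue (\<lambda>x. 2 powr p * (\<bar>f x\<bar> powr p + \<bar>g x\<bar> powr p))"
      using f g by (auto simp: Lp_UNIV_iff)
    show "(\<lambda>x. \<bar>f x - g x\<bar> powr p) \<in> borel_measurable lebesgue" using m by measurable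
    show "AE x in lebesgue. norm (\<bar>f x - g x\<bar> powr p) \<le> norm (2 powr p * (\<bar>f x\<bar> powr p + \<bar>g x\<bar> powr p))"
      using b by (intro AE_I2) simp
  qed
  then show ?thesis using m by (simp add: Lp_UNIV_iff)
qed

text \<open>A splitting at height \<delta>: above it, \<open>\<bar>h\<bar> powr (1 - p)\<close> is
  at most \<open>\<delta> powr (1 - p)\<close>. Integrated over a compact set, it plays the part of
  Hoelder's inequality.\<close>

lemma abs_le_powr:
  fixes h \<delta> p :: real
  assumes "\<delta> > 0" "p \<ge> 1"
  shows "\<bar>h\<bar> \<le> \<delta> + \<delta> powr (1 - p) * \<bar>h\<bar> powr p"
proof (cases "\<bar>h\<bar> \<le> \<delta>")
  case False
  then have h: "\<bar>h\<bar> > 0" "\<delta> \<le> \<bar>h\<bar>" using assms by auto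
  have "\<bar>h\<bar> = \<bar>h\<bar> powr (1 - p) * \<bar>h\<bar> powr p" using h(1) by (simp flip: powr_add)
  also have "\<dots> \<le> \<delta> powr (1 - p) * \<bar>h\<bar> powr p"
    using assms h by (intro mult_right_mono powr_mono2') auto
  finally show ?thesis using assms by simp
qed (simp add: add_increasing2)

lemma Lp_l1_bound:
  fixes h :: "'a::euclidean_space \<Rightarrow> real"
  assumes h: "h \<in> Lp p UNIV" and p: "p \<ge> 1" and C: "compact C" and \<delta>: "\<delta> > 0"
  shows "integrable (lebesgue_on C) h"
    and "(\<integral>x. \<bar>h x\<bar> \<partial>lebesgue_on C) \<le> \<delta> * measure lebesgue C + \<delta> powr (1 - p) * (\<integral>x. \<bar>h x\<bar> powr p \<partial>lebesgue)"
proof -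
  have Cs: "C \<in> sets lebesgue" by (rule sets_lebesgue_compact[OF C])
  have O: "C \<inter> space lebesgue \<in> sets lebesgue" using Cs by simp
  have hm: "h \<in> borel_measurable lebesgue" and hi: "integrable lebesgue (\<lambda>x. \<bar>h x\<bar> powr p)"
    using h by (auto simp: Lp_UNIV_iff)
  have j: "integrable lebesgue (\<lambda>x. indicator C x *\<^sub>R \<bar>h x\<bar> powr p)" by (rule integrable_mult_indicator[OF Cs hi])
  then have i1: "integrable (lebesgue_on C) (\<lambda>x. \<bar>h x\<bar> powr p)" unfolding integrable_restrict_space[OF O] .
  have i2: "integrable (lebesgue_on C) (\<lambda>_. \<delta>)"
    by (rule finite_measure.integrable_const[OF finite_measure_lebesgue_on[OF lmeasurable_compact[OF C]]])
  have i3: "integrable (lebesgue_on C) (\<lambda>x. \<delta> + \<delta> powr (1 - p) * \<bar>h x\<bar> powr p)"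
    by (intro Bochner_Integration.integrable_add i2 integrable_mult_right i1)
  show hC: "integrable (lebesgue_on C) h"
  proof (rule Bochner_Integration.integrable_bound[OF i3])
    show "h \<in> borel_measurable (lebesgue_on C)" by (rule measurable_restrict_space1[OF hm])
    show "AE x in lebesgue_on C. norm (h x) \<le> norm (\<delta> + \<delta> powr (1 - p) * \<bar>h x\<bar> powr p)"
      using abs_le_powr[OF \<delta> p] \<delta> by (intro AE_I2) simp
  qed
  have "(\<integral>x. \<bar>h x\<bar> \<partial>lebesgue_on C) \<le> (\<integral>x. \<delta> + \<delta> powr (1 - p) * \<bar>h x\<bar> powr p \<partial>lebesgue_on C)"
    using hC i3 abs_le_powr[OF \<delta> p] by (intro integral_mono) auto
  also have "\<dots> = \<delta> * measure lebesgue C + \<delta> powr (1 - p) * (\<integral>x. \<bar>h x\<bar> powr p \<partial>lebesgue_on C)"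
    using i1 i2 Cs by (simp add: measure_restrict_space mult.commute)
  also have "(\<integral>x. \<bar>h x\<bar> powr p \<partial>lebesgue_on C) \<le> (\<integral>x. \<bar>h x\<bar> powr p \<partial>lebesgue)"
    unfolding integral_restrict_space[OF O] by (rule integral_mono[OF j hi]) (auto simp: indicator_def)
  finally show "(\<integral>x. \<bar>h x\<bar> \<partial>lebesgue_on C) \<le> \<delta> * measure lebesgue C + \<delta> powr (1 - p) * (\<integral>x. \<bar>h x\<bar> powr p \<partial>lebesgue)"
    by (simp add: mult_left_mono)
qed

lemma Lp_tendsto_l1:
  fixes h :: "nat \<Rightarrow> 'a::euclidean_space \<Rightarrow> real"
  assumes h: "\<And>n. h n \<in> Lp p UNIV" and p: "p \<ge> 1" and C: "compact C"
    and lim: "(\<lambda>n. Lp_norm p UNIV (h n)) \<longlonglongrightarrow> 0"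
  shows "(\<lambda>n. \<integral>x. \<bar>h n x\<bar> \<partial>lebesgue_on C) \<longlonglongrightarrow> 0"
proof (rule LIMSEQ_I)
  fix e :: real assume e: "e > 0"
  let ?I = "\<lambda>n. \<integral>x. \<bar>h n x\<bar> powr p \<partial>lebesgue"
  have "(Lp_norm p UNIV (h n)) powr p = ?I n" for n
    using p by (simp add: Lp_norm_def lebesgue_on_UNIV_eq powr_powr)
  moreover have "(\<lambda>n. (Lp_norm p UNIV (h n)) powr p) \<longlonglongrightarrow> 0"
    by (rule tendsto_zero_powrI[OF lim tendsto_const]) (use p in \<open>auto simp: Lp_norm_def\<close>)
  ultimately have I0: "?I \<longlonglongrightarrow> 0" by simp
  \<comment> \<open>Half of \<open>e\<close> is reserved for the constant part over
    \<open>C\<close>; the added 1 covers sets of measure zero.\<close>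
  define \<delta> where "\<delta> = e / (2 * (measure lebesgue C + 1))"
  have \<delta>: "\<delta> > 0" using e by (simp add: \<delta>_def add_nonneg_pos)
  have "\<delta> * measure lebesgue C < \<delta> * (measure lebesgue C + 1)" using \<delta> by simp
  also have "\<dots> = e / 2" by (simp add: \<delta>_def field_simps add_nonneg_eq_0_iff)
  finally have d: "\<delta> * measure lebesgue C < e / 2" .
  have "(\<lambda>n. \<delta> powr (1 - p) * ?I n) \<longlonglongrightarrow> 0" by (rule tendsto_mult_right_zero[OF I0])
  then have "\<forall>\<^sub>F n in sequentially. \<delta> powr (1 - p) * ?I n < e / 2" using e by (intro order_tendstoD) auto
  then obtain N where N: "\<And>n. n \<ge> N \<Longrightarrow> \<delta> powr (1 - p) * ?I n < e / 2" by (auto simp: eventually_sequentially)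
  have "norm ((\<integral>x. \<bar>h n x\<bar> \<partial>lebesgue_on C) - 0) < e" if "n \<ge> N" for n
    using Lp_l1_bound(2)[OF h p C \<delta>, of n] N[OF that] d by simp
  then show "\<exists>no. \<forall>n\<ge>no. norm ((\<integral>x. \<bar>h n x\<bar> \<partial>lebesgue_on C) - 0) < e" by blast
qed

text \<open>The defining sequence converges in L^p, hence in L^1 on compact sets, and the Hardy
  estimate makes its weighted derivatives Cauchy in L^2; \<open>weak_partials_limit\<close> then
  produces the derivatives of f. The weight is trivial at order m, so those derivatives are square
  integrable.\<close>

lemma homogeneous_sobolev_finite_energy:
  fixes f :: "'a::euclidean_space \<Rightarrow> real"
  assumes f: "f \<in> homogeneous_sobolev m" and m: "2 * m < DIM('a)"
  shows "finite_energy m UNIV f"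
proof -
  define p where "p = 2 * real DIM('a) / (real DIM('a) - 2 * real m)"
  have "real DIM('a) - 2 * real m > 0" using m by linarith
  then have p: "p \<ge> 1" unfolding p_def by (simp add: field_simps)
  obtain \<phi> where fL: "f \<in> Lp p UNIV" and \<phi>: "\<And>n::nat. \<phi> n \<in> test_functions UNIV"
    and cau: "\<And>e. e > 0 \<Longrightarrow> \<exists>M. \<forall>j\<ge>M. \<forall>k\<ge>M. energy_norm m (\<lambda>x. \<phi> j x - \<phi> k x) < e"
    and lim: "(\<lambda>n. Lp_norm p UNIV (\<lambda>x. \<phi> n x - f x)) \<longlonglongrightarrow> 0"
    using f unfolding homogeneous_sobolev_def Let_def p_def[symmetric] by blast
  let ?q = "hardy_weight :: 'a \<Rightarrow> real"
  have \<phi>s: "smooth (\<phi> n)" for n by (rule test_functions_smooth[OF \<phi>])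
  have dL: "(\<lambda>x. \<phi> n x - f x) \<in> Lp p UNIV" for n
    using p by (intro Lp_diff fL test_functions_Lp[OF \<phi>]) auto
  have lf: "locally_integrable UNIV f"
    unfolding locally_integrable_def using Lp_l1_bound(1)[OF fL p _ zero_less_one] by blast
  have key: "\<exists>g. has_weak_partials UNIV bs f g \<and> square_integrable (lebesgue_on UNIV) (\<lambda>x. ?q x ^ (m - length bs) * g x)"
    if bs: "bs \<in> lists Basis" "length bs \<le> m" for bs
  proof -
    let ?w = "\<lambda>x. ?q x ^ (m - length bs)" and ?K = "sqrt ((4 * real DIM('a)) ^ (m - length bs))"
    have ws: "smooth ?w" by (intro smooth_power smooth_hardy_weight)
    have w0: "?w x \<noteq> 0" for x using hardy_weight_bounds(1)[of x] by simp
    have K: "?K > 0" by simp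
    have sq: "square_integrable (lebesgue_on UNIV) (\<lambda>x. ?w x * partials bs (\<phi> n) x)" for n
      by (intro test_functions_square_integrable[of _ UNIV] test_functions_mult test_functions_partials[OF \<phi> bs(1)] ws) simp
    have c: "\<exists>N. \<forall>i\<ge>N. \<forall>j\<ge>N.
      l2norm (lebesgue_on UNIV) (\<lambda>x. ?w x * partials bs (\<phi> i) x - ?w x * partials bs (\<phi> j) x) < e" if e: "e > 0" for e
    proof -
      obtain M where M: "\<forall>j\<ge>M. \<forall>k\<ge>M. energy_norm m (\<lambda>x. \<phi> j x - \<phi> k x) < e / ?K"
        using cau[of "e / ?K"] e K by auto
      show ?thesis
      proof (intro exI[of _ M] allI impI)
        fix i j assume ij: "M \<le> i" "M \<le> j"
        have t: "(\<lambda>x. \<phi> i x - \<phi> j x) \<in> test_functions UNIV" by (rule test_functions_diff[OF \<phi> \<phi>])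
        have "(\<lambda>x. ?w x * partials bs (\<phi> i) x - ?w x * partials bs (\<phi> j) x) = (\<lambda>x. ?w x * partials bs (\<lambda>x. \<phi> i x - \<phi> j x) x)"
          by (simp add: partials_diff \<phi>s bs right_diff_distrib)
        then have "l2norm (lebesgue_on UNIV) (\<lambda>x. ?w x * partials bs (\<phi> i) x - ?w x * partials bs (\<phi> j) x)
          \<le> ?K * enorm m UNIV (\<lambda>x. \<phi> i x - \<phi> j x)"
          using weighted_partials_le_enorm[OF t bs m] by (simp add: lebesgue_on_UNIV_eq)
        also have "\<dots> < ?K * (e / ?K)" using M ij K by (intro mult_strict_left_mono) (auto simp: energy_norm_eq)
        finally show "l2norm (lebesgue_on UNIV) (\<lambda>x. ?w x * partials bs (\<phi> i) x - ?w x * partials bs (\<phi> j) x) < e"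
          using K by simp
      qed
    qed
    show ?thesis
      by (rule weak_partials_limit[OF open_UNIV bs(1) \<phi>s lf Lp_tendsto_l1[OF dL p _ lim] ws w0 sq c]) blast+
  qed
  have wd: "weakly_diff m UNIV f" unfolding weakly_diff_def using key by blast
  have "square_integrable (lebesgue_on UNIV) (weak_partials UNIV bs f)" if "bs \<in> basis_lists m" for bs
  proof -
    have bs: "bs \<in> lists Basis" "length bs \<le> m" "length bs = m" using that by (auto simp: basis_lists_def)
    obtain g where g: "has_weak_partials UNIV bs f g" "square_integrable (lebesgue_on UNIV) g"
      using key[OF bs(1,2)] bs(3) by auto
    show ?thesis
      using square_integrable_cong_AE[OF locally_integrable_measurable[OF open_UNIV weak_partials_locally_integrable[OF wd bs(1,2)]]
          square_integrable_measurable[OF g(2)] weak_partials_AE_unique[OF open_UNIV g(1)]] g(2) by blast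
  qed
  with wd show ?thesis by (rule_tac enorm_bound[OF open_UNIV, of m]) blast
qed

lemma test_functions_homogeneous_sobolev:
  fixes \<phi> :: "'a::euclidean_space \<Rightarrow> real"
  assumes \<phi>: "\<phi> \<in> test_functions U" and m: "2 * m < DIM('a)"
  shows "\<phi> \<in> homogeneous_sobolev m"
proof -
  have "real DIM('a) - 2 * real m > 0" using m by linarith
  then have p: "2 * real DIM('a) / (real DIM('a) - 2 * real m) > 0" by simp
  have z: "Lp_norm q UNIV (\<lambda>_::'a. 0) = 0" for q by (simp add: Lp_norm_def)
  show ?thesis
    unfolding homogeneous_sobolev_def Let_def mem_Collect_eq
    using test_functions_Lp[OF \<phi> p] test_functions_UNIV[OF \<phi>]
    by (intro conjI exI[of _ "\<lambda>_. \<phi>"]) (auto simp: energy_norm_eq enorm_zero z)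
qed

lemma test_functions_homogeneous_sobolev0:
  fixes \<phi> :: "'a::euclidean_space \<Rightarrow> real"
  assumes "\<phi> \<in> test_functions U" "2 * m < DIM('a)"
  shows "\<phi> \<in> homogeneous_sobolev0 m U"
  unfolding homogeneous_sobolev0_def mem_Collect_eq
  using test_functions_homogeneous_sobolev[OF assms] assms(1)
  by (intro conjI exI[of _ "\<lambda>_. \<phi>"]) (auto simp: energy_norm_eq enorm_zero)

subsection \<open>Capacities and test functions\<close>

lemma cap_space_le:
  fixes \<eta> :: "'a::euclidean_space \<Rightarrow> real"
  assumes m: "2 * m < DIM('a)" and \<eta>: "\<eta> \<in> test_functions UNIV" and u: "smooth u" and \<phi>: "\<phi> \<in> test_functions (- K)"
  shows "sqrt (cap_space m \<eta> K u) \<le> enorm m UNIV (\<lambda>x. \<eta> x * u x + \<phi> x)"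
proof -
  let ?f = "\<lambda>x. \<eta> x * u x + \<phi> x"
  have t: "?f \<in> test_functions UNIV"
    using test_functions_mult[OF \<eta> u] by (intro test_functions_add test_functions_UNIV[OF \<phi>]) (simp add: mult.commute)
  have "?f \<in> homogeneous_sobolev m" by (rule test_functions_homogeneous_sobolev[OF t m])
  moreover have "(\<lambda>x. ?f x - \<eta> x * u x) \<in> homogeneous_sobolev0 m (- K)"
    using test_functions_homogeneous_sobolev0[OF \<phi> m] by simp
  ultimately have "cap_space m \<eta> K u \<le> energy m UNIV ?f"
    unfolding cap_space_def
    by (intro cInf_lower) (auto simp: energy_eq intro!: bdd_belowI[of _ 0])
  then show ?thesis unfolding energy_eq using real_sqrt_le_mono by fastforce
qed

lemma sqrt_Inf_approx:
  fixes S :: "real set"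
  assumes "S \<noteq> {}" "\<And>s. s \<in> S \<Longrightarrow> 0 \<le> s" "e > 0"
  obtains s where "s \<in> S" "sqrt s < sqrt (Inf S) + e"
proof -
  have I: "0 \<le> Inf S" using assms by (intro cInf_greatest) auto
  have "(sqrt (Inf S))\<^sup>2 < (sqrt (Inf S) + e)\<^sup>2" using I assms(3) by (intro power_strict_mono) auto
  then have "Inf S < (sqrt (Inf S) + e)\<^sup>2" using I by simp
  then obtain s where s: "s \<in> S" "s < (sqrt (Inf S) + e)\<^sup>2" using cInf_lessD[OF assms(1)] by blast
  have "sqrt s < sqrt ((sqrt (Inf S) + e)\<^sup>2)" using s(2) by (rule real_sqrt_less_mono)
  with s(1) that I assms(3) show ?thesis by simp
qed

text \<open>For an almost optimal f, the difference \<open>f - \<eta> * u\<close> is replaced by a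
  test function \<phi> on the complement of \<open>K\<close>; the new competitor differs from f by
  exactly the error of that approximation.\<close>

lemma cap_space_approx:
  fixes \<eta> :: "'a::euclidean_space \<Rightarrow> real"
  assumes m: "2 * m < DIM('a)" and \<eta>: "\<eta> \<in> test_functions UNIV" and u: "smooth u" and e: "e > 0"
  obtains \<phi> where "\<phi> \<in> test_functions (- K)"
    "enorm m UNIV (\<lambda>x. \<eta> x * u x + \<phi> x) < sqrt (cap_space m \<eta> K u) + e"
proof -
  let ?g = "\<lambda>x. \<eta> x * u x"
  let ?S = "{energy m UNIV f | f. f \<in> homogeneous_sobolev m \<and> (\<lambda>x. f x - ?g x) \<in> homogeneous_sobolev0 m (- K)}"
  have g: "?g \<in> test_functions UNIV" using test_functions_mult[OF \<eta> u] by (simp add: mult.commute)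
  have zero: "(\<lambda>_. 0) \<in> test_functions (- K)" by (simp add: test_functions_iff smooth_const exI[of _ "{}"])
  have "energy m UNIV ?g \<in> ?S"
    using test_functions_homogeneous_sobolev[OF g m] test_functions_homogeneous_sobolev0[OF zero m] by auto
  then have ne: "?S \<noteq> {}" by blast
  have "e / 2 > 0" using e by simp
  moreover have "0 \<le> s" if "s \<in> ?S" for s using that by (auto simp: energy_eq)
  ultimately obtain s where s: "s \<in> ?S" "sqrt s < sqrt (Inf ?S) + e / 2"
    using sqrt_Inf_approx[OF ne] by blast
  then obtain f where f: "f \<in> homogeneous_sobolev m" "(\<lambda>x. f x - ?g x) \<in> homogeneous_sobolev0 m (- K)"
    and sf: "s = energy m UNIV f" by blast
  have ef: "enorm m UNIV f < sqrt (cap_space m \<eta> K u) + e / 2"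
    using s(2) unfolding sf energy_eq cap_space_def by simp
  obtain \<phi> where \<phi>: "\<And>n::nat. \<phi> n \<in> test_functions (- K)"
    and lim: "(\<lambda>n. energy_norm m (\<lambda>x. \<phi> n x - (f x - ?g x))) \<longlonglongrightarrow> 0"
    using f(2) unfolding homogeneous_sobolev0_def by blast
  have "\<forall>\<^sub>F n in sequentially. energy_norm m (\<lambda>x. \<phi> n x - (f x - ?g x)) < e / 2"
    using lim e by (intro order_tendstoD) auto
  then obtain n where n: "energy_norm m (\<lambda>x. \<phi> n x - (f x - ?g x)) < e / 2" by (auto simp: eventually_sequentially)
  \<comment> \<open>Here the Hardy inequality enters: without weak derivatives of f the triangle
    inequality below would not be available.\<close>
  have ff: "finite_energy m UNIV f" by (rule homogeneous_sobolev_finite_energy[OF f(1) m])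
  have fg: "finite_energy m UNIV (\<lambda>x. ?g x + \<phi> n x)"
    by (intro test_functions_finite_energy[OF open_UNIV, of _ UNIV] test_functions_add g test_functions_UNIV[OF \<phi>])
  have "enorm m UNIV (\<lambda>x. ?g x + \<phi> n x) \<le> enorm m UNIV f + enorm m UNIV (\<lambda>x. (?g x + \<phi> n x) - f x)"
    by (rule enorm_triangle_diff[OF open_UNIV fg ff])
  also have "(\<lambda>x. (?g x + \<phi> n x) - f x) = (\<lambda>x. \<phi> n x - (f x - ?g x))" by auto
  finally have "enorm m UNIV (\<lambda>x. ?g x + \<phi> n x) < sqrt (cap_space m \<eta> K u) + e"
    using ef n by (simp add: energy_norm_eq)
  with \<phi> that show ?thesis by blast
qed

section \<open>Competitors for the capacity in the domain\<close>

lemma sobolev0_sobolev_space: "f \<in> sobolev0 m \<Omega> U \<Longrightarrow> f \<in> sobolev_space m \<Omega>"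
  by (simp add: sobolev0_def)

lemma sobolev0_approx:
  assumes "f \<in> sobolev0 m \<Omega> U"
  obtains \<phi> where "\<And>n::nat. \<phi> n \<in> test_functions U" "(\<lambda>n. sob_sum m \<Omega> (\<lambda>x. \<phi> n x - f x)) \<longlonglongrightarrow> 0"
  using assms unfolding sobolev0_def sobolev_norm_tendsto_iff by blast

lemma sobolev0I:
  assumes "f \<in> sobolev_space m \<Omega>" "\<And>n::nat. \<phi> n \<in> test_functions U" "(\<lambda>n. sob_sum m \<Omega> (\<lambda>x. \<phi> n x - f x)) \<longlonglongrightarrow> 0"
  shows "f \<in> sobolev0 m \<Omega> U"
  using assms unfolding sobolev0_def sobolev_norm_tendsto_iff by blast

lemma cap_domain_le:
  assumes "f \<in> sobolev0 m \<Omega> \<Omega>" "(\<lambda>x. f x - u x) \<in> sobolev0 m \<Omega> (\<Omega> - K)"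
  shows "sqrt (cap_domain m \<Omega> K u) \<le> enorm m \<Omega> f"
proof -
  have "cap_domain m \<Omega> K u \<le> energy m \<Omega> f"
    unfolding cap_domain_def using assms
    by (intro cInf_lower) (auto simp: energy_eq intro!: bdd_belowI[of _ 0])
  then show ?thesis unfolding energy_eq using real_sqrt_le_mono by fastforce
qed

lemma sob_sum_zero:
  fixes \<Omega> :: "'a::euclidean_space set"
  assumes "open \<Omega>" shows "sob_sum m \<Omega> (\<lambda>_. 0) = 0"
  unfolding sob_sum_def
proof (rule sum.neutral, intro ballI)
  fix bs assume "bs \<in> {bs \<in> lists (Basis :: 'a set). length bs \<le> m}"
  then show "l2norm (lebesgue_on \<Omega>) (weak_partials \<Omega> bs (\<lambda>_. 0)) = 0"
    using weak_partials_smooth(2)[OF assms smooth_const, of bs 0] by (simp add: partials_zero l2norm_def)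
qed

lemma zero_sobolev0:
  assumes "open \<Omega>" shows "(\<lambda>_. 0) \<in> sobolev0 m \<Omega> U"
proof (rule sobolev0I[of _ _ _ "\<lambda>_ _. 0"])
  show t: "(\<lambda>_. 0) \<in> test_functions U" by (simp add: test_functions_iff smooth_const exI[of _ "{}"])
  show s: "(\<lambda>_. 0) \<in> sobolev_space m \<Omega>" by (rule test_functions_sobolev_space[OF assms t])
  show "(\<lambda>n. sob_sum m \<Omega> (\<lambda>x. 0 - 0)) \<longlonglongrightarrow> 0" by (simp add: sob_sum_zero[OF assms])
qed

text \<open>The function u itself is admissible, so the infimum is over a nonempty set.
  Nonnegativity is what permits returning from square roots to capacities at the end.\<close>

lemma cap_domain_nonneg:
  assumes "open \<Omega>" "u \<in> sobolev0 m \<Omega> \<Omega>"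
  shows "0 \<le> cap_domain m \<Omega> K u"
  unfolding cap_domain_def
proof (rule cInf_greatest)
  have "u \<in> sobolev0 m \<Omega> \<Omega> \<and> (\<lambda>x. u x - u x) \<in> sobolev0 m \<Omega> (\<Omega> - K)"
    using assms zero_sobolev0 by auto
  then show "{energy m \<Omega> f | f. f \<in> sobolev0 m \<Omega> \<Omega> \<and> (\<lambda>x. f x - u x) \<in> sobolev0 m \<Omega> (\<Omega> - K)} \<noteq> {}" by blast
qed (auto simp: energy_eq)

lemma cap_space_nonneg:
  fixes \<eta> :: "'a::euclidean_space \<Rightarrow> real"
  assumes m: "2 * m < DIM('a)" and \<eta>: "\<eta> \<in> test_functions UNIV" and u: "smooth u"
  shows "0 \<le> cap_space m \<eta> K u"
  unfolding cap_space_def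
proof (rule cInf_greatest)
  have g: "(\<lambda>x. \<eta> x * u x) \<in> test_functions UNIV" using test_functions_mult[OF \<eta> u] by (simp add: mult.commute)
  have zero: "(\<lambda>_. 0) \<in> test_functions (- K)" by (simp add: test_functions_iff smooth_const exI[of _ "{}"])
  have "(\<lambda>x. \<eta> x * u x) \<in> homogeneous_sobolev m \<and> (\<lambda>x. \<eta> x * u x - \<eta> x * u x) \<in> homogeneous_sobolev0 m (- K)"
    using test_functions_homogeneous_sobolev[OF g m] test_functions_homogeneous_sobolev0[OF zero m] by simp
  then show "{energy m UNIV f | f. f \<in> homogeneous_sobolev m \<and> (\<lambda>x. f x - \<eta> x * u x) \<in> homogeneous_sobolev0 m (- K)} \<noteq> {}"
    by blast
qed (auto simp: energy_eq)

text \<open>Two independent approximations: \<open>v\<close> of u, and \<psi> of the difference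
  between an almost optimal f and u. They are kept apart because only \<open>v\<close> is compared
  with the limiting polynomial, while \<psi> must vanish near \<open>K\<close>.\<close>

lemma cap_domain_approx:
  assumes \<Omega>: "open \<Omega>" and u: "u \<in> sobolev0 m \<Omega> \<Omega>" and e: "e > 0"
  obtains v \<psi> where "v \<in> test_functions \<Omega>" "\<psi> \<in> test_functions (\<Omega> - K)" "sob_sum m \<Omega> (\<lambda>x. v x - u x) < e"
    "enorm m \<Omega> (\<lambda>x. v x + \<psi> x) < sqrt (cap_domain m \<Omega> K u) + e"
proof -
  let ?S = "{energy m \<Omega> f | f. f \<in> sobolev0 m \<Omega> \<Omega> \<and> (\<lambda>x. f x - u x) \<in> sobolev0 m \<Omega> (\<Omega> - K)}"
  have "u \<in> sobolev0 m \<Omega> \<Omega> \<and> (\<lambda>x. u x - u x) \<in> sobolev0 m \<Omega> (\<Omega> - K)"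
    using u zero_sobolev0[OF \<Omega>] by auto
  then have ne: "?S \<noteq> {}" by blast
  have "e / 2 > 0" using e by simp
  moreover have "0 \<le> s" if "s \<in> ?S" for s using that by (auto simp: energy_eq)
  ultimately obtain s where s: "s \<in> ?S" "sqrt s < sqrt (Inf ?S) + e / 2"
    using sqrt_Inf_approx[OF ne] by blast
  then obtain f where f: "f \<in> sobolev0 m \<Omega> \<Omega>" "(\<lambda>x. f x - u x) \<in> sobolev0 m \<Omega> (\<Omega> - K)"
    and sf: "s = energy m \<Omega> f" by blast
  have ef: "enorm m \<Omega> f < sqrt (cap_domain m \<Omega> K u) + e / 2"
    using s(2) unfolding sf energy_eq cap_domain_def by simp
  obtain C where C: "C \<ge> 0" "\<And>f. f \<in> sobolev_space m \<Omega> \<Longrightarrow> finite_energy m \<Omega> f \<and> enorm m \<Omega> f \<le> C * sob_sum m \<Omega> f"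
    by (rule sobolev_enorm_bound[OF \<Omega>, of m]) blast
  obtain v where v: "\<And>n::nat. v n \<in> test_functions \<Omega>" "(\<lambda>n. sob_sum m \<Omega> (\<lambda>x. v n x - u x)) \<longlonglongrightarrow> 0"
    by (rule sobolev0_approx[OF u]) blast
  obtain \<psi> where \<psi>: "\<And>n::nat. \<psi> n \<in> test_functions (\<Omega> - K)" "(\<lambda>n. sob_sum m \<Omega> (\<lambda>x. \<psi> n x - (f x - u x))) \<longlonglongrightarrow> 0"
    by (rule sobolev0_approx[OF f(2)]) blast
  let ?d = "\<lambda>n. C * (sob_sum m \<Omega> (\<lambda>x. v n x - u x) + sob_sum m \<Omega> (\<lambda>x. \<psi> n x - (f x - u x)))"
  have "?d \<longlonglongrightarrow> C * (0 + 0)" by (intro tendsto_intros v \<psi>)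
  then have "\<forall>\<^sub>F n in sequentially. ?d n < e / 2" using e by (intro order_tendstoD) auto
  moreover have "\<forall>\<^sub>F n in sequentially. sob_sum m \<Omega> (\<lambda>x. v n x - u x) < e" using v(2) e by (intro order_tendstoD) auto
  ultimately have "\<forall>\<^sub>F n in sequentially. ?d n < e / 2 \<and> sob_sum m \<Omega> (\<lambda>x. v n x - u x) < e" by eventually_elim simp
  then obtain n where n: "?d n < e / 2" "sob_sum m \<Omega> (\<lambda>x. v n x - u x) < e" by (auto simp: eventually_sequentially)
  note us = sobolev0_sobolev_space[OF u] and fs = sobolev0_sobolev_space[OF f(1)] and fus = sobolev0_sobolev_space[OF f(2)]
  note vs = test_functions_sobolev_space[OF \<Omega> v(1)[of n], of m] and \<psi>s = test_functions_sobolev_space[OF \<Omega> \<psi>(1)[of n], of m]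
  have d1: "(\<lambda>x. v n x - u x) \<in> sobolev_space m \<Omega>" and d2: "(\<lambda>x. \<psi> n x - (f x - u x)) \<in> sobolev_space m \<Omega>"
    by (intro sobolev_space_diff(1) \<Omega> vs us \<psi>s fus)+
  have vp: "(\<lambda>x. v n x + \<psi> n x) \<in> sobolev_space m \<Omega>" by (intro sobolev_space_add(1) \<Omega> vs \<psi>s)
  have d12: "(\<lambda>x. v n x + \<psi> n x - f x) = (\<lambda>x. (v n x - u x) + (\<psi> n x - (f x - u x)))" by auto
  have "enorm m \<Omega> (\<lambda>x. v n x + \<psi> n x) \<le> enorm m \<Omega> f + enorm m \<Omega> (\<lambda>x. v n x + \<psi> n x - f x)"
    using C(2) vp fs by (intro enorm_triangle_diff \<Omega>) auto
  also have "enorm m \<Omega> (\<lambda>x. v n x + \<psi> n x - f x) \<le> C * sob_sum m \<Omega> (\<lambda>x. (v n x - u x) + (\<psi> n x - (f x - u x)))"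
    unfolding d12 using C(2)[OF sobolev_space_add(1)[OF \<Omega> d1 d2]] by blast
  also have "\<dots> \<le> ?d n" by (intro mult_left_mono C(1) sobolev_space_add(2) \<Omega> d1 d2)
  finally have "enorm m \<Omega> (\<lambda>x. v n x + \<psi> n x) < sqrt (cap_domain m \<Omega> K u) + e" using ef n(1) by simp
  with v(1) \<psi>(1) n(2) that show ?thesis by blast
qed

subsection \<open>Comparison of the two capacities at scale \<open>\<epsilon>\<close>\<close>

lemma smooth_square_integrable_bounded:
  assumes h: "smooth h" and B: "bounded B" "open B"
  shows "square_integrable (lebesgue_on B) h"
proof -
  have c: "compact (closure B)" using B by (simp add: compact_closure)
  have s2: "smooth (\<lambda>x. h x * h x)" by (intro smooth_mult h)
  have "square_integrable (lebesgue_on (closure B)) h"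
    unfolding square_integrable_def
    using smooth_measurable_lebesgue_on[OF h sets_lebesgue_compact[OF c]]
      locally_integrableD[OF locally_integrable_smooth[OF s2] c subset_refl]
    by (simp add: power2_eq_square)
  then show ?thesis
    by (rule square_integrable_restrict(1)[OF _ closure_subset sets_lebesgue_open[OF B(2)] sets_lebesgue_compact[OF c]])
qed

lemma smooth_sobolev_space_bounded:
  assumes h: "smooth h" and B: "bounded B" "open B"
  shows "h \<in> sobolev_space m B"
  unfolding sobolev_space_iff[OF B(2)]
  using weak_partials_smooth(3)[OF B(2) h] smooth_square_integrable_bounded[OF smooth_partials[OF h] B]
  by (auto intro: weakly_diff_smooth[OF B(2) h])

text \<open>The support of \<eta> lies in \<open>B\<close>, so the energy localises there and the
  Leibniz bound applies. This converts blow-up convergence in the Sobolev norm on \<open>B\<close>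
  into smallness of the energy of \<eta> times the error, uniformly in the error.\<close>

lemma enorm_mult_cutoff_bound:
  fixes \<eta> :: "'a::euclidean_space \<Rightarrow> real"
  assumes \<eta>: "\<eta> \<in> test_functions B" and B: "bounded B" "open B"
  obtains C where "C \<ge> 0" "\<And>h. smooth h \<Longrightarrow> enorm m UNIV (\<lambda>x. \<eta> x * h x) \<le> C * sob_sum m B h"
proof -
  let ?L = "\<lambda>n. {bs. bs \<in> lists (Basis :: 'a set) \<and> length bs \<le> n}" and ?M = "lebesgue_on B"
  have Bs: "B \<in> sets lebesgue" by (rule sets_lebesgue_open[OF B(2)])
  obtain C where C: "C \<ge> 0" "\<And>f. f \<in> sobolev_space m B \<Longrightarrow> finite_energy m B f \<and> enorm m B f \<le> C * sob_sum m B f"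
    by (rule sobolev_enorm_bound[OF B(2), of m]) blast
  \<comment> \<open>The membership condition is placed under the existential quantifier so that
    choice yields a constant \<open>D bs\<close> for every list.\<close>
  have exD: "\<exists>D. bs \<in> lists Basis \<longrightarrow> D \<ge> 0 \<and> (\<forall>v. smooth v \<longrightarrow> (\<forall>cs\<in>lists Basis. square_integrable ?M (partials cs v)) \<longrightarrow>
      l2norm ?M (partials bs (\<lambda>x. \<eta> x * v x)) \<le> D * (\<Sum>cs\<in>?L (length bs). l2norm ?M (partials cs v)))" for bs
  proof (cases "bs \<in> lists Basis")
    case True
    show ?thesis by (rule l2norm_partials_mult_bound[OF test_functions_UNIV[OF \<eta>] True Bs]) blast
  qed simp
  obtain D where DD: "\<forall>bs. bs \<in> lists Basis \<longrightarrow> D bs \<ge> 0 \<and> (\<forall>v. smooth v \<longrightarrow> (\<forall>cs\<in>lists Basis. square_integrable ?M (partials cs v)) \<longrightarrow>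
      l2norm ?M (partials bs (\<lambda>x. \<eta> x * v x)) \<le> D bs * (\<Sum>cs\<in>?L (length bs). l2norm ?M (partials cs v)))"
    using choice[OF allI[OF exD]] by (rule exE)
  have D: "\<And>bs. bs \<in> lists Basis \<Longrightarrow> D bs \<ge> 0"
    "\<And>bs v. bs \<in> lists Basis \<Longrightarrow> smooth v \<Longrightarrow> (\<forall>cs\<in>lists Basis. square_integrable ?M (partials cs v)) \<Longrightarrow>
      l2norm ?M (partials bs (\<lambda>x. \<eta> x * v x)) \<le> D bs * (\<Sum>cs\<in>?L (length bs). l2norm ?M (partials cs v))"
    using DD by simp_all
  let ?K = "\<Sum>bs\<in>?L m. D bs"
  have bd: "enorm m UNIV (\<lambda>x. \<eta> x * h x) \<le> (C * ?K) * sob_sum m B h" if h: "smooth h" for h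
  proof -
    have t: "(\<lambda>x. \<eta> x * h x) \<in> test_functions B" using test_functions_mult[OF \<eta> h] by (simp add: mult.commute)
    have sm: "smooth (\<lambda>x. \<eta> x * h x)" by (rule test_functions_smooth[OF t])
    have "enorm m UNIV (\<lambda>x. \<eta> x * h x) = enorm m B (\<lambda>x. \<eta> x * h x)"
      using enorm_test_function_eq[OF B(2) t] by simp
    also have "\<dots> \<le> C * sob_sum m B (\<lambda>x. \<eta> x * h x)" using C(2)[OF test_functions_sobolev_space[OF B(2) t]] by blast
    also have "sob_sum m B (\<lambda>x. \<eta> x * h x) \<le> (\<Sum>bs\<in>?L m. D bs * sob_sum m B h)"
      unfolding sob_sum_def[of m B "\<lambda>x. \<eta> x * h x"]
    proof (rule sum_mono)
      fix bs assume "bs \<in> ?L m"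
      then have bs: "bs \<in> lists Basis" "length bs \<le> m" by auto
      have "l2norm ?M (weak_partials B bs (\<lambda>x. \<eta> x * h x)) = l2norm ?M (partials bs (\<lambda>x. \<eta> x * h x))"
        by (rule weak_partials_smooth(2)[OF B(2) sm bs(1)])
      also have "\<dots> \<le> D bs * (\<Sum>cs\<in>?L (length bs). l2norm ?M (partials cs h))"
        by (intro D(2) bs h ballI smooth_square_integrable_bounded smooth_partials B)
      also have "(\<Sum>cs\<in>?L (length bs). l2norm ?M (partials cs h)) = (\<Sum>cs\<in>?L (length bs). l2norm ?M (weak_partials B cs h))"
        by (intro sum.cong refl) (simp add: weak_partials_smooth(2)[OF B(2) h])
      also have "D bs * (\<Sum>cs\<in>?L (length bs). l2norm ?M (weak_partials B cs h)) \<le> D bs * sob_sum m B h"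
        unfolding sob_sum_def using bs by (intro mult_left_mono D(1) sum_mono2) auto
      finally show "l2norm ?M (weak_partials B bs (\<lambda>x. \<eta> x * h x)) \<le> D bs * sob_sum m B h" .
    qed
    finally show ?thesis using C(1) by (simp add: mult_left_mono sum_distrib_right[symmetric] mult.assoc)
  qed
  have "?K \<ge> 0" using D(1) by (intro sum_nonneg) auto
  then show thesis using C(1) by (intro that[OF _ bd]) simp
qed

definition rescale :: "nat \<Rightarrow> real \<Rightarrow> ('a::euclidean_space \<Rightarrow> real) \<Rightarrow> 'a \<Rightarrow> real" where
  "rescale \<gamma> \<epsilon> v x = v (\<epsilon> *\<^sub>R x) / \<epsilon> ^ \<gamma>"

lemma test_functions_rescale:
  assumes "v \<in> test_functions U" "\<epsilon> > 0" "\<And>x. x \<in> U \<Longrightarrow> (1 / \<epsilon>) *\<^sub>R x \<in> W"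
  shows "rescale \<gamma> \<epsilon> v \<in> test_functions W"
proof -
  have "(\<lambda>x. v (\<epsilon> *\<^sub>R x)) \<in> test_functions W"
    using assms by (intro test_functions_scale[of v U]) auto
  from test_functions_cmult[OF this, of "1 / \<epsilon> ^ \<gamma>"] show ?thesis by (simp add: rescale_def[abs_def])
qed

text \<open>The dilation contributes the exponent N - 2m to the energy, and the division by
  \<open>\<epsilon> ^ \<gamma>\<close> contributes 2 \<gamma>. The assumption on m keeps the
  subtraction of natural numbers from being truncated.\<close>

lemma enorm_rescale:
  fixes v :: "'a::euclidean_space \<Rightarrow> real"
  assumes v: "v \<in> test_functions U" and \<epsilon>: "\<epsilon> > 0" and m: "2 * m < DIM('a)"
  shows "enorm m UNIV v = sqrt (\<epsilon> ^ (DIM('a) - 2 * m + 2 * \<gamma>)) * enorm m UNIV (rescale \<gamma> \<epsilon> v)"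
proof -
  let ?s = "\<lambda>x. v (\<epsilon> *\<^sub>R x)"
  have s: "?s \<in> test_functions UNIV" using \<epsilon> by (intro test_functions_scale[OF v]) auto
  have r: "rescale \<gamma> \<epsilon> v \<in> test_functions UNIV" using \<epsilon> by (intro test_functions_rescale[OF v]) auto
  have 1: "hessian_energy m (rescale \<gamma> \<epsilon> v) = (1 / \<epsilon> ^ \<gamma>)\<^sup>2 * hessian_energy m ?s"
  proof -
    have e: "rescale \<gamma> \<epsilon> v = (\<lambda>x. (1 / \<epsilon> ^ \<gamma>) * ?s x)" by (simp add: rescale_def[abs_def])
    have "partials bs (rescale \<gamma> \<epsilon> v) = (\<lambda>x. (1 / \<epsilon> ^ \<gamma>) * partials bs ?s x)" if "bs \<in> basis_lists m" for bs
      unfolding e using that by (intro partials_cmult test_functions_smooth[OF s]) (simp add: basis_lists_def)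
    then show ?thesis unfolding hessian_energy_def sum_distrib_left by (intro sum.cong refl) (simp add: power_divide)
  qed
  have 2: "\<epsilon> ^ DIM('a) * hessian_energy m ?s = \<epsilon> ^ (2 * m) * hessian_energy m v"
    by (rule hessian_energy_scale[OF v \<epsilon>])
  have 3: "\<epsilon> ^ DIM('a) = \<epsilon> ^ (DIM('a) - 2 * m) * \<epsilon> ^ (2 * m)"
    using m by (simp flip: power_add)
  have "hessian_energy m v = \<epsilon> ^ (DIM('a) - 2 * m) * hessian_energy m ?s"
    using 2 \<epsilon> unfolding 3 by simp
  also have "hessian_energy m ?s = \<epsilon> ^ (2 * \<gamma>) * hessian_energy m (rescale \<gamma> \<epsilon> v)"
    using \<epsilon> unfolding 1 by (simp add: power_one_over power_even_eq)
  finally have "hessian_energy m v = \<epsilon> ^ (DIM('a) - 2 * m + 2 * \<gamma>) * hessian_energy m (rescale \<gamma> \<epsilon> v)"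
    by (simp add: power_add)
  then have "(enorm m UNIV v)\<^sup>2 = (sqrt (\<epsilon> ^ (DIM('a) - 2 * m + 2 * \<gamma>)) * enorm m UNIV (rescale \<gamma> \<epsilon> v))\<^sup>2"
    using \<epsilon> by (simp add: enorm_test_function_UNIV[OF v] enorm_test_function_UNIV[OF r] power_mult_distrib)
  then show ?thesis using \<epsilon> power2_eq_imp_eq by fastforce
qed

text \<open>
  The two comparisons below rest on the same pair of approximations: with \<open>v\<close> a test function close to \<open>u\<close>
  and \<open>\<psi>\<close> one vanishing near \<open>\<epsilon> K\<close>, the functions \<open>v + \<psi>\<close> and \<open>\<eta> U + \<phi>\<close>, where
  \<open>\<phi> = \<psi>\<^sub>\<epsilon> + (1 - \<eta>) v\<^sub>\<epsilon>\<close>, differ after rescaling by \<open>\<eta> (U - v\<^sub>\<epsilon>)\<close> only.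
\<close>

locale blowup_comparison =
  fixes m \<gamma> :: nat and \<Omega> K B V :: "'a::euclidean_space set" and u U \<eta> :: "'a \<Rightarrow> real" and C :: real
  assumes m: "2 * m < DIM('a)" and \<Omega>: "open \<Omega>" and B: "bounded B" "open B"
    and u: "u \<in> sobolev0 m \<Omega> \<Omega>" and U: "smooth U" and \<eta>: "\<eta> \<in> test_functions B"
    and V: "open V" "K \<subseteq> V" "\<And>x. x \<in> V \<Longrightarrow> \<eta> x = 1"
    and C: "C \<ge> 0" "\<And>h. smooth h \<Longrightarrow> enorm m UNIV (\<lambda>x. \<eta> x * h x) \<le> C * sob_sum m B h"
begin

abbreviation "gap \<epsilon> \<equiv> sob_sum m B (\<lambda>x. rescale \<gamma> \<epsilon> u x - U x)"

lemma smooth_\<eta>: "smooth \<eta>"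
  by (rule test_functions_smooth[OF \<eta>])

text \<open>The constant \<open>D\<close> combines the amplitude factor with the cost of dilating a
  Sobolev norm, and it is unbounded as \<epsilon> tends to 0. This is harmless because
  \<open>v\<close> approaches u while \<epsilon> is fixed.\<close>

lemma rescale_gap:
  assumes \<epsilon>: "\<epsilon> > 0" and sub: "\<And>x. x \<in> B \<Longrightarrow> \<epsilon> *\<^sub>R x \<in> \<Omega>"
  obtains D where "D \<ge> 0"
    "\<And>v. v \<in> test_functions \<Omega> \<Longrightarrow> sob_sum m B (\<lambda>x. rescale \<gamma> \<epsilon> v x - U x) \<le> D * sob_sum m \<Omega> (\<lambda>x. v x - u x) + gap \<epsilon>"
proof -
  let ?D = "(1 / \<epsilon> ^ \<gamma>) * ((1 + \<epsilon>) ^ m * sqrt (1 / \<epsilon> ^ DIM('a)))"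
  note us = sobolev0_sobolev_space[OF u]
  have bd: "sob_sum m B (\<lambda>x. rescale \<gamma> \<epsilon> v x - U x) \<le> ?D * sob_sum m \<Omega> (\<lambda>x. v x - u x) + gap \<epsilon>"
    if v: "v \<in> test_functions \<Omega>" for v
  proof -
    let ?d = "\<lambda>x. v x - u x"
    have ds: "?d \<in> sobolev_space m \<Omega>" by (intro sobolev_space_diff(1) \<Omega> us test_functions_sobolev_space[OF \<Omega> v])
    note sc = sobolev_space_scale[OF ds \<epsilon> sub \<Omega> B(2)]
    have "(\<lambda>x. (1 / \<epsilon> ^ \<gamma>) * u (\<epsilon> *\<^sub>R x) + (- U x)) \<in> sobolev_space m B"
      by (intro sobolev_space_linear(1) B sobolev_space_scale(1)[OF us \<epsilon> sub \<Omega>] smooth_sobolev_space_bounded smooth_uminus U)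
    then have g: "(\<lambda>x. rescale \<gamma> \<epsilon> u x - U x) \<in> sobolev_space m B" by (simp add: rescale_def)
    have "sob_sum m B (\<lambda>x. (1 / \<epsilon> ^ \<gamma>) * ?d (\<epsilon> *\<^sub>R x) + (rescale \<gamma> \<epsilon> u x - U x))
      \<le> \<bar>1 / \<epsilon> ^ \<gamma>\<bar> * sob_sum m B (\<lambda>x. ?d (\<epsilon> *\<^sub>R x)) + gap \<epsilon>"
      by (rule sobolev_space_linear(2)[OF B(2) sc(1) g])
    also have "\<dots> \<le> \<bar>1 / \<epsilon> ^ \<gamma>\<bar> * ((1 + \<epsilon>) ^ m * sqrt (1 / \<epsilon> ^ DIM('a)) * sob_sum m \<Omega> ?d) + gap \<epsilon>"
      by (intro add_right_mono mult_left_mono[OF sc(2)] abs_ge_zero)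
    \<comment> \<open>The error of \<open>v\<close> against the limit splits into the rescaled
      difference of \<open>v\<close> and u and the blow-up error of u.\<close>
    also have "(\<lambda>x. (1 / \<epsilon> ^ \<gamma>) * ?d (\<epsilon> *\<^sub>R x) + (rescale \<gamma> \<epsilon> u x - U x)) = (\<lambda>x. rescale \<gamma> \<epsilon> v x - U x)"
      using \<epsilon> by (auto simp: rescale_def field_simps)
    finally show ?thesis using \<epsilon> by (simp add: mult.assoc)
  qed
  show thesis by (rule that[OF _ bd]) (use \<epsilon> in auto)
qed

lemma cap_space_le_cap_domain:
  assumes \<epsilon>: "\<epsilon> > 0" and sub: "\<And>x. x \<in> B \<Longrightarrow> \<epsilon> *\<^sub>R x \<in> \<Omega>"
  shows "sqrt (cap_space m \<eta> K U) \<le> sqrt (cap_domain m \<Omega> ((*\<^sub>R) \<epsilon> ` K) u) / sqrt (\<epsilon> ^ (DIM('a) - 2 * m + 2 * \<gamma>)) + C * gap \<epsilon>"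
proof -
  let ?K = "(*\<^sub>R) \<epsilon> ` K" and ?S = "sqrt (\<epsilon> ^ (DIM('a) - 2 * m + 2 * \<gamma>))"
  have S: "?S > 0" using \<epsilon> by simp
  obtain D where D: "D \<ge> 0"
    "\<And>v. v \<in> test_functions \<Omega> \<Longrightarrow> sob_sum m B (\<lambda>x. rescale \<gamma> \<epsilon> v x - U x) \<le> D * sob_sum m \<Omega> (\<lambda>x. v x - u x) + gap \<epsilon>"
    by (rule rescale_gap[OF \<epsilon> sub]) (assumption, rule that, assumption, blast)
  \<comment> \<open>The approximation error \<open>t\<close> carries a factor depending on
    \<epsilon>; it is eliminated below by letting \<open>t\<close> tend to 0 at this fixed
    \<epsilon>.\<close>
  have key: "sqrt (cap_space m \<eta> K U) \<le> (sqrt (cap_domain m \<Omega> ?K u) / ?S + C * gap \<epsilon>) + (1 / ?S + C * D) * t"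
    if t: "t > 0" for t
  proof -
    obtain v \<psi> where v: "v \<in> test_functions \<Omega>" and \<psi>: "\<psi> \<in> test_functions (\<Omega> - ?K)"
      and vu: "sob_sum m \<Omega> (\<lambda>x. v x - u x) < t"
      and en: "enorm m \<Omega> (\<lambda>x. v x + \<psi> x) < sqrt (cap_domain m \<Omega> ?K u) + t"
      by (rule cap_domain_approx[OF \<Omega> u t]) blast
    let ?rv = "rescale \<gamma> \<epsilon> v" and ?r\<psi> = "rescale \<gamma> \<epsilon> \<psi>"
    have \<psi>\<Omega>: "\<psi> \<in> test_functions \<Omega>" using \<psi> test_functions_mono[of "\<Omega> - ?K" \<Omega>] by auto
    have vp: "(\<lambda>x. v x + \<psi> x) \<in> test_functions \<Omega>" by (rule test_functions_add[OF v \<psi>\<Omega>])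
    have r\<psi>: "?r\<psi> \<in> test_functions (- K)"
    proof (rule test_functions_rescale[OF \<psi> \<epsilon>])
      fix x assume x: "x \<in> \<Omega> - ?K"
      show "(1 / \<epsilon>) *\<^sub>R x \<in> - K"
      proof
        assume "(1 / \<epsilon>) *\<^sub>R x \<in> K"
        then have "\<epsilon> *\<^sub>R ((1 / \<epsilon>) *\<^sub>R x) \<in> ?K" by (rule imageI)
        then show False using x \<epsilon> by simp
      qed
    qed
    have rv: "?rv \<in> test_functions UNIV" by (rule test_functions_rescale[OF v \<epsilon>]) auto
    have rvs: "smooth ?rv" by (rule test_functions_smooth[OF rv])
    \<comment> \<open>The cutoff equals 1 on \<open>V\<close>, so the product vanishes off the
      compact set \<open>F - V\<close>, which misses \<open>K\<close>.\<close>
    have cut: "(\<lambda>x. (1 - \<eta> x) * ?rv x) \<in> test_functions (- K)"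
    proof -
      obtain F where F: "compact F" "\<And>x. x \<notin> F \<Longrightarrow> ?rv x = 0" by (rule test_functionsE[OF rv]) blast
      have "smooth (\<lambda>x. (1 - \<eta> x) * ?rv x)" by (intro smooth_mult smooth_diff smooth_const smooth_\<eta> rvs)
      moreover have "compact (F - V)" "F - V \<subseteq> - K" using F(1) V by (auto intro: compact_diff)
      moreover have "(1 - \<eta> x) * ?rv x = 0" if "x \<notin> F - V" for x using that F(2) V(3) by auto
      ultimately show ?thesis unfolding test_functions_iff by blast
    qed
    let ?\<phi> = "\<lambda>x. ?r\<psi> x + (1 - \<eta> x) * ?rv x"
    have \<phi>: "?\<phi> \<in> test_functions (- K)" by (rule test_functions_add[OF r\<psi> cut])
    let ?w = "\<lambda>x. ?rv x + ?r\<psi> x" and ?d = "\<lambda>x. \<eta> x * (U x - ?rv x)"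
    have w: "?w \<in> test_functions UNIV" by (rule test_functions_add[OF rv test_functions_UNIV[OF r\<psi>]])
    have dd: "?d \<in> test_functions UNIV"
      using test_functions_mult[OF test_functions_UNIV[OF \<eta>] smooth_diff[OF U rvs]] by (simp add: mult.commute)
    have "sqrt (cap_space m \<eta> K U) \<le> enorm m UNIV (\<lambda>x. \<eta> x * U x + ?\<phi> x)"
      by (rule cap_space_le[OF m test_functions_UNIV[OF \<eta>] U \<phi>])
    also have "(\<lambda>x. \<eta> x * U x + ?\<phi> x) = (\<lambda>x. ?w x + ?d x)" by (auto simp: algebra_simps)
    also have "enorm m UNIV (\<lambda>x. ?w x + ?d x) \<le> enorm m UNIV ?w + enorm m UNIV ?d"
      by (intro finite_energy_add(2) open_UNIV test_functions_finite_energy[of UNIV _ UNIV] w dd)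
    also have "enorm m UNIV ?d \<le> C * sob_sum m B (\<lambda>x. U x - ?rv x)"
      by (rule C(2)[OF smooth_diff[OF U rvs]])
    \<comment> \<open>Weak derivatives are chosen, so even a change of sign passes through
      linearity, here with coefficient -1 and the zero function added.\<close>
    also have "sob_sum m B (\<lambda>x. U x - ?rv x) \<le> sob_sum m B (\<lambda>x. ?rv x - U x)"
    proof -
      have "(\<lambda>x. ?rv x - U x) \<in> sobolev_space m B" "(\<lambda>_. 0) \<in> sobolev_space m B"
        by (intro smooth_sobolev_space_bounded B smooth_diff rvs U smooth_const)+
      from sobolev_space_linear(2)[OF B(2) this, of "-1"] 
      have "sob_sum m B (\<lambda>x. U x - ?rv x) \<le> sob_sum m B (\<lambda>x. ?rv x - U x) + sob_sum m B (\<lambda>_. 0)" by simp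
      then show ?thesis using sob_sum_zero[OF B(2)] by simp
    qed
    also have "\<dots> \<le> D * t + gap \<epsilon>"
      using D(2)[OF v] mult_left_mono[OF less_imp_le[OF vu] D(1)] by linarith
    finally have 1: "sqrt (cap_space m \<eta> K U) \<le> enorm m UNIV ?w + C * (D * t + gap \<epsilon>)"
      using C(1) by (simp add: mult_left_mono)
    have "enorm m \<Omega> (\<lambda>x. v x + \<psi> x) = enorm m UNIV (\<lambda>x. v x + \<psi> x)" by (rule enorm_test_function_eq[OF \<Omega> vp])
    also have "\<dots> = ?S * enorm m UNIV (rescale \<gamma> \<epsilon> (\<lambda>x. v x + \<psi> x))" by (rule enorm_rescale[OF vp \<epsilon> m])
    also have "rescale \<gamma> \<epsilon> (\<lambda>x. v x + \<psi> x) = ?w" by (auto simp: rescale_def add_divide_distrib)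
    finally have "enorm m UNIV ?w = enorm m \<Omega> (\<lambda>x. v x + \<psi> x) / ?S" using \<epsilon> by simp
    also have "\<dots> \<le> (sqrt (cap_domain m \<Omega> ?K u) + t) / ?S" using en S by (intro divide_right_mono) auto
    finally show ?thesis using 1 by (simp add: algebra_simps add_divide_distrib)
  qed
  let ?a = "sqrt (cap_domain m \<Omega> ?K u) / ?S + C * gap \<epsilon>" and ?b = "1 / ?S + C * D"
  have "((\<lambda>t. ?a + ?b * t) \<longlongrightarrow> ?a + ?b * 0) (at_right 0)" by (intro tendsto_intros)
  moreover have "\<forall>\<^sub>F t in at_right 0. sqrt (cap_space m \<eta> K U) \<le> ?a + ?b * t"
    using key by (auto simp: eventually_at_filter)
  ultimately show ?thesis using tendsto_lowerbound[of "\<lambda>t. ?a + ?b * t" "?a + ?b * 0" "at_right 0"] by simp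
qed

text \<open>The competitor in \<Omega> is \<open>\<eta>' * u + \<phi>'\<close>: it equals u near the
  scaled compact set, as the constraint requires, and follows the rescaled \<phi> elsewhere. The set
  \<open>W\<close> contains the support of \<phi>, so the two assumptions on it place the support of
  \<open>\<phi>'\<close> inside \<Omega> and off that compact set.\<close>

lemma cap_domain_le_cap_space:
  assumes \<epsilon>: "\<epsilon> > 0" and sub: "\<And>x. x \<in> B \<Longrightarrow> \<epsilon> *\<^sub>R x \<in> \<Omega>"
    and \<phi>: "\<phi> \<in> test_functions W" and W: "\<And>x. x \<in> W \<Longrightarrow> \<epsilon> *\<^sub>R x \<in> \<Omega>" "W \<inter> K = {}"
  shows "sqrt (cap_domain m \<Omega> ((*\<^sub>R) \<epsilon> ` K) u) / sqrt (\<epsilon> ^ (DIM('a) - 2 * m + 2 * \<gamma>)) \<le> enorm m UNIV (\<lambda>x. \<eta> x * U x + \<phi> x) + C * gap \<epsilon>"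
proof -
  let ?K = "(*\<^sub>R) \<epsilon> ` K" and ?S = "sqrt (\<epsilon> ^ (DIM('a) - 2 * m + 2 * \<gamma>))" and ?e = "enorm m UNIV (\<lambda>x. \<eta> x * U x + \<phi> x)"
  have S: "?S > 0" using \<epsilon> by simp
  note us = sobolev0_sobolev_space[OF u]
  obtain D where D: "D \<ge> 0"
    "\<And>v. v \<in> test_functions \<Omega> \<Longrightarrow> sob_sum m B (\<lambda>x. rescale \<gamma> \<epsilon> v x - U x) \<le> D * sob_sum m \<Omega> (\<lambda>x. v x - u x) + gap \<epsilon>"
    by (rule rescale_gap[OF \<epsilon> sub]) (assumption, rule that, assumption, blast)
  obtain E where E: "E \<ge> 0" "\<And>f. f \<in> sobolev_space m \<Omega> \<Longrightarrow> finite_energy m \<Omega> f \<and> enorm m \<Omega> f \<le> E * sob_sum m \<Omega> f"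
    by (rule sobolev_enorm_bound[OF \<Omega>, of m]) blast
  define \<eta>' where "\<eta>' x = \<eta> ((1 / \<epsilon>) *\<^sub>R x)" for x
  define \<phi>' where "\<phi>' x = \<epsilon> ^ \<gamma> * \<phi> ((1 / \<epsilon>) *\<^sub>R x)" for x
  have t\<eta>: "\<eta>' \<in> test_functions UNIV"
    unfolding \<eta>'_def[abs_def] by (rule test_functions_scale[OF \<eta>]) (use \<epsilon> in auto)
  have s\<eta>: "smooth \<eta>'" by (rule test_functions_smooth[OF t\<eta>])
  have img: "(*\<^sub>R) (1 / (1 / \<epsilon>)) ` W \<subseteq> \<Omega> - ?K"
  proof -
    have "\<epsilon> *\<^sub>R x \<notin> ?K" if "x \<in> W" for x using that W(2) \<epsilon> by auto
    then show ?thesis using W(1) by auto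
  qed
  have t\<phi>: "\<phi>' \<in> test_functions (\<Omega> - ?K)"
    unfolding \<phi>'_def[abs_def] by (rule test_functions_cmult, rule test_functions_scale[OF \<phi> _ img]) (use \<epsilon> in simp)
  have t\<phi>\<Omega>: "\<phi>' \<in> test_functions \<Omega>" using t\<phi> test_functions_mono[of "\<Omega> - ?K" \<Omega>] by auto
  obtain v where v: "\<And>n::nat. v n \<in> test_functions \<Omega>" and lim: "(\<lambda>n. sob_sum m \<Omega> (\<lambda>x. v n x - u x)) \<longlonglongrightarrow> 0"
    by (rule sobolev0_approx[OF u]) blast
  note mult = sobolev_space_mult[OF \<Omega> t\<eta> v us lim[folded sobolev_norm_tendsto_iff]]
  have lim2: "(\<lambda>n. sob_sum m \<Omega> (\<lambda>x. \<eta>' x * v n x - \<eta>' x * u x)) \<longlonglongrightarrow> 0"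
    using mult(2) unfolding sobolev_norm_tendsto_iff .
  have t\<eta>v: "(\<lambda>x. \<eta>' x * v n x) \<in> test_functions \<Omega>" for n by (rule test_functions_mult[OF v s\<eta>])
  let ?f = "\<lambda>x. \<eta>' x * u x + \<phi>' x"
  let ?fn = "\<lambda>n x. \<eta>' x * v n x + \<phi>' x"
  have fnt: "?fn n \<in> test_functions \<Omega>" for n by (rule test_functions_add[OF t\<eta>v t\<phi>\<Omega>])
  have fs: "?f \<in> sobolev_space m \<Omega>" by (intro sobolev_space_add(1) \<Omega> mult(1) test_functions_sobolev_space[OF \<Omega> t\<phi>])
  have fn: "(\<lambda>x. ?fn n x - ?f x) = (\<lambda>x. \<eta>' x * v n x - \<eta>' x * u x)" for n by auto
  have f0: "?f \<in> sobolev0 m \<Omega> \<Omega>"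
    by (rule sobolev0I[OF fs fnt]) (unfold fn, rule lim2)
  have "(\<lambda>x. ?f x - u x) \<in> sobolev0 m \<Omega> (\<Omega> - ?K)"
  \<comment> \<open>The difference \<open>?f - u\<close> equals
    \<open>(\<eta>' - 1) * u + \<phi>'\<close>. Replacing u by \<open>v n\<close> gives test
    functions off the scaled compact set, because \<open>\<eta>'\<close> is 1 on the scaled
    \<open>V\<close>.\<close>
  proof (rule sobolev0I[where \<phi>="\<lambda>n x. (\<eta>' x - 1) * v n x + \<phi>' x"])
    show fus: "(\<lambda>x. ?f x - u x) \<in> sobolev_space m \<Omega>" by (intro sobolev_space_diff(1) \<Omega> fs us)
    show "(\<lambda>x. (\<eta>' x - 1) * v n x + \<phi>' x) \<in> test_functions (\<Omega> - ?K)" for n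
    proof (rule test_functions_add[OF _ t\<phi>])
      obtain F where F: "compact F" "F \<subseteq> \<Omega>" "\<And>x. x \<notin> F \<Longrightarrow> v n x = 0" by (rule test_functionsE[OF v]) blast
      let ?V = "(*\<^sub>R) \<epsilon> ` V"
      have "open ?V" using V(1) \<epsilon> by (intro open_scaling) auto
      then have "compact (F - ?V)" "F - ?V \<subseteq> \<Omega> - ?K" using F V(2) by (auto intro: compact_diff)
      moreover have "(\<eta>' x - 1) * v n x = 0" if x: "x \<notin> F - ?V" for x
      proof (cases "x \<in> F")
        case True
        then obtain y where "y \<in> V" "x = \<epsilon> *\<^sub>R y" using x by auto
        then show ?thesis using V(3)[of y] \<epsilon> by (simp add: \<eta>'_def)
      qed (simp add: F(3))
      moreover have "smooth (\<lambda>x. (\<eta>' x - 1) * v n x)"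
        by (intro smooth_mult smooth_diff smooth_const s\<eta> test_functions_smooth[OF v])
      ultimately show "(\<lambda>x. (\<eta>' x - 1) * v n x) \<in> test_functions (\<Omega> - ?K)"
        unfolding test_functions_iff by blast
    qed
    have e: "(\<lambda>x. (\<eta>' x - 1) * v n x + \<phi>' x - (?f x - u x)) = (\<lambda>x. (\<eta>' x * v n x - \<eta>' x * u x) - (v n x - u x))" for n
      by (auto simp: algebra_simps)
    have "sob_sum m \<Omega> (\<lambda>x. (\<eta>' x - 1) * v n x + \<phi>' x - (?f x - u x))
      \<le> sob_sum m \<Omega> (\<lambda>x. \<eta>' x * v n x - \<eta>' x * u x) + sob_sum m \<Omega> (\<lambda>x. v n x - u x)" for n
      unfolding e
      by (intro sobolev_space_diff(2) sobolev_space_diff(1) \<Omega> test_functions_sobolev_space[OF \<Omega> t\<eta>v]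
          test_functions_sobolev_space[OF \<Omega> v] us mult(1))
    then have "\<forall>\<^sub>F n in sequentially. norm (sob_sum m \<Omega> (\<lambda>x. (\<eta>' x - 1) * v n x + \<phi>' x - (?f x - u x)))
      \<le> sob_sum m \<Omega> (\<lambda>x. \<eta>' x * v n x - \<eta>' x * u x) + sob_sum m \<Omega> (\<lambda>x. v n x - u x)" by simp
    moreover have "(\<lambda>n. sob_sum m \<Omega> (\<lambda>x. \<eta>' x * v n x - \<eta>' x * u x) + sob_sum m \<Omega> (\<lambda>x. v n x - u x)) \<longlonglongrightarrow> 0"
      using tendsto_add[OF lim2 lim] by simp
    ultimately show "(\<lambda>n. sob_sum m \<Omega> (\<lambda>x. (\<eta>' x - 1) * v n x + \<phi>' x - (?f x - u x))) \<longlonglongrightarrow> 0"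
      by (rule Lim_null_comparison)
  qed
  then have "sqrt (cap_domain m \<Omega> ?K u) \<le> enorm m \<Omega> ?f" by (rule cap_domain_le[OF f0])
  \<comment> \<open>The scaling identity holds for test functions, so the energy is estimated for
    \<open>?fn n\<close> first; the limit in \<open>n\<close> at fixed \<epsilon> removes the terms
    with \<open>D\<close> and \<open>E\<close>.\<close>
  also have "enorm m \<Omega> ?f \<le> ?S * (?e + C * gap \<epsilon>)"
  proof (rule LIMSEQ_le_const)
    let ?x = "\<lambda>n. sob_sum m \<Omega> (\<lambda>x. v n x - u x)" and ?y = "\<lambda>n. sob_sum m \<Omega> (\<lambda>x. \<eta>' x * v n x - \<eta>' x * u x)"
    have "(\<lambda>n. ?S * (?e + C * (D * ?x n + gap \<epsilon>)) + E * ?y n) \<longlonglongrightarrow> ?S * (?e + C * (D * 0 + gap \<epsilon>)) + E * 0"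
      by (intro tendsto_intros lim lim2)
    then show "(\<lambda>n. ?S * (?e + C * (D * ?x n + gap \<epsilon>)) + E * ?y n) \<longlonglongrightarrow> ?S * (?e + C * gap \<epsilon>)" by simp
    have "enorm m \<Omega> ?f \<le> ?S * (?e + C * (D * ?x n + gap \<epsilon>)) + E * ?y n" for n
    proof -
      let ?rv = "rescale \<gamma> \<epsilon> (v n)"
      have rvs: "smooth ?rv"
        by (rule test_functions_smooth[of _ UNIV], rule test_functions_rescale[OF v \<epsilon>]) auto
      have fns: "?fn n \<in> sobolev_space m \<Omega>" by (rule test_functions_sobolev_space[OF \<Omega> fnt])
      have "enorm m \<Omega> ?f \<le> enorm m \<Omega> (?fn n) + enorm m \<Omega> (\<lambda>x. ?f x - ?fn n x)"
        using E(2)[OF fs] E(2)[OF fns] by (intro enorm_triangle_diff \<Omega>) auto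
      moreover have "enorm m \<Omega> (\<lambda>x. ?f x - ?fn n x) \<le> E * ?y n"
      proof -
        have d: "(\<lambda>x. \<eta>' x * v n x - \<eta>' x * u x) \<in> sobolev_space m \<Omega>" "(\<lambda>_. 0) \<in> sobolev_space m \<Omega>"
          by (intro sobolev_space_diff(1) \<Omega> test_functions_sobolev_space[OF \<Omega> t\<eta>v] mult(1) sobolev0_sobolev_space[OF zero_sobolev0[OF \<Omega>]])+
        have fd: "finite_energy m \<Omega> (\<lambda>x. \<eta>' x * v n x - \<eta>' x * u x)" "finite_energy m \<Omega> (\<lambda>_. 0)" "enorm m \<Omega> (\<lambda>_. 0) = 0"
          using E(2)[OF d(1)] E(2)[OF d(2)] enorm_test_function_eq[OF \<Omega>, of "\<lambda>_. 0" m] enorm_zero[of m]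
          by (auto simp: test_functions_iff smooth_const exI[of _ "{}"])
        have "enorm m \<Omega> (\<lambda>x. (-1) * (\<eta>' x * v n x - \<eta>' x * u x) + 0) \<le> \<bar>-1\<bar> * enorm m \<Omega> (\<lambda>x. \<eta>' x * v n x - \<eta>' x * u x) + enorm m \<Omega> (\<lambda>_. 0)"
          by (rule finite_energy_linear(2)[OF \<Omega> fd(1,2)])
        also have "(\<lambda>x. (-1) * (\<eta>' x * v n x - \<eta>' x * u x) + 0) = (\<lambda>x. ?f x - ?fn n x)" by auto
        finally show ?thesis using E(2)[OF d(1)] fd(3) by simp
      qed
      moreover have "enorm m \<Omega> (?fn n) \<le> ?S * (?e + C * (D * ?x n + gap \<epsilon>))"
      proof -
        have "enorm m \<Omega> (?fn n) = enorm m UNIV (?fn n)" by (rule enorm_test_function_eq[OF \<Omega> fnt])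
        also have "\<dots> = ?S * enorm m UNIV (rescale \<gamma> \<epsilon> (?fn n))" by (rule enorm_rescale[OF fnt \<epsilon> m])
        \<comment> \<open>At unit scale the competitor is the given one for the whole space plus a
          cutoff blow-up error.\<close>
        also have "rescale \<gamma> \<epsilon> (?fn n) = (\<lambda>x. (\<eta> x * U x + \<phi> x) + \<eta> x * (?rv x - U x))"
          using \<epsilon> by (auto simp: rescale_def \<eta>'_def \<phi>'_def field_simps)
        also have "enorm m UNIV (\<lambda>x. (\<eta> x * U x + \<phi> x) + \<eta> x * (?rv x - U x)) \<le> ?e + enorm m UNIV (\<lambda>x. \<eta> x * (?rv x - U x))"
        proof -
          have "(\<lambda>x. U x * \<eta> x) \<in> test_functions UNIV" "(\<lambda>x. (?rv x - U x) * \<eta> x) \<in> test_functions UNIV"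
            by (intro test_functions_mult test_functions_UNIV[OF \<eta>] U smooth_diff rvs)+
          then have "(\<lambda>x. \<eta> x * U x + \<phi> x) \<in> test_functions UNIV" "(\<lambda>x. \<eta> x * (?rv x - U x)) \<in> test_functions UNIV"
            using test_functions_add[OF _ test_functions_UNIV[OF \<phi>], of "\<lambda>x. U x * \<eta> x"] by (simp_all add: mult.commute)
          then show ?thesis by (intro finite_energy_add(2) open_UNIV test_functions_finite_energy[of UNIV _ UNIV])
        qed
        also have "enorm m UNIV (\<lambda>x. \<eta> x * (?rv x - U x)) \<le> C * sob_sum m B (\<lambda>x. ?rv x - U x)"
          by (rule C(2)[OF smooth_diff[OF rvs U]])
        also have "\<dots> \<le> C * (D * ?x n + gap \<epsilon>)" by (intro mult_left_mono D(2) v C(1))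
        finally show ?thesis using S by (simp add: mult_left_mono)
      qed
      ultimately show ?thesis by linarith
    qed
    then show "\<exists>N. \<forall>n\<ge>N. enorm m \<Omega> ?f \<le> ?S * (?e + C * (D * ?x n + gap \<epsilon>)) + E * ?y n" by blast
  qed
  finally show ?thesis using S by (simp add: pos_divide_le_eq mult.commute)
qed

end

lemma scaled_bounded_subset:
  fixes \<Omega> S :: "'a::real_normed_vector set"
  assumes "open \<Omega>" "0 \<in> \<Omega>" "bounded S"
  shows "\<forall>\<^sub>F \<epsilon> in at_right 0. \<forall>x\<in>S. \<epsilon> *\<^sub>R x \<in> \<Omega>"
proof -
  obtain d where d: "d > 0" "ball 0 d \<subseteq> \<Omega>" using assms by (meson open_contains_ball)
  obtain R where R: "R > 0" "\<And>x. x \<in> S \<Longrightarrow> norm x \<le> R" using assms(3) unfolding bounded_pos by blast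
  have "\<forall>\<^sub>F \<epsilon> in at_right 0. 0 < \<epsilon> \<and> \<epsilon> < d / R"
    using d(1) R(1) by (intro eventually_conj eventually_at_right_less eventually_at_rightI[of 0 "d / R"]) auto
  then show ?thesis
  proof eventually_elim
    case (elim \<epsilon>)
    have "\<epsilon> *\<^sub>R x \<in> \<Omega>" if "x \<in> S" for x
    proof -
      have "norm (\<epsilon> *\<^sub>R x) \<le> \<epsilon> * R" using elim R(2)[OF that] by (simp add: mult_left_mono)
      also have "\<dots> < d" using elim R(1) by (simp add: field_simps)
      finally show ?thesis using d(2) by auto
    qed
    then show ?case by blast
  qed
qed

theorem theorem1p3:
  fixes m \<gamma> :: nat
    and \<Omega> \<K> :: "'a::euclidean_space set"
    and lam\<^sub>J :: real
    and u\<^sub>J U\<^sub>0 :: "'a \<Rightarrow> real"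
  assumes "m \<ge> 2" and "DIM('a) > 2 * m"
    and "bounded_smooth_domain \<Omega>" and "0 \<in> \<Omega>"
    and "compact \<K>"
    and "dirichlet_eigenpair m \<Omega> lam\<^sub>J u\<^sub>J" and "Lp_norm 2 \<Omega> u\<^sub>J = 1"
    and "blowup_limit m u\<^sub>J \<gamma> U\<^sub>0"
  shows "\<forall>\<eta>. cutoff \<K> \<eta> \<longrightarrow>
           (\<exists>r \<in> o[at_right 0](\<lambda>_. 1). \<forall>\<^sub>F \<epsilon> in at_right 0.
              cap_domain m \<Omega> ((*\<^sub>R) \<epsilon> ` \<K>) u\<^sub>J
                = \<epsilon> ^ (DIM('a) - 2 * m + 2 * \<gamma>) * (cap_space m \<eta> \<K> U\<^sub>0 + r \<epsilon>))"
proof (intro allI impI)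
  fix \<eta> assume cut: "cutoff \<K> \<eta>"
  have m: "2 * m < DIM('a)" by (rule assms(2))
  have \<Omega>: "open \<Omega>" using assms(3) by (simp add: bounded_smooth_domain_def)
  have u: "u\<^sub>J \<in> sobolev0 m \<Omega> \<Omega>" using assms(6) by (simp add: dirichlet_eigenpair_def)
  have U: "smooth U\<^sub>0" using assms(8) by (intro smooth_real_polynomial_function) (simp add: blowup_limit_def)
  have \<eta>U: "\<eta> \<in> test_functions UNIV" using cut by (simp add: cutoff_def)
  obtain V where V: "open V" "\<K> \<subseteq> V" "\<forall>x\<in>V. \<eta> x = 1" using cut by (auto simp: cutoff_def)
  obtain F where F: "compact F" "\<And>x. x \<notin> F \<Longrightarrow> \<eta> x = 0" by (rule test_functionsE[OF \<eta>U]) blast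
  obtain R where R: "R > 0" "\<And>x. x \<in> F \<Longrightarrow> norm x \<le> R"
    using compact_imp_bounded[OF F(1)] unfolding bounded_pos by blast
  let ?B = "ball (0 :: 'a) (R + 1)"
  have FB: "F \<subseteq> ?B" using R(2) by force
  have \<eta>: "\<eta> \<in> test_functions ?B"
    using F FB test_functions_smooth[OF \<eta>U] unfolding test_functions_iff by blast
  have B: "bounded ?B" "open ?B" by auto
  \<comment> \<open>\<open>C\<close> is fixed before \<epsilon> and depends on the cutoff and the
    ball only, so the blow-up limit makes \<open>C * gap \<epsilon>\<close> tend to 0.\<close>
  obtain C where C: "C \<ge> 0" "\<And>h. smooth h \<Longrightarrow> enorm m UNIV (\<lambda>x. \<eta> x * h x) \<le> C * sob_sum m ?B h"
    by (rule enorm_mult_cutoff_bound[OF \<eta> B, of m]) blast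
  interpret blowup_comparison m \<gamma> \<Omega> \<K> ?B V u\<^sub>J U\<^sub>0 \<eta> C
    using m \<Omega> B u U \<eta> V C by unfold_locales auto
  let ?X = "sqrt (cap_space m \<eta> \<K> U\<^sub>0)" and ?d = "\<lambda>\<epsilon>. cap_domain m \<Omega> ((*\<^sub>R) \<epsilon> ` \<K>) u\<^sub>J"
  let ?c = "\<lambda>\<epsilon>. sqrt (?d \<epsilon>) / sqrt (\<epsilon> ^ (DIM('a) - 2 * m + 2 * \<gamma>))" and ?p = "\<lambda>\<epsilon>::real. \<epsilon> ^ (DIM('a) - 2 * m + 2 * \<gamma>)"
  have pos: "\<forall>\<^sub>F \<epsilon> in at_right 0. (0::real) < \<epsilon>" by (simp add: eventually_at_right_less)
  have sB: "\<forall>\<^sub>F \<epsilon> in at_right 0. \<forall>x\<in>?B. \<epsilon> *\<^sub>R x \<in> \<Omega>" by (rule scaled_bounded_subset[OF \<Omega> assms(4) B(1)])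
  have "((\<lambda>\<epsilon>. sobolev_norm m ?B (\<lambda>x. u\<^sub>J (\<epsilon> *\<^sub>R x) / \<epsilon> ^ \<gamma> - U\<^sub>0 x)) \<longlongrightarrow> 0) (at_right 0)"
    using assms(8) R(1) by (simp add: blowup_limit_def)
  then have gap: "((\<lambda>\<epsilon>. C * gap \<epsilon>) \<longlongrightarrow> 0) (at_right 0)"
    by (intro tendsto_mult_right_zero) (simp add: sobolev_norm_tendsto_iff rescale_def)
  have lim: "(?c \<longlongrightarrow> ?X) (at_right 0)"
  proof (rule tendstoI)
    fix e :: real assume e: "e > 0"
    then have e2: "e / 2 > 0" by simp
    \<comment> \<open>This almost optimal \<phi> depends on \<open>e\<close> but not on \<epsilon>;
      its compact support therefore fits into \<Omega> after scaling for all small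
      \<epsilon>.\<close>
    obtain \<phi> where \<phi>: "\<phi> \<in> test_functions (- \<K>)" "enorm m UNIV (\<lambda>x. \<eta> x * U\<^sub>0 x + \<phi> x) < ?X + e / 2"
      by (rule cap_space_approx[OF m \<eta>U U e2]) blast
    obtain W where W: "compact W" "W \<subseteq> - \<K>" "\<And>x. x \<notin> W \<Longrightarrow> \<phi> x = 0" by (rule test_functionsE[OF \<phi>(1)]) blast
    \<comment> \<open>The compact support itself serves as the underlying set, since
      \<open>test_functions\<close> does not ask for an open one.\<close>
    have \<phi>W: "\<phi> \<in> test_functions W" unfolding test_functions_iff using W test_functions_smooth[OF \<phi>(1)] by blast
    have sW: "\<forall>\<^sub>F \<epsilon> in at_right 0. \<forall>x\<in>W. \<epsilon> *\<^sub>R x \<in> \<Omega>"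
      by (rule scaled_bounded_subset[OF \<Omega> assms(4) compact_imp_bounded[OF W(1)]])
    have "\<forall>\<^sub>F \<epsilon> in at_right 0. C * gap \<epsilon> < e / 2" using gap e2 by (rule order_tendstoD)
    with pos sB sW show "\<forall>\<^sub>F \<epsilon> in at_right 0. dist (?c \<epsilon>) ?X < e"
    proof eventually_elim
      case (elim \<epsilon>)
      have "?X \<le> ?c \<epsilon> + C * gap \<epsilon>" by (rule cap_space_le_cap_domain) (use elim in auto)
      moreover have "?c \<epsilon> \<le> enorm m UNIV (\<lambda>x. \<eta> x * U\<^sub>0 x + \<phi> x) + C * gap \<epsilon>"
        by (rule cap_domain_le_cap_space[OF _ _ \<phi>W]) (use elim W(2) in auto)
      ultimately show ?case using \<phi>(2) elim e by (simp add: dist_real_def abs_less_iff)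
    qed
  qed
  \<comment> \<open>The remainder is forced by the claimed identity; it tends to 0 because
    \<open>?c\<close> converges to \<open>?X\<close> and the squares of both recover the
    capacities.\<close>
  define r where "r \<epsilon> = ?d \<epsilon> / ?p \<epsilon> - cap_space m \<eta> \<K> U\<^sub>0" for \<epsilon>
  have "((\<lambda>\<epsilon>. (?c \<epsilon>)\<^sup>2 - ?X\<^sup>2) \<longlongrightarrow> ?X\<^sup>2 - ?X\<^sup>2) (at_right 0)" by (intro tendsto_intros lim)
  moreover have "\<forall>\<^sub>F \<epsilon> in at_right 0. (?c \<epsilon>)\<^sup>2 - ?X\<^sup>2 = r \<epsilon>"
    using pos by eventually_elim
      (simp add: r_def power_divide cap_domain_nonneg[OF \<Omega> u] cap_space_nonneg[OF m \<eta>U U])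
  ultimately have "(r \<longlongrightarrow> 0) (at_right 0)" using Lim_transform_eventually by fastforce
  then have "r \<in> o[at_right 0](\<lambda>_. 1)" by (intro smalloI_tendsto) auto
  moreover have "\<forall>\<^sub>F \<epsilon> in at_right 0. ?d \<epsilon> = ?p \<epsilon> * (cap_space m \<eta> \<K> U\<^sub>0 + r \<epsilon>)"
    using pos by eventually_elim (simp add: r_def)
  ultimately show "\<exists>r \<in> o[at_right 0](\<lambda>_. 1). \<forall>\<^sub>F \<epsilon> in at_right 0. ?d \<epsilon> = ?p \<epsilon> * (cap_space m \<eta> \<K> U\<^sub>0 + r \<epsilon>)"
    by blast
qed

end
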